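(* Let $p\ge 2$ and $\frac p2\le r\le p$. Then there exists a positive number $\alpha_C=\alpha_C(p,r)$ such that: (1) if $\alpha<\alpha_C$, then $\lambda_\alpha(p,r)<\pi_p^p$, and any minimizer $y$ of $\lambda_\alpha(p,r)$ has constant sign in $]-1,1[$; (2) if $\alpha\ge\alpha_C$, then $\lambda_\alpha(p,r)=\pi_p^p$. Moreover, if $\alpha>\alpha_C$, the function $y(x)=\sin_p(\pi_p x)$, $x\in[-1,1]$, is the unique minimizer, up to a multiplicative constant, of $\lambda_\alpha(p,r)$; hence it is odd, $\int_{-1}^{1}|y(x)|^{r-1}y(x)\,dx=0$, and $\overline x=0$ is the only point in $]-1,1[$ such that $y(\overline x)=0$.
   Context: For $\alpha\in\mathbb{R}$, $p\ge2$, $\frac p2\le r\le p$, and real-valued $u\in W_0^{1,p}(-1,1)$, $u\not\equiv0$, set $$\mathcal Q_\alpha[u]=\frac{\int_{-1}^1|u'|^p\,dx+\alpha\left|\int_{-1}^1|u|^{r-1}u\,dx\right|^{p/r}}{\int_{-1}^1|u|^p\,dx},\qquad \lambda_\alpha(p,r)=\inf\{\mathcal Q_\alpha[u]:u\in W_0^{1,p}(-1,1),\ u\not\equiv0\}.$$ A minimizer of $\lambda_\alpha(p,r)$ is a function $y\in W_0^{1,p}(-1,1)$, $y\not\equiv0$, with $\mathcal Q_\alpha[y]=\lambda_\alpha(p,r)$. $$\pi_p=2\int_0^{(p-1)^{1/p}}\frac{dt}{[1-t^p/(p-1)]^{1/p}}=2\pi\frac{(p-1)^{1/p}}{p\sin(\pi/p)}.$$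 Let $F_p(x)=\int_0^x\frac{dt}{[1-t^p/(p-1)]^{1/p}}$ for $x\in[0,(p-1)^{1/p}]$ and let $z:[0,\pi_p/2]\to[0,(p-1)^{1/p}]$ be its inverse. The function $\sin_p$ is defined by $\sin_p(t)=z(t)$ for $t\in[0,\pi_p/2]$, $\sin_p(t)=z(\pi_p-t)$ for $t\in[\pi_p/2,\pi_p]$, $\sin_p(t)=-\sin_p(-t)$ for $t\in[-\pi_p,0]$, and extended to $\mathbb{R}$ with period $2\pi_p$. *)

theory Defs
  imports "HOL-Analysis.Analysis"
begin

section \<open>The Sobolev space $W_0^{1,p}(-1,1)$\<close>

text \<open>
  Sobolev functions are represented by total functions \<open>real \<Rightarrow> real\<close>, of which only the
  values on the interval \<open>]-1,1[\<close>, up to Lebesgue-null sets, matter.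
\<close>

abbreviation Omega :: "real set" where
  "Omega \<equiv> {-1<..<1}"

abbreviation leb_Omega :: "real measure" where
  "leb_Omega \<equiv> lebesgue_on Omega"

definition test_function :: "(real \<Rightarrow> real) \<Rightarrow> bool" where
  "test_function \<phi> \<longleftrightarrow>
     (\<forall>n x. ((deriv ^^ n) \<phi>) differentiable (at x)) \<and>
     (\<exists>K. compact K \<and> K \<subseteq> Omega \<and> (\<forall>x. x \<notin> K \<longrightarrow> \<phi> x = 0))"

definition locally_integrable :: "(real \<Rightarrow> real) \<Rightarrow> bool" where
  "locally_integrable f \<longleftrightarrow> (\<forall>K. compact K \<and> K \<subseteq> Omega \<longrightarrow> set_integrable lebesgue K f)"

definition has_weak_deriv :: "(real \<Rightarrow> real) \<Rightarrow> (real \<Rightarrow> real) \<Rightarrow> bool" where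
  "has_weak_deriv u g \<longleftrightarrow>
     locally_integrable u \<and> locally_integrable g \<and>
     (\<forall>\<phi>. test_function \<phi> \<longrightarrow>
        (LINT x|leb_Omega. u x * deriv \<phi> x) = - (LINT x|leb_Omega. g x * \<phi> x))"

text \<open>
  Weak derivatives are unique up to null sets, so the choice below does not affect any
  integral over \<open>Omega\<close>.
\<close>

definition weak_deriv :: "(real \<Rightarrow> real) \<Rightarrow> real \<Rightarrow> real" where
  "weak_deriv u = (SOME g. has_weak_deriv u g)"

definition Lp :: "real \<Rightarrow> (real \<Rightarrow> real) set" where
  "Lp p = {u. u \<in> borel_measurable leb_Omega \<and> integrable leb_Omega (\<lambda>x. \<bar>u x\<bar> powr p)}"

definition W1p :: "real \<Rightarrow> (real \<Rightarrow> real) set" where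
  "W1p p = {u \<in> Lp p. \<exists>g \<in> Lp p. has_weak_deriv u g}"

definition sobolev_norm :: "real \<Rightarrow> (real \<Rightarrow> real) \<Rightarrow> real" where
  "sobolev_norm p u =
     ((LINT x|leb_Omega. \<bar>u x\<bar> powr p) +
      (LINT x|leb_Omega. \<bar>weak_deriv u x\<bar> powr p)) powr (1 / p)"

text \<open>The closure of the test functions in the Sobolev norm.\<close>

definition W01p :: "real \<Rightarrow> (real \<Rightarrow> real) set" where
  "W01p p = {u \<in> W1p p. \<exists>\<phi>. (\<forall>n. test_function (\<phi> n)) \<and>
                (\<lambda>n. sobolev_norm p (\<lambda>x. \<phi> n x - u x)) \<longlonglongrightarrow> 0}"

definition W01p_nonzero :: "real \<Rightarrow> (real \<Rightarrow> real) set" where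
  "W01p_nonzero p = {u \<in> W01p p. \<not> (AE x in leb_Omega. u x = 0)}"


section \<open>The nonlocal eigenvalue problem\<close>

definition Q :: "real \<Rightarrow> real \<Rightarrow> real \<Rightarrow> (real \<Rightarrow> real) \<Rightarrow> real" where
  "Q p r \<alpha> u =
     ((LINT x|leb_Omega. \<bar>weak_deriv u x\<bar> powr p) +
      \<alpha> * \<bar>LINT x|leb_Omega. \<bar>u x\<bar> powr (r - 1) * u x\<bar> powr (p / r)) /
     (LINT x|leb_Omega. \<bar>u x\<bar> powr p)"

definition lambda_eig :: "real \<Rightarrow> real \<Rightarrow> real \<Rightarrow> real" where
  "lambda_eig p r \<alpha> = (INF u \<in> W01p_nonzero p. Q p r \<alpha> u)"

definition is_minimizer :: "real \<Rightarrow> real \<Rightarrow> real \<Rightarrow> (real \<Rightarrow> real) \<Rightarrow> bool" where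
  "is_minimizer p r \<alpha> y \<longleftrightarrow> y \<in> W01p_nonzero p \<and> Q p r \<alpha> y = lambda_eig p r \<alpha>"

text \<open>
  Pointwise statements about a Sobolev function refer to its (unique) continuous
  representative.  Constant sign on the open interval means that the representative is
  everywhere positive or everywhere negative there; in particular it has no zero.
\<close>

definition continuous_representative :: "(real \<Rightarrow> real) \<Rightarrow> (real \<Rightarrow> real) \<Rightarrow> bool" where
  "continuous_representative y w \<longleftrightarrow>
     continuous_on {-1..1} w \<and> (AE x in leb_Omega. y x = w x)"

definition has_constant_sign :: "(real \<Rightarrow> real) \<Rightarrow> bool" where
  "has_constant_sign y \<longleftrightarrow>
     (\<exists>w. continuous_representative y w \<and>
          ((\<forall>x \<in> Omega. w x > 0) \<or> (\<forall>x \<in> Omega. w x < 0)))"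


section \<open>Generalized trigonometric functions\<close>

definition F_p :: "real \<Rightarrow> real \<Rightarrow> real" where
  "F_p p x = (LBINT t:{0..x}. 1 / (1 - t powr p / (p - 1)) powr (1 / p))"

definition pi_p :: "real \<Rightarrow> real" where
  "pi_p p = 2 * (LBINT t:{0..(p - 1) powr (1 / p)}. 1 / (1 - t powr p / (p - 1)) powr (1 / p))"

definition z_p :: "real \<Rightarrow> real \<Rightarrow> real" where
  "z_p p = inv_into {0..(p - 1) powr (1 / p)} (F_p p)"

definition sin_p_period :: "real \<Rightarrow> real \<Rightarrow> real" where
  "sin_p_period p t =
     (let s = (\<lambda>t. if t \<le> pi_p p / 2 then z_p p t else z_p p (pi_p p - t))
      in if 0 \<le> t then s t else - s (- t))"

text \<open>
  The translation by a multiple of the period \<open>2 * pi_p p\<close> moves \<open>t\<close> into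
  \<open>[- pi_p p, pi_p p[\<close>, where \<open>sin_p_period\<close> is meaningful.
\<close>

definition sin_p :: "real \<Rightarrow> real \<Rightarrow> real" where
  "sin_p p t = sin_p_period p (t - 2 * pi_p p * of_int \<lfloor>(t + pi_p p) / (2 * pi_p p)\<rfloor>)"

end

theory Submission
  imports Defs
begin

text \<open>
  Let \<open>u\<close> be \<open>C\<^sup>1\<close> with maximum \<open>1\<close> and minimum \<open>- m\<close>, and let \<open>g s = A + R |s|^(r-1) s - |s|^p\<close> be the
  function of this shape that vanishes at \<open>1\<close> and \<open>- m\<close>. A solution of the Euler--Lagrange equation with
  this range satisfies \<open>|u'|^p = C g(u)\<close> with \<open>\<lambda> = (p - 1) C\<close>. If it is not of strictly constant sign, it
  runs through \<open>[- m, 1]\<close> twice within time \<open>2\<close>, so that \<open>C^(1/p)\<close> is at least the time integral of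
  \<open>g^(-1/p)\<close> over \<open>[- m, 1]\<close>. Comparing points of the positive and of the negative arc with equal
  \<open>|u'| / |u|\<close>, this time is smallest for \<open>m = 1\<close>, precisely because \<open>r \<ge> p / 2\<close>; hence \<open>\<lambda> \<ge> \<pi>_p^p\<close>.

  Existence of minimizers is never needed. By Young's inequality the functional is calibrated by
  \<open>g(u)\<close>, which bounds \<open>\<integral>|u'|^p - \<pi>_p^p \<integral>|u|^p\<close> from below by \<open>c R^2 - \<pi>_p^p R J\<close> with the nonlocal term
  \<open>J\<close>. Since \<open>p / r \<le> 2\<close>, a multiple of \<open>|J|^(p/r)\<close> absorbs this loss, so that \<open>\<lambda>\<close> saturates. Beyond
  the threshold a minimizer has \<open>J = 0\<close>, hence \<open>R = 0\<close>, and its first integral forces it to be the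
  generalized sine.
\<close>


section \<open>Smooth functions and cutoffs\<close>

text \<open>Two difficulties shape the argument. The time density \<open>gf^(-1/p)\<close> is
  singular exactly where an extremal turns, so the chain rule for a primitive composed with
  \<open>w\<close> breaks down there. It is applied to \<open>\<theta> * w\<close> with
  \<open>\<theta> < 1\<close> instead, which is harmless since
  \<open>\<theta>^p * g s \<le> g (\<theta> * s)\<close>. And a substitution carrying
  \<open>[- m, 1]\<close> to \<open>[-1, 1]\<close> leaves a Jacobian that is favourable on one arc
  only. The cure is to add to the target density an odd function of the new variable: this does not
  change the integral, and it can be chosen so that the comparison becomes pointwise. The device
  serves twice, for the time and for the action \<open>K m\<close>, where the leftover is a gain
  quadratic in \<open>R\<close>. The threshold is the infimum of all \<alpha> for which \<pi>_p^p is
  a lower bound of the functional. It belongs to this set because the quotient is affine in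
  \<alpha>, and it is positive because half a wave has constant sign and a Dirichlet quotient
  smaller by the factor 2^p.\<close>

definition smooth :: "(real \<Rightarrow> real) \<Rightarrow> bool" where
  "smooth f \<longleftrightarrow> (\<forall>n x. ((deriv ^^ n) f) differentiable (at x))"

text \<open>Finite-order form of \<open>smooth\<close>, so that closure under products and
  substitutions can be proved by induction, one derivative at a time.\<close>

definition diff_upto :: "nat \<Rightarrow> (real \<Rightarrow> real) \<Rightarrow> bool" where
  "diff_upto n f \<longleftrightarrow> (\<forall>k<n. \<forall>x. ((deriv ^^ k) f) differentiable (at x))"

lemma smooth_iff_diff_upto: "smooth f \<longleftrightarrow> (\<forall>n. diff_upto n f)"
  unfolding smooth_def diff_upto_def by auto

lemma diff_upto_0 [simp]: "diff_upto 0 f"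
  by (simp add: diff_upto_def)

lemma diff_upto_Suc:
  "diff_upto (Suc n) f \<longleftrightarrow> (\<forall>x. f differentiable (at x)) \<and> diff_upto n (deriv f)"
proof -
  have "diff_upto (Suc n) f \<longleftrightarrow> (\<forall>x. f differentiable (at x)) \<and>
      (\<forall>k<n. \<forall>x. ((deriv ^^ Suc k) f) differentiable (at x))"
    unfolding diff_upto_def by (subst All_less_Suc2) auto
  then show ?thesis
    by (simp add: diff_upto_def funpow_swap1)
qed

lemma diff_upto_SucD: "diff_upto (Suc n) f \<Longrightarrow> diff_upto n f"
  by (simp add: diff_upto_def)

lemma diff_upto_SucI:
  assumes "\<And>x. (f has_real_derivative f' x) (at x)" "diff_upto n f'"
  shows "diff_upto (Suc n) f"
proof -
  have "deriv f = f'"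
    using assms(1) by (auto intro: DERIV_imp_deriv)
  then show ?thesis
    using assms by (auto simp: diff_upto_Suc real_differentiable_def)
qed

lemma diff_upto_deriv:
  "diff_upto (Suc n) f \<Longrightarrow> (f has_real_derivative deriv f x) (at x)"
  by (simp add: diff_upto_Suc DERIV_deriv_iff_real_differentiable)

lemma diff_upto_const: "diff_upto n (\<lambda>x. c)"
proof (induction n arbitrary: c)
  case (Suc n)
  show ?case
    by (rule diff_upto_SucI[OF _ Suc[of 0]]) (auto intro!: derivative_eq_intros)
qed simp

lemma diff_upto_ident: "diff_upto n (\<lambda>x. x)"
  by (cases n) (auto intro!: diff_upto_SucI[OF _ diff_upto_const[of _ 1]] derivative_eq_intros)

lemma diff_upto_add: "diff_upto n f \<Longrightarrow> diff_upto n g \<Longrightarrow> diff_upto n (\<lambda>x. f x + g x)"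
proof (induction n arbitrary: f g)
  case (Suc n)
  show ?case
    by (rule diff_upto_SucI[OF DERIV_add[OF diff_upto_deriv diff_upto_deriv]])
      (use Suc in \<open>auto simp: diff_upto_Suc\<close>)
qed simp

lemma diff_upto_mult: "diff_upto n f \<Longrightarrow> diff_upto n g \<Longrightarrow> diff_upto n (\<lambda>x. f x * g x)"
proof (induction n arbitrary: f g)
  case (Suc n)
  have "diff_upto n (\<lambda>x. deriv f x * g x + deriv g x * f x)"
    using Suc.prems diff_upto_SucD[OF Suc.prems(1)] diff_upto_SucD[OF Suc.prems(2)]
    by (intro diff_upto_add Suc.IH) (auto simp: diff_upto_Suc)
  then show ?case
    by (rule diff_upto_SucI[OF DERIV_mult[OF diff_upto_deriv diff_upto_deriv], rotated 2])
      (use Suc in auto)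
qed simp

lemma diff_upto_affine: "diff_upto n f \<Longrightarrow> diff_upto n (\<lambda>x. f (c * x + d))"
proof (induction n arbitrary: f)
  case (Suc n)
  have 1: "((\<lambda>x. f (c * x + d)) has_real_derivative deriv f (c * x + d) * c) (at x)" for x
    by (rule DERIV_chain2[OF diff_upto_deriv[OF Suc.prems]]) (auto intro!: derivative_eq_intros)
  have 2: "diff_upto n (\<lambda>x. deriv f (c * x + d) * c)"
    by (intro diff_upto_mult diff_upto_const Suc.IH) (use Suc.prems diff_upto_Suc in blast)
  show ?case
    by (rule diff_upto_SucI[OF 1 2])
qed simp

lemma smooth_const: "smooth (\<lambda>x. c)"
  and smooth_ident: "smooth (\<lambda>x. x)"
  and smooth_add: "smooth f \<Longrightarrow> smooth g \<Longrightarrow> smooth (\<lambda>x. f x + g x)"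
  and smooth_mult: "smooth f \<Longrightarrow> smooth g \<Longrightarrow> smooth (\<lambda>x. f x * g x)"
  and smooth_affine: "smooth f \<Longrightarrow> smooth (\<lambda>x. f (c * x + d))"
  by (simp_all add: smooth_iff_diff_upto diff_upto_const diff_upto_ident diff_upto_add
      diff_upto_mult diff_upto_affine)

lemma smoothI:
  assumes "\<And>x. (f has_real_derivative f' x) (at x)" "smooth f'"
  shows "smooth f"
  unfolding smooth_iff_diff_upto
proof
  fix n show "diff_upto n f"
    using diff_upto_SucI[OF assms(1)] assms(2) by (cases n) (auto simp: smooth_iff_diff_upto)
qed

lemma smooth_deriv: "smooth f \<Longrightarrow> smooth (deriv f)"
  and smooth_has_deriv: "smooth f \<Longrightarrow> (f has_real_derivative deriv f x) (at x)"
  unfolding smooth_iff_diff_upto using diff_upto_Suc diff_upto_deriv by blast+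

lemma smooth_isCont: "smooth f \<Longrightarrow> isCont f x"
  using smooth_has_deriv DERIV_isCont by blast

lemma smooth_continuous_on: "smooth f \<Longrightarrow> continuous_on S f"
  using smooth_isCont continuous_at_imp_continuous_on by blast

lemma smooth_polynomial: "real_polynomial_function q \<Longrightarrow> smooth q"
proof (induction rule: real_polynomial_function.induct)
  case (linear f)
  then obtain c where "f = (\<lambda>x. x * c)"
    using real_bounded_linear by blast
  then show ?case by (simp add: smooth_mult smooth_ident smooth_const)
qed (auto intro: smooth_const smooth_add smooth_mult)

text \<open>The classical flat function exp(-1/x) with powers of 1/x. Differentiating one member
  gives a linear combination of the next two, so the family is closed under derivatives and
  smoothness follows by one induction with \<open>k\<close> left free.\<close>

definition flat_exp :: "nat \<Rightarrow> real \<Rightarrow> real" where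
  "flat_exp k x = (if x > 0 then (1 / x) ^ k * exp (- (1 / x)) else 0)"

lemma flat_exp_over_id_tendsto_0: "((\<lambda>x. flat_exp k x / x) \<longlongrightarrow> 0) (at 0)"
proof -
  have "((\<lambda>x::real. (1 / x) ^ Suc k / exp (1 / x)) \<longlongrightarrow> 0) (at_right 0)"
    using filterlim_compose[OF tendsto_power_div_exp_0 filterlim_inverse_at_top_right, of "Suc k"]
    by (simp add: inverse_eq_divide)
  then have "((\<lambda>x. flat_exp k x / x) \<longlongrightarrow> 0) (at_right 0)"
    by (rule Lim_transform_eventually)
      (auto simp: flat_exp_def eventually_at_filter exp_minus field_simps)
  moreover have "((\<lambda>x. flat_exp k x / x) \<longlongrightarrow> 0) (at_left 0)"
    by (rule Lim_transform_eventually[OF tendsto_const])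
      (auto simp: flat_exp_def eventually_at_filter)
  ultimately show ?thesis
    using filterlim_split_at by blast
qed

lemma flat_exp_has_derivative:
  "(flat_exp k has_real_derivative - (real k * flat_exp (Suc k) x) + flat_exp (Suc (Suc k)) x) (at x)"
proof -
  consider "x < 0" | "x = 0" | "x > 0" by linarith
  then show ?thesis
  proof cases
    case 1
    have "((\<lambda>x. 0) has_real_derivative 0) (at x)" by simp
    moreover have "\<forall>\<^sub>F y in nhds x. flat_exp k y = 0"
      using eventually_nhds_in_open[of "{..<0}" x] 1
      by (auto simp: flat_exp_def elim!: eventually_mono)
    ultimately show ?thesis
      using 1 by (subst DERIV_cong_ev[where g="\<lambda>x. 0"]) (auto simp: flat_exp_def)
  next
    case 2
    then show ?thesis
      using flat_exp_over_id_tendsto_0[of k]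
      by (simp add: DERIV_def flat_exp_def)
  next
    case 3
    have inv: "((\<lambda>x. 1 / x) has_real_derivative - (1 / x)\<^sup>2) (at x)"
      using 3 by (auto intro!: derivative_eq_intros simp: power2_eq_square)
    have "((\<lambda>x. (1 / x) ^ k) has_real_derivative - (real k * (1 / x) ^ Suc k)) (at x)"
      using DERIV_power_Suc[OF inv, of "k - 1"] 
      by (cases k) (auto simp: algebra_simps power2_eq_square)
    from DERIV_mult[OF this DERIV_fun_exp[OF DERIV_minus[OF inv]]]
    have "((\<lambda>x. (1 / x) ^ k * exp (- (1 / x))) has_real_derivative
       - (real k * flat_exp (Suc k) x) + flat_exp (Suc (Suc k)) x) (at x)"
      using 3 by (simp add: flat_exp_def algebra_simps power2_eq_square)
    moreover have "\<forall>\<^sub>F y in nhds x. flat_exp k y = (1 / y) ^ k * exp (- (1 / y))"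
      using eventually_nhds_in_open[of "{0<..}" x] 3
      by (auto simp: flat_exp_def elim!: eventually_mono)
    ultimately show ?thesis
      by (subst DERIV_cong_ev) auto
  qed
qed

lemma smooth_flat_exp: "smooth (flat_exp k)"
proof -
  have "diff_upto n (flat_exp k)" for n
  proof (induction n arbitrary: k)
    case (Suc n)
    have "diff_upto n (\<lambda>x. (- real k) * flat_exp (Suc k) x + flat_exp (Suc (Suc k)) x)"
      by (intro diff_upto_add diff_upto_mult diff_upto_const Suc)
    then show ?case
      by (intro diff_upto_SucI[OF flat_exp_has_derivative]) auto
  qed simp
  then show ?thesis by (simp add: smooth_iff_diff_upto)
qed

text \<open>Increasing the scale n + 1 flattens the bump towards 1 without moving its support. It
  converges to the indicator of ]a,b[ and stays in [0,1] without normalization.\<close>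

definition cutoff :: "real \<Rightarrow> real \<Rightarrow> nat \<Rightarrow> real \<Rightarrow> real" where
  "cutoff a b n x = flat_exp 0 (real (Suc n) * x + - (real (Suc n) * a)) *
     flat_exp 0 (- real (Suc n) * x + real (Suc n) * b)"

lemma smooth_cutoff: "smooth (cutoff a b n)"
  unfolding cutoff_def by (intro smooth_mult smooth_affine smooth_flat_exp)

lemma cutoff_eq:
  "cutoff a b n x = (if a < x \<and> x < b then exp (- (1 / (real (Suc n) * (x - a))))
     * exp (- (1 / (real (Suc n) * (b - x)))) else 0)"
proof -
  have "0 < real (Suc n) * x + - (real (Suc n) * a) \<longleftrightarrow> a < x"
    by (metis ab_group_add_class.ab_diff_conv_add_uminus diff_gt_0_iff_gt mult_less_cancel_left_pos of_nat_0_less_iff zero_less_Suc)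
  moreover have "0 < - real (Suc n) * x + real (Suc n) * b \<longleftrightarrow> x < b"
    by (metis add.commute ab_group_add_class.ab_diff_conv_add_uminus diff_gt_0_iff_gt minus_mult_left mult_less_cancel_left_pos of_nat_0_less_iff zero_less_Suc)
  ultimately show ?thesis
    by (simp add: cutoff_def flat_exp_def algebra_simps)
qed

lemma cutoff_bounds: "0 \<le> cutoff a b n x" "cutoff a b n x \<le> 1"
  by (auto simp: cutoff_eq intro!: mult_le_one)

lemma cutoff_tendsto: "(\<lambda>n. cutoff a b n x) \<longlonglongrightarrow> indicator {a<..<b} x"
proof (cases "a < x \<and> x < b")
  case True
  have "(\<lambda>n. 1 / (real (Suc n) * c)) \<longlonglongrightarrow> 0" for c
    using tendsto_mult[OF LIMSEQ_inverse_real_of_nat tendsto_const[of "1/c"]]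
    by (simp add: field_simps)
  from tendsto_mult[OF tendsto_exp[OF tendsto_minus[OF this]] tendsto_exp[OF tendsto_minus[OF this]]]
  show ?thesis
    using True by (simp add: cutoff_eq)
qed (auto simp: cutoff_eq)

section \<open>Test functions and the lemma of du Bois-Reymond\<close>

lemma lebesgue_on_Omega_continuous:
  fixes f :: "real \<Rightarrow> real"
  assumes "continuous_on {-1..1} f"
  shows "integrable leb_Omega f" "(LINT x|leb_Omega. f x) = integral {-1..1} f"
proof -
  have "integrable (lebesgue_on {-1..1}) f"
    by (rule continuous_imp_integrable_real[OF assms])
  then have 1: "set_integrable lebesgue {-1..1} f"
    by (simp add: integrable_restrict_space set_integrable_def)
  have "set_integrable lebesgue Omega f"
    by (rule set_integrable_subset[OF 1]) auto
  then show 2: "integrable leb_Omega f"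
    by (simp add: integrable_restrict_space set_integrable_def)
  show "(LINT x|leb_Omega. f x) = integral {-1..1} f"
    by (subst lebesgue_integral_eq_integral[OF 2]) (auto simp: integral_open_interval_real)
qed

lemma test_function_iff:
  "test_function \<phi> \<longleftrightarrow> smooth \<phi> \<and> (\<exists>d. 0 < d \<and> d < 1 \<and> (\<forall>x. \<bar>x\<bar> > d \<longrightarrow> \<phi> x = 0))"
proof
  assume "test_function \<phi>"
  then obtain K where K: "smooth \<phi>" "compact K" "K \<subseteq> Omega" "\<And>x. x \<notin> K \<Longrightarrow> \<phi> x = 0"
    by (auto simp: test_function_def smooth_def)
  have "compact (insert (1/2) (abs ` K))"
    by (intro compact_insert compact_continuous_image K continuous_intros)
  from compact_attains_sup[OF this] obtain d where
    d: "d \<in> insert (1/2) (abs ` K)" "\<And>y. y \<in> insert (1/2) (abs ` K) \<Longrightarrow> y \<le> d"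
    by (metis insert_not_empty)
  have "d \<ge> 1/2" using d(2)[of "1/2"] by simp
  moreover have "d < 1"
  proof -
    have "\<bar>x\<bar> < 1" if "x \<in> K" for x using subsetD[OF K(3) that] by (auto simp: abs_less_iff)
    then show ?thesis using d(1) by auto
  qed
  moreover have "\<phi> x = 0" if "\<bar>x\<bar> > d" for x
    using d(2)[of "\<bar>x\<bar>"] K(4)[of x] that by fastforce
  ultimately show "smooth \<phi> \<and> (\<exists>d. 0 < d \<and> d < 1 \<and> (\<forall>x. \<bar>x\<bar> > d \<longrightarrow> \<phi> x = 0))"
    using K(1) by (intro conjI exI[of _ d]) auto
next
  assume "smooth \<phi> \<and> (\<exists>d. 0 < d \<and> d < 1 \<and> (\<forall>x. \<bar>x\<bar> > d \<longrightarrow> \<phi> x = 0))"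
  then obtain d where d: "smooth \<phi>" "0 < d" "d < 1" "\<And>x. \<bar>x\<bar> > d \<Longrightarrow> \<phi> x = 0" by blast
  show "test_function \<phi>"
    unfolding test_function_def
    using d by (intro conjI exI[of _ "{-d..d}"]) (auto simp: smooth_def abs_le_iff not_le)
qed

lemma test_smooth: "test_function \<phi> \<Longrightarrow> smooth \<phi>"
  by (simp add: test_function_iff)

lemma test_function_smooth_mult:
  assumes "smooth f" "test_function g"
  shows "test_function (\<lambda>x. f x * g x)"
  using assms by (force simp: test_function_iff intro: smooth_mult)

lemma test_function_cmult: "test_function g \<Longrightarrow> test_function (\<lambda>x. c * g x)"
  by (rule test_function_smooth_mult[OF smooth_const])

lemma test_function_add:
  assumes "test_function f" "test_function g"
  shows "test_function (\<lambda>x. f x + g x)"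
proof -
  obtain d1 d2 where d: "0 < d1" "d1 < 1" "\<And>x. \<bar>x\<bar> > d1 \<Longrightarrow> f x = 0"
      "0 < d2" "d2 < 1" "\<And>x. \<bar>x\<bar> > d2 \<Longrightarrow> g x = 0"
    using assms by (auto simp: test_function_iff)
  then show ?thesis
    unfolding test_function_iff
    by (intro conjI smooth_add test_smooth assms exI[of _ "max d1 d2"]) auto
qed

lemma test_function_deriv:
  assumes "test_function f" shows "test_function (deriv f)"
proof -
  obtain d where d: "0 < d" "d < 1" "\<And>x. \<bar>x\<bar> > d \<Longrightarrow> f x = 0"
    using assms by (auto simp: test_function_iff)
  have "deriv f x = 0" if "\<bar>x\<bar> > d" for x
  proof -
    have "open {x::real. d < \<bar>x\<bar>}"
      by (intro open_Collect_less continuous_intros)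
    then have "\<forall>\<^sub>F y in nhds x. f y = 0"
      using eventually_nhds_in_open[of "{x. d < \<bar>x\<bar>}" x] that d(3)
      by (auto elim!: eventually_mono)
    then have "deriv f x = deriv (\<lambda>x. 0) x"
      by (intro deriv_cong_ev) auto
    then show ?thesis by simp
  qed
  then show ?thesis
    unfolding test_function_iff using d
    by (intro conjI smooth_deriv test_smooth[OF assms] exI[of _ d]) auto
qed

lemma test_function_cutoff:
  assumes "-1 < a" "b < 1" shows "test_function (cutoff a b n)"
  unfolding test_function_iff
proof (intro conjI smooth_cutoff exI[of _ "max (1/2) (max (-a) b)"] allI impI)
  fix x :: real assume "max (1 / 2) (max (- a) b) < \<bar>x\<bar>"
  then have "\<not> (a < x \<and> x < b)" by (auto simp: abs_if split: if_splits)
  then show "cutoff a b n x = 0" by (simp add: cutoff_eq)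
qed (use assms in auto)

lemma test_function_has_deriv: "test_function \<phi> \<Longrightarrow> (\<phi> has_real_derivative deriv \<phi> x) (at x)"
  by (rule smooth_has_deriv[OF test_smooth])

lemma test_function_continuous_on: "test_function \<phi> \<Longrightarrow> continuous_on S \<phi>"
  by (rule smooth_continuous_on[OF test_smooth])

lemma test_function_measurable: "test_function \<phi> \<Longrightarrow> \<phi> \<in> borel_measurable leb_Omega"
  by (rule continuous_imp_measurable_on_sets_lebesgue[OF test_function_continuous_on]) auto

lemma test_function_boundary: "test_function \<phi> \<Longrightarrow> \<bar>x\<bar> \<ge> 1 \<Longrightarrow> \<phi> x = 0"
  by (force simp: test_function_iff)

lemma test_function_bounded:
  assumes "test_function \<phi>" obtains B where "B > 0" "\<And>x. \<bar>\<phi> x\<bar> \<le> B"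
proof -
  have "compact (\<phi> ` {-1..1})"
    by (intro compact_continuous_image test_function_continuous_on assms) auto
  then have "bounded (\<phi> ` {-1..1})"
    by (rule compact_imp_bounded)
  then obtain B where B: "B > 0" "\<And>x. x \<in> {-1..1} \<Longrightarrow> \<bar>\<phi> x\<bar> \<le> B"
    by (auto simp: bounded_pos)
  have "\<bar>\<phi> x\<bar> \<le> B" for x
    using B test_function_boundary[OF assms, of x] by (cases "\<bar>x\<bar> \<le> 1") (auto simp: abs_le_iff)
  with B(1) that show ?thesis by blast
qed

lemma test_function_has_integral:
  assumes "test_function \<phi>" "a \<le> b"
  shows "(deriv \<phi> has_integral (\<phi> b - \<phi> a)) {a..b}"
  by (rule fundamental_theorem_of_calculus[OF assms(2)])
    (use test_function_has_deriv[OF assms(1)] in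
      \<open>auto intro: has_field_derivative_at_within simp: has_real_derivative_iff_has_vector_derivative[symmetric]\<close>)

text \<open>The zero mean makes the primitive vanish again to the right of the support. Thus
  zero-mean test functions can serve as derivatives of test functions, which is what the lemma of du
  Bois-Reymond is tested with.\<close>

lemma test_function_antideriv:
  assumes h: "test_function h" and "integral {-1..1} h = 0"
  obtains \<eta> where "test_function \<eta>" "deriv \<eta> = h" "\<And>x. x \<in> {-1..1} \<Longrightarrow> \<eta> x = integral {-1..x} h"
proof -
  obtain d where d: "0 < d" "d < 1" "\<And>x. \<bar>x\<bar> > d \<Longrightarrow> h x = 0"
    using h by (auto simp: test_function_iff)
  \<comment> \<open>The second integral makes this the oriented integral from -2 also for x < -2,
    where the first runs over an empty interval. The point -2 lies to the left of the
    support.\<close>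
  define \<eta> where "\<eta> x = integral {-2..x} h - integral {x..-2} h" for x
  have int: "h integrable_on {a..b}" for a b
    by (rule integrable_continuous_real[OF test_function_continuous_on[OF h]])
  have ge: "\<eta> x = integral {-2..x} h" if "-2 \<le> x" for x
    using that by (cases "x = -2") (auto simp: \<eta>_def)
  have zero: "integral {a..b} h = 0" if "b \<le> -1" for a b
  proof -
    have "integral {a..b} h = integral {a..b} (\<lambda>x. 0)"
      by (intro integral_cong) (use that d in auto)
    then show ?thesis by simp
  qed
  have zero': "integral {a..b} h = 0" if "1 \<le> a" for a b
  proof -
    have "integral {a..b} h = integral {a..b} (\<lambda>x. 0)"
      by (intro integral_cong) (use that d in auto)
    then show ?thesis by simp
  qed
  have eq: "\<eta> x = integral {-1..x} h" if "x \<ge> -1" for x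
    using that ge[of x] Henstock_Kurzweil_Integration.integral_combine[of "-2" "-1" x h] int zero[of "-1" "-2"] by simp
  have deriv: "(\<eta> has_real_derivative h x) (at x)" for x
  proof -
    define a where "a = min x 0 - 3"
    have 1: "((\<lambda>u. integral {a..u} h) has_vector_derivative h x) (at x within {a..x+1})"
      by (rule integral_has_vector_derivative[OF test_function_continuous_on[OF h]])
        (auto simp: a_def)
    have "((\<lambda>u. integral {a..u} h - integral {a..-2} h) has_vector_derivative h x) (at x within {a..x+1})"
      using has_vector_derivative_diff[OF 1 has_vector_derivative_const[of "integral {a..-2} h"]]
      by simp
    moreover have "at x within {a..x+1} = at x"
      by (rule at_within_interior) (auto simp: a_def)
    ultimately have 2: "((\<lambda>u. integral {a..u} h - integral {a..-2} h) has_real_derivative h x) (at x)"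
      by (simp add: has_real_derivative_iff_has_vector_derivative)
    have eqa: "integral {a..u} h - integral {a..-2} h = \<eta> u" if "u > a" for u
    proof (cases "u \<le> -2")
      case True
      then show ?thesis
        using Henstock_Kurzweil_Integration.integral_combine[of a u "-2" h] int that by (cases "u = -2") (auto simp: \<eta>_def)
    next
      case False
      then show ?thesis
        using Henstock_Kurzweil_Integration.integral_combine[of a "-2" u h] int that ge[of u]
        by (simp add: a_def min_le_iff_disj)
    qed
    show ?thesis
    proof (rule has_field_derivative_transform_within_open[OF 2, of "{a<..}"])
      show "x \<in> {a<..}" by (auto simp: a_def)
    qed (use eqa in auto)
  qed
  have "\<eta> x = 0" if "\<bar>x\<bar> > d" for x
  proof (cases "x < 0")
    case True
    then have "x < - d" using that by auto
    then show ?thesis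
    proof (cases "x < -1")
      case True
      then show ?thesis by (simp add: \<eta>_def zero)
    next
      case False
      have "integral {-1..x} h = integral {-1..x} (\<lambda>x. 0)"
        by (intro integral_cong) (use \<open>x < - d\<close> d in auto)
      then show ?thesis using eq[of x] False by simp
    qed
  next
    case False
    then have "d < x" using that by auto
    show ?thesis
    proof (cases "x > 1")
      case True
      then show ?thesis
        using eq[of x] Henstock_Kurzweil_Integration.integral_combine[of "-1" 1 x h] int assms(2) zero'[of 1 x] by simp
    next
      case False
      have "integral {x..1} h = integral {x..1} (\<lambda>x. 0)"
        by (intro integral_cong) (use \<open>d < x\<close> d in auto)
      then show ?thesis
        using eq[of x] Henstock_Kurzweil_Integration.integral_combine[of "-1" x 1 h] int assms(2) False \<open>d < x\<close> d by simp
    qed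
  qed
  then have "test_function \<eta>"
    unfolding test_function_iff using d smoothI[OF deriv test_smooth[OF h]] by blast
  moreover have "deriv \<eta> = h"
    using deriv DERIV_imp_deriv by blast
  ultimately show ?thesis
    using eq that by simp
qed

section \<open>The fundamental lemma and the lemma of du Bois-Reymond\<close>

lemma locally_integrable_Icc:
  "locally_integrable d \<Longrightarrow> -1 < a \<Longrightarrow> b < 1 \<Longrightarrow> set_integrable lebesgue {a..b} d"
  unfolding locally_integrable_def by (drule spec[of _ "{a..b}"]) auto

lemma integrable_imp_locally_integrable:
  assumes "integrable leb_Omega f" shows "locally_integrable f"
proof -
  have "set_integrable lebesgue Omega f"
    using assms by (simp add: integrable_restrict_space set_integrable_def)
  then show ?thesis
    unfolding locally_integrable_def
    by (meson fmeasurableD lmeasurable_compact set_integrable_subset)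
qed

lemma measurable_lebesgueI_cont:
  fixes f :: "real \<Rightarrow> real"
  shows "continuous_on UNIV f \<Longrightarrow> f \<in> borel_measurable lebesgue"
  using continuous_imp_measurable_on_sets_lebesgue[of UNIV f] by (simp add: lebesgue_on_UNIV_eq)

lemma locally_integrable_mult_test:
  assumes d: "locally_integrable d" and \<phi>: "test_function \<phi>"
  shows "integrable leb_Omega (\<lambda>x. d x * \<phi> x)"
proof -
  obtain e where e: "0 < e" "e < 1" "\<And>x. \<bar>x\<bar> > e \<Longrightarrow> \<phi> x = 0"
    using \<phi> by (auto simp: test_function_iff)
  obtain B where B: "B > 0" "\<And>x. \<bar>\<phi> x\<bar> \<le> B"
    using test_function_bounded[OF \<phi>] by blast
  have int: "integrable lebesgue (\<lambda>x. indicator {-e..e} x * d x)"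
    using locally_integrable_Icc[OF d, of "-e" e] e by (simp add: set_integrable_def)
  have "integrable lebesgue (\<lambda>x. indicator {-e..e} x * d x * \<phi> x)"
  proof (rule Bochner_Integration.integrable_bound[OF integrable_mult_right[OF int, of B]])
    show "(\<lambda>x. indicator {-e..e} x * d x * \<phi> x) \<in> borel_measurable lebesgue"
      by (intro borel_measurable_times borel_measurable_integrable[OF int]
          measurable_lebesgueI_cont test_function_continuous_on[OF \<phi>])
    show "AE x in lebesgue. norm (indicator {-e..e} x * d x * \<phi> x) \<le> norm (B * (indicator {-e..e} x * d x))"
    proof (intro AE_I2)
      fix x
      show "norm (indicator {-e..e} x * d x * \<phi> x) \<le> norm (B * (indicator {-e..e} x * d x))"
        using mult_left_mono[OF B(2)[of x], of "\<bar>indicator {-e..e} x * d x\<bar>"] B(1)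
        by (simp add: abs_mult mult.commute)
    qed
  qed
  also have "(\<lambda>x. indicator {-e..e} x * d x * \<phi> x) = (\<lambda>x. indicator Omega x * (d x * \<phi> x))"
  proof
    fix x show "indicator {-e..e} x * d x * \<phi> x = indicator Omega x * (d x * \<phi> x)"
      using e(1,2) e(3)[of x] by (cases "\<bar>x\<bar> > e") (auto simp: indicator_def abs_le_iff)
  qed
  finally show ?thesis
    by (simp add: integrable_restrict_space)
qed

lemma integrable_mult_test:
  "integrable leb_Omega f \<Longrightarrow> test_function \<phi> \<Longrightarrow> integrable leb_Omega (\<lambda>x. f x * \<phi> x)"
  using locally_integrable_mult_test integrable_imp_locally_integrable by blast

text \<open>Lebesgue differentiation: off a null set the right averages of \<open>d\<close> converge
  to its value, yet all of them are zero.\<close>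

lemma AE_zero_if_integrals_zero:
  fixes d :: "real \<Rightarrow> real"
  assumes int: "\<And>a b. -1 < a \<Longrightarrow> b < 1 \<Longrightarrow> d integrable_on {a..b}"
    and zero: "\<And>a b. -1 < a \<Longrightarrow> a < b \<Longrightarrow> b < 1 \<Longrightarrow> integral {a..b} d = 0"
  shows "AE x in leb_Omega. d x = 0"
proof -
  have *: "\<exists>N. negligible N \<and> (\<forall>x \<in> {-c<..<c} - N. d x = 0)" if "c < 1" for c
  proof -
    let ?D = "\<lambda>x. if x \<in> {-c..c} then d x else 0"
    have "?D integrable_on UNIV"
      using int[of "-c" c] that by (subst integrable_restrict_UNIV) auto
    then have "?D integrable_on cbox a b" for a b
      by (rule integrable_on_subcbox) auto
    from integrable_ccontinuous_explicit[OF this] obtain N where N: "negligible N"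
       "\<And>x e. x \<notin> N \<Longrightarrow> 0 < e \<Longrightarrow> \<exists>h0>0. \<forall>h. 0 < h \<and> h < h0 \<longrightarrow>
                         norm (integral (cbox x (x + h *\<^sub>R One)) ?D /\<^sub>R h ^ DIM(real) - ?D x) < e"
      by blast
    have "d x = 0" if x: "x \<in> {-c<..<c} - N" for x
    proof (rule ccontr)
      assume nz: "d x \<noteq> 0"
      then obtain h0 where h0: "h0 > 0" "\<And>h. 0 < h \<Longrightarrow> h < h0 \<Longrightarrow>
          norm (integral (cbox x (x + h *\<^sub>R One)) ?D /\<^sub>R h ^ DIM(real) - ?D x) < \<bar>d x\<bar>"
        using N(2)[of x "\<bar>d x\<bar>"] x by auto
      define h where "h = min (h0/2) (c - x)"
      have h: "0 < h" "h < h0" "x + h \<le> c" using x h0 by (auto simp: h_def)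
      have "integral {x..x+h} ?D = integral {x..x+h} d"
        by (intro integral_cong) (use x h in auto)
      also have "\<dots> = 0"
        using zero[of x "x+h"] x h that \<open>c < 1\<close> by auto
      finally show False
        using h0(2)[of h] h x by auto
    qed
    with N(1) show ?thesis by blast
  qed
  \<comment> \<open>\<open>d\<close> is integrable only on compactly contained intervals; countably
    many of them exhaust \<open>Omega\<close>.\<close>
  define c where "c n = 1 - 1 / real (Suc n)" for n
  have "\<forall>n. \<exists>N. negligible N \<and> (\<forall>x \<in> {-c n<..<c n} - N. d x = 0)"
    by (intro allI *) (simp add: c_def)
  then obtain N where N: "\<And>n. negligible (N n)" "\<And>n x. x \<in> {-c n<..<c n} - N n \<Longrightarrow> d x = 0"
    by metis
  have neg: "negligible (\<Union>n. N n)"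
    by (rule negligible_countable_Union) (auto simp: N)
  have "x \<in> (\<Union>n. N n)" if "x \<in> Omega" "d x \<noteq> 0" for x
  proof -
    have "0 < 1 - \<bar>x\<bar>" using that(1) by (simp add: abs_less_iff)
    from reals_Archimedean[OF this] obtain n where "inverse (real (Suc n)) < 1 - \<bar>x\<bar>" by blast
    then have "x \<in> {-c n<..<c n}" by (auto simp: c_def inverse_eq_divide)
    then show ?thesis using N(2)[of x n] that by auto
  qed
  then show ?thesis
    using neg unfolding negligible_iff_null_sets
    by (subst AE_restrict_space_iff) (auto intro!: AE_I'[of "\<Union>n. N n"])
qed

text \<open>Fundamental lemma of the calculus of variations. The cutoffs converge boundedly to the
  indicator of an interval, which reduces the claim to vanishing integrals over intervals.\<close>

lemma AE_zero_if_test_integrals_zero: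
  assumes d: "locally_integrable d"
    and zero: "\<And>\<phi>. test_function \<phi> \<Longrightarrow> (LINT x|leb_Omega. d x * \<phi> x) = 0"
  shows "AE x in leb_Omega. d x = 0"
proof (rule AE_zero_if_integrals_zero)
  have sint: "set_integrable lebesgue {a..b} d" if "-1 < a" "b < 1" for a b
    using locally_integrable_Icc[OF d] that by blast
  then show "d integrable_on {a..b}" if "-1 < a" "b < 1" for a b
    using that set_lebesgue_integral_eq_integral(1) by blast
  fix a b :: real assume ab: "-1 < a" "a < b" "b < 1"
  have int: "integrable leb_Omega (\<lambda>x. indicator {a..b} x * d x)"
  proof -
    have "(\<lambda>x. indicator Omega x * (indicator {a..b} x * d x)) = (\<lambda>x. indicator {a..b} x * d x)"
      using ab by (auto simp: fun_eq_iff split: split_indicator)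
    then show ?thesis
      using sint[OF ab(1,3)] by (simp add: integrable_restrict_space set_integrable_def)
  qed
  let ?s = "\<lambda>n x. d x * cutoff a b n x"
  have "(\<lambda>n. LINT x|leb_Omega. ?s n x) \<longlonglongrightarrow> (LINT x|leb_Omega. d x * indicator {a<..<b} x)"
  proof (rule integral_dominated_convergence)
    show "integrable leb_Omega (\<lambda>x. \<bar>indicator {a..b} x * d x\<bar>)"
      using int by simp
    show "AE x in leb_Omega. (\<lambda>n. ?s n x) \<longlonglongrightarrow> d x * indicator {a<..<b} x"
      by (intro AE_I2 tendsto_mult tendsto_const cutoff_tendsto)
    show "AE x in leb_Omega. norm (?s n x) \<le> \<bar>indicator {a..b} x * d x\<bar>" for n
    proof (intro AE_I2)
      fix x
      show "norm (?s n x) \<le> \<bar>indicator {a..b} x * d x\<bar>"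
      proof (cases "a < x \<and> x < b")
        case True
        then show ?thesis
          using mult_left_mono[OF cutoff_bounds(2)[of a b n x], of "\<bar>d x\<bar>"] cutoff_bounds(1)[of a b n x]
          by (simp add: abs_mult)
      next
        case False
        then have "cutoff a b n x = 0" by (simp add: cutoff_eq)
        then show ?thesis by simp
      qed
    qed
    have "(\<lambda>x. (indicator {a..b} x * d x) * indicator {a<..<b} x) \<in> borel_measurable leb_Omega"
      by (intro borel_measurable_times borel_measurable_integrable[OF int] measurable_restrict_space1
          borel_measurable_indicator) auto
    moreover have "(indicator {a..b} x * d x) * indicator {a<..<b} x = d x * indicator {a<..<b} x" for x
      by (auto split: split_indicator)
    ultimately show "(\<lambda>x. d x * indicator {a<..<b} x) \<in> borel_measurable leb_Omega"
      by (simp only:)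
    show "?s n \<in> borel_measurable leb_Omega" for n
      using locally_integrable_mult_test[OF d test_function_cutoff[OF ab(1,3)]] by blast
  qed
  then have "(LINT x|leb_Omega. d x * indicator {a<..<b} x) = 0"
    using LIMSEQ_unique[OF _ tendsto_const[of 0]] zero[OF test_function_cutoff[OF ab(1,3)]] by simp
  also have "(LINT x|leb_Omega. d x * indicator {a<..<b} x) = (LINT x|lebesgue. indicator {a<..<b} x * d x)"
    by (subst integral_restrict_space) (use ab in \<open>auto intro!: Bochner_Integration.integral_cong split: split_indicator\<close>)
  also have "\<dots> = integral {a<..<b} d"
    using set_lebesgue_integral_eq_integral(2)[of "{a<..<b}" d] set_integrable_subset[OF sint[OF ab(1,3)], of "{a<..<b}"] greaterThanLessThan_subseteq_atLeastAtMost_iff[of a b a b]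
    by (auto simp: set_lebesgue_integral_def)
  finally show "integral {a..b} d = 0"
    by (simp add: integral_open_interval_real)
qed

text \<open>A fixed bump of nonzero mass splits off the mean of an arbitrary test function. The
  constant is the integral of \<open>f\<close> against that bump, divided by its mass.\<close>

lemma du_Bois_Reymond:
  assumes f: "integrable leb_Omega f"
    and zero: "\<And>h. test_function h \<Longrightarrow> integral {-1..1} h = 0 \<Longrightarrow> (LINT x|leb_Omega. f x * h x) = 0"
  shows "\<exists>c. AE x in leb_Omega. f x = c"
proof -
  define \<rho>0 where "\<rho>0 = cutoff (-1/2) (1/2) 0"
  have t0: "test_function \<rho>0" unfolding \<rho>0_def by (rule test_function_cutoff) auto
  define I where "I = integral {-1..1} \<rho>0"
  have "I \<noteq> 0"
  proof
    assume "I = 0"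
    then have "\<rho>0 0 = 0"
      using integral_eq_0_iff[of "-1" 1 \<rho>0] test_function_continuous_on[OF t0] cutoff_bounds
      unfolding I_def \<rho>0_def by auto
    then show False by (simp add: \<rho>0_def cutoff_eq)
  qed
  define c where "c = (LINT x|leb_Omega. f x * \<rho>0 x) / I"
  have "AE x in leb_Omega. f x - c = 0"
  proof (rule AE_zero_if_test_integrals_zero)
    have "integrable leb_Omega (\<lambda>x. c)"
      by (rule lebesgue_on_Omega_continuous) auto
    then show "locally_integrable (\<lambda>x. f x - c)"
      using f by (intro integrable_imp_locally_integrable) auto
    fix \<phi> assume \<phi>: "test_function \<phi>"
    define J where "J = integral {-1..1} \<phi>"
    define h where "h x = \<phi> x + (- (J / I)) * \<rho>0 x" for x
    have h: "test_function h"
      unfolding h_def by (intro test_function_add test_function_cmult \<phi> t0)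
    have icont: "\<psi> integrable_on {-1..1}" if "test_function \<psi>" for \<psi>
      by (rule integrable_continuous_real[OF test_function_continuous_on[OF that]])
    have "integral {-1..1} h = J + (- (J / I)) * I"
      unfolding h_def J_def I_def
      using integral_add[OF icont[OF \<phi>] icont[OF test_function_cmult[OF t0, of "- (J / I)"]]]
      by (simp add: J_def I_def)
    then have "(LINT x|leb_Omega. f x * h x) = 0"
      using zero[OF h] \<open>I \<noteq> 0\<close> by simp
    moreover have "(LINT x|leb_Omega. f x * h x) = (LINT x|leb_Omega. f x * \<phi> x) - (J / I) * (LINT x|leb_Omega. f x * \<rho>0 x)"
      using integrable_mult_test[OF f \<phi>] integrable_mult_test[OF f t0]
      by (simp add: h_def algebra_simps)
    moreover have "(LINT x|leb_Omega. (f x - c) * \<phi> x) = (LINT x|leb_Omega. f x * \<phi> x) - c * J"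
      using integrable_mult_test[OF f \<phi>] lebesgue_on_Omega_continuous[OF test_function_continuous_on[OF \<phi>]]
      by (simp add: algebra_simps J_def)
    ultimately show "(LINT x|leb_Omega. (f x - c) * \<phi> x) = 0"
      by (simp add: c_def)
  qed
  then show ?thesis by auto
qed

text \<open>Lagrange multiplier version. Since \<open>T\<close> is not constant, some zero-mean
  \<rho> violates the constraint, and subtracting a multiple of it makes any zero-mean test function
  admissible. The multiplier \<open>b\<close> is read off from \<rho>.\<close>

lemma du_Bois_Reymond_constraint:
  assumes f: "integrable leb_Omega f" and T: "integrable leb_Omega T"
    and nc: "\<not> (\<exists>c. AE x in leb_Omega. T x = c)"
    and zero: "\<And>h. test_function h \<Longrightarrow> integral {-1..1} h = 0 \<Longrightarrow> (LINT x|leb_Omega. T x * h x) = 0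
       \<Longrightarrow> (LINT x|leb_Omega. f x * h x) = 0"
  shows "\<exists>b c. AE x in leb_Omega. f x = c + b * T x"
proof -
  obtain \<rho> where \<rho>: "test_function \<rho>" "integral {-1..1} \<rho> = 0" and
     nz: "(LINT x|leb_Omega. T x * \<rho> x) \<noteq> 0"
    using du_Bois_Reymond[OF T] nc by blast
  define b where "b = (LINT x|leb_Omega. f x * \<rho> x) / (LINT x|leb_Omega. T x * \<rho> x)"
  have icont: "\<psi> integrable_on {-1..1}" if "test_function \<psi>" for \<psi>
    by (rule integrable_continuous_real[OF test_function_continuous_on[OF that]])
  have "\<exists>c. AE x in leb_Omega. f x - b * T x = c"
  proof (rule du_Bois_Reymond)
    show "integrable leb_Omega (\<lambda>x. f x - b * T x)" using f T by simp
    fix h assume h: "test_function h" "integral {-1..1} h = 0"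
    define k where "k = (LINT x|leb_Omega. T x * h x) / (LINT x|leb_Omega. T x * \<rho> x)"
    define h' where "h' x = h x + (- k) * \<rho> x" for x
    have h': "test_function h'"
      unfolding h'_def by (intro test_function_add test_function_cmult h \<rho>)
    have "integral {-1..1} h' = integral {-1..1} h + (- k) * integral {-1..1} \<rho>"
      unfolding h'_def
      using integral_add[OF icont[OF h(1)] icont[OF test_function_cmult[OF \<rho>(1), of "- k"]]]
      by simp
    then have "integral {-1..1} h' = 0" using h(2) \<rho>(2) by simp
    moreover have *: "(LINT x|leb_Omega. F x * h' x) = (LINT x|leb_Omega. F x * h x) - k * (LINT x|leb_Omega. F x * \<rho> x)"
      if "integrable leb_Omega F" for F
      using integrable_mult_test[OF that h(1)] integrable_mult_test[OF that \<rho>(1)]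
      by (simp add: h'_def algebra_simps)
    moreover have "(LINT x|leb_Omega. T x * h' x) = 0"
      using nz by (simp add: *[OF T] k_def)
    ultimately have "(LINT x|leb_Omega. f x * h' x) = 0"
      using zero[OF h'] by simp
    then have "(LINT x|leb_Omega. f x * h x) = b * (LINT x|leb_Omega. T x * h x)"
      by (simp add: *[OF f] k_def b_def)
    moreover have "(LINT x|leb_Omega. (f x - b * T x) * h x) = (LINT x|leb_Omega. f x * h x - b * (T x * h x))"
      by (intro Bochner_Integration.integral_cong) (auto simp: algebra_simps)
    moreover have "\<dots> = (LINT x|leb_Omega. f x * h x) - b * (LINT x|leb_Omega. T x * h x)"
      using integrable_mult_test[OF f h(1)] integrable_mult_test[OF T h(1)] by simp
    ultimately show "(LINT x|leb_Omega. (f x - b * T x) * h x) = 0" by linarith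
  qed
  then obtain c where "AE x in leb_Omega. f x - b * T x = c" by blast
  then have "AE x in leb_Omega. f x = c + b * T x" by eventually_elim auto
  then show ?thesis by blast
qed

section \<open>Weak derivatives and Lebesgue classes\<close>

lemma has_weak_derivD:
  assumes "has_weak_deriv u g"
  shows "locally_integrable u" "locally_integrable g"
    "test_function \<phi> \<Longrightarrow> (LINT x|leb_Omega. u x * deriv \<phi> x) = - (LINT x|leb_Omega. g x * \<phi> x)"
  using assms by (auto simp: has_weak_deriv_def)

lemma locally_integrable_lin:
  assumes "locally_integrable u" "locally_integrable v"
  shows "locally_integrable (\<lambda>x. u x + c * v x)"
  using assms unfolding locally_integrable_def
  by (auto intro!: set_integral_add set_integrable_mult_right)

lemma has_weak_deriv_lin:
  assumes u: "has_weak_deriv u g" and v: "has_weak_deriv v h"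
  shows "has_weak_deriv (\<lambda>x. u x + c * v x) (\<lambda>x. g x + c * h x)"
  unfolding has_weak_deriv_def
proof (intro conjI allI impI locally_integrable_lin has_weak_derivD(1)[OF u] has_weak_derivD(1)[OF v]
    has_weak_derivD(2)[OF u] has_weak_derivD(2)[OF v])
  fix \<phi> assume \<phi>: "test_function \<phi>"
  note i = locally_integrable_mult_test[OF _ \<phi>] locally_integrable_mult_test[OF _ test_function_deriv[OF \<phi>]]
  have "(LINT x|leb_Omega. (u x + c * v x) * deriv \<phi> x)
      = (LINT x|leb_Omega. u x * deriv \<phi> x + c * (v x * deriv \<phi> x))"
    by (intro Bochner_Integration.integral_cong) (auto simp: algebra_simps)
  also have "\<dots> = (LINT x|leb_Omega. u x * deriv \<phi> x) + c * (LINT x|leb_Omega. v x * deriv \<phi> x)"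
    using i(2)[OF has_weak_derivD(1)[OF u]] i(2)[OF has_weak_derivD(1)[OF v]] by simp
  also have "\<dots> = - ((LINT x|leb_Omega. g x * \<phi> x) + c * (LINT x|leb_Omega. h x * \<phi> x))"
    using has_weak_derivD(3)[OF u \<phi>] has_weak_derivD(3)[OF v \<phi>] by simp
  also have "(LINT x|leb_Omega. g x * \<phi> x) + c * (LINT x|leb_Omega. h x * \<phi> x)
      = (LINT x|leb_Omega. g x * \<phi> x + c * (h x * \<phi> x))"
    using i(1)[OF has_weak_derivD(2)[OF u]] i(1)[OF has_weak_derivD(2)[OF v]] by simp
  also have "\<dots> = (LINT x|leb_Omega. (g x + c * h x) * \<phi> x)"
    by (intro Bochner_Integration.integral_cong) (auto simp: algebra_simps)
  finally show "(LINT x|leb_Omega. (u x + c * v x) * deriv \<phi> x) = - (LINT x|leb_Omega. (g x + c * h x) * \<phi> x)" .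
qed

lemma weak_deriv_unique:
  assumes g: "has_weak_deriv u g" and h: "has_weak_deriv u h"
  shows "AE x in leb_Omega. g x = h x"
proof -
  have gh: "has_weak_deriv (\<lambda>x. u x + (- 1) * u x) (\<lambda>x. g x + (- 1) * h x)"
    by (rule has_weak_deriv_lin[OF g h])
  have "AE x in leb_Omega. g x + (- 1) * h x = 0"
    by (rule AE_zero_if_test_integrals_zero[OF has_weak_derivD(2)[OF gh]])
      (use has_weak_derivD(3)[OF gh] in simp)
  then show ?thesis by eventually_elim simp
qed

lemma weak_deriv_AE_eq: "has_weak_deriv u g \<Longrightarrow> AE x in leb_Omega. weak_deriv u x = g x"
  unfolding weak_deriv_def by (rule weak_deriv_unique[OF someI[of "has_weak_deriv u"]])

lemma locally_integrable_measurable: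
  assumes "locally_integrable f" shows "f \<in> borel_measurable leb_Omega"
proof -
  define c where "c n = 1 - 1 / real (Suc n)" for n
  have c: "-1 < - c n" "c n < 1" for n by (auto simp: c_def)
  have "(\<lambda>x. indicator {- c n..c n} x * f x) \<in> borel_measurable lebesgue" for n
    using locally_integrable_Icc[OF assms c] by (auto simp: set_integrable_def)
  moreover have "(\<lambda>n. indicator {- c n..c n} x * f x) \<longlonglongrightarrow> indicator Omega x * f x" for x
  proof (cases "x \<in> Omega")
    case True
    then have "0 < 1 - \<bar>x\<bar>" by (simp add: abs_less_iff)
    from reals_Archimedean[OF this] obtain n where n: "inverse (real (Suc n)) < 1 - \<bar>x\<bar>" by blast
    have "\<forall>\<^sub>F m in sequentially. indicator {- c m..c m} x * f x = indicator Omega x * f x"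
    proof (rule eventually_sequentiallyI[of n])
      fix m assume "n \<le> m"
      then have "1 / real (Suc m) \<le> inverse (real (Suc n))"
        unfolding inverse_eq_divide by (intro frac_le) auto
      then have "\<bar>x\<bar> < c m" using n by (simp add: c_def)
      then show "indicator {- c m..c m} x * f x = indicator Omega x * f x"
        using True by (auto simp: indicator_def abs_less_iff)
    qed
    then show ?thesis by (rule tendsto_eventually)
  next
    case False
    then have "x \<notin> {- c n..c n}" for n using c[of n] by auto
    then show ?thesis using False by simp
  qed
  ultimately have "(\<lambda>x. indicator Omega x * f x) \<in> borel_measurable lebesgue"
    using borel_measurable_LIMSEQ_real[of lebesgue "\<lambda>n x. indicator {- c n..c n} x * f x"] by simp
  then show ?thesis
    by (subst borel_measurable_restrict_space_iff) auto
qed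

lemma weak_deriv_measurable: "has_weak_deriv u g \<Longrightarrow> weak_deriv u \<in> borel_measurable leb_Omega"
  unfolding weak_deriv_def
  by (rule locally_integrable_measurable[OF has_weak_derivD(2)[OF someI[of "has_weak_deriv u"]]])

lemma has_weak_deriv_C1:
  assumes u: "continuous_on {-1..1} u" and g: "continuous_on {-1..1} g"
    and der: "\<And>x. x \<in> {-1<..<1} \<Longrightarrow> (u has_real_derivative g x) (at x)"
  shows "has_weak_deriv u g"
  unfolding has_weak_deriv_def
proof (intro conjI allI impI)
  show "locally_integrable u" "locally_integrable g"
    using u g by (auto intro!: integrable_imp_locally_integrable lebesgue_on_Omega_continuous)
  fix \<phi> assume \<phi>: "test_function \<phi>"
  have c1: "continuous_on {-1..1} (\<lambda>x. g x * \<phi> x)" "continuous_on {-1..1} (\<lambda>x. u x * deriv \<phi> x)"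
    by (intro continuous_intros u g test_function_continuous_on \<phi> test_function_deriv)+
  define I where "I = integral {-1..1} (\<lambda>x. u x * deriv \<phi> x)"
  have "((\<lambda>x. g x * \<phi> x) has_integral (- I)) {-1..1}"
  proof (rule integration_by_parts_interior[OF bounded_bilinear_mult, where f=u and g=\<phi> and g'="deriv \<phi>"])
    show "((\<lambda>x. u x * deriv \<phi> x) has_integral u 1 * \<phi> 1 - u (-1) * \<phi> (-1) - - I) {-1..1}"
      using integrable_integral[OF integrable_continuous_real[OF c1(2)]] test_function_boundary[OF \<phi>]
      by (simp add: I_def)
  qed (use der test_function_has_deriv[OF \<phi>] in
      \<open>auto simp: has_real_derivative_iff_has_vector_derivative[symmetric] u
        intro!: test_function_continuous_on \<phi>\<close>)
  then have "integral {-1..1} (\<lambda>x. g x * \<phi> x) = - I"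
    by (rule integral_unique)
  then show "(LINT x|leb_Omega. u x * deriv \<phi> x) = - (LINT x|leb_Omega. g x * \<phi> x)"
    using lebesgue_on_Omega_continuous(2)[OF c1(1)] lebesgue_on_Omega_continuous(2)[OF c1(2)]
    by (simp add: I_def)
qed

lemma has_weak_deriv_test: "test_function \<phi> \<Longrightarrow> has_weak_deriv \<phi> (deriv \<phi>)"
  by (intro has_weak_deriv_C1 test_function_continuous_on test_function_deriv test_function_has_deriv)

section \<open>Lebesgue classes on the interval\<close>

lemma integrable_const_Omega [simp]: "integrable leb_Omega (\<lambda>x. c::real)"
  and integral_const_Omega [simp]: "(LINT x|leb_Omega. (c::real)) = 2 * c"
  using lebesgue_on_Omega_continuous[of "\<lambda>x. c"] by auto

lemma integrable_leb_Omega_HK: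
  fixes f :: "real \<Rightarrow> real"
  assumes "integrable leb_Omega f"
  shows "f integrable_on {-1..1}" "(LINT x|leb_Omega. f x) = integral {-1..1} f"
    "(\<lambda>x. \<bar>f x\<bar>) integrable_on {-1..1}"
proof -
  have *: "f integrable_on {-1..1}" if "integrable leb_Omega f" for f :: "real \<Rightarrow> real"
    using integrable_on_lebesgue_on[OF that] has_integral_Icc_iff_Ioo[of f _ "-1" 1]
    by (auto simp: integrable_on_def)
  show "f integrable_on {-1..1}" "(\<lambda>x. \<bar>f x\<bar>) integrable_on {-1..1}"
    using *[OF assms] *[of "\<lambda>x. \<bar>f x\<bar>"] assms by auto
  show "(LINT x|leb_Omega. f x) = integral {-1..1} f"
    by (subst lebesgue_integral_eq_integral[OF assms]) (auto simp: integral_open_interval_real)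
qed

lemma continuous_on_abs_powr:
  fixes f :: "real \<Rightarrow> real"
  shows "continuous_on S f \<Longrightarrow> 0 < p \<Longrightarrow> continuous_on S (\<lambda>x. \<bar>f x\<bar> powr p)"
  by (intro continuous_on_powr' continuous_on_rabs continuous_on_const) auto

lemma Lp_continuous: "continuous_on {-1..1} f \<Longrightarrow> 0 < p \<Longrightarrow> f \<in> Lp p"
  unfolding Lp_def
  by (auto intro!: lebesgue_on_Omega_continuous(1) continuous_on_abs_powr continuous_imp_measurable_on_sets_lebesgue
      intro: continuous_on_subset)

lemma abs_add_powr_le:
  fixes a b :: real
  assumes "0 \<le> p" shows "\<bar>a + b\<bar> powr p \<le> 2 powr p * (\<bar>a\<bar> powr p + \<bar>b\<bar> powr p)"
proof -
  have "\<bar>a + b\<bar> powr p \<le> (2 * max \<bar>a\<bar> \<bar>b\<bar>) powr p"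
    by (intro powr_mono2 assms) auto
  also have "\<dots> = 2 powr p * max \<bar>a\<bar> \<bar>b\<bar> powr p"
    by (simp add: powr_mult)
  also have "max \<bar>a\<bar> \<bar>b\<bar> powr p \<le> \<bar>a\<bar> powr p + \<bar>b\<bar> powr p"
    by (simp add: max_def)
  finally show ?thesis by (simp add: mult_left_mono)
qed

lemma LpD: "f \<in> Lp p \<Longrightarrow> f \<in> borel_measurable leb_Omega" "f \<in> Lp p \<Longrightarrow> integrable leb_Omega (\<lambda>x. \<bar>f x\<bar> powr p)"
  by (auto simp: Lp_def)

lemma Lp_lin:
  assumes f: "f \<in> Lp p" and g: "g \<in> Lp p" and "0 \<le> p"
  shows "(\<lambda>x. f x + c * g x) \<in> Lp p"
proof -
  have m: "f \<in> borel_measurable leb_Omega" "g \<in> borel_measurable leb_Omega"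
    using LpD f g by auto
  have "integrable leb_Omega (\<lambda>x. 2 powr p * (\<bar>f x\<bar> powr p + \<bar>c\<bar> powr p * \<bar>g x\<bar> powr p))"
    using LpD(2)[OF f] LpD(2)[OF g] by simp
  then have "integrable leb_Omega (\<lambda>x. \<bar>f x + c * g x\<bar> powr p)"
  proof (rule Bochner_Integration.integrable_bound)
    show "(\<lambda>x. \<bar>f x + c * g x\<bar> powr p) \<in> borel_measurable leb_Omega"
      using m by measurable
    show "AE x in leb_Omega. norm (\<bar>f x + c * g x\<bar> powr p)
        \<le> norm (2 powr p * (\<bar>f x\<bar> powr p + \<bar>c\<bar> powr p * \<bar>g x\<bar> powr p))"
    proof (intro AE_I2)
      fix x show "norm (\<bar>f x + c * g x\<bar> powr p) \<le> norm (2 powr p * (\<bar>f x\<bar> powr p + \<bar>c\<bar> powr p * \<bar>g x\<bar> powr p))"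
        using abs_add_powr_le[OF assms(3), of "f x" "c * g x"] by (simp add: abs_mult powr_mult)
    qed
  qed
  then show ?thesis
    unfolding Lp_def using m by auto
qed

lemma powr_le_one_plus:
  fixes t :: real
  assumes "0 \<le> q" "q \<le> p" "0 \<le> t" shows "t powr q \<le> 1 + t powr p"
proof (cases "t \<le> 1")
  case True
  then have "t powr q \<le> 1 powr q" using assms by (intro powr_mono2) auto
  then show ?thesis by (simp add: add_increasing2)
next
  case False
  then have "t powr q \<le> t powr p" using assms by (intro powr_mono) auto
  then show ?thesis by simp
qed

lemma Lp_integrable_powr:
  assumes f: "f \<in> Lp p" and "0 \<le> q" "q \<le> p"
  shows "integrable leb_Omega (\<lambda>x. \<bar>f x\<bar> powr q)"
proof (rule Bochner_Integration.integrable_bound)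
  show "integrable leb_Omega (\<lambda>x. 1 + \<bar>f x\<bar> powr p)" using LpD[OF f] by simp
  show "(\<lambda>x. \<bar>f x\<bar> powr q) \<in> borel_measurable leb_Omega"
    using LpD(1)[OF f] by measurable
qed (use powr_le_one_plus[OF assms(2,3)] in \<open>auto simp: abs_of_nonneg add_nonneg_nonneg\<close>)

lemma Lp_integrable:
  assumes f: "f \<in> Lp p" and "1 \<le> p" shows "integrable leb_Omega f"
proof (rule Bochner_Integration.integrable_bound)
  show "integrable leb_Omega (\<lambda>x. \<bar>f x\<bar> powr 1)" using Lp_integrable_powr[OF f, of 1] assms by simp
qed (use LpD(1)[OF f] in auto)

lemma L1_tendsto_0_if_Lp_tendsto_0:
  assumes p: "1 \<le> p" and f: "\<And>n. f n \<in> Lp p"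
    and lim: "(\<lambda>n. LINT x|leb_Omega. \<bar>f n x\<bar> powr p) \<longlonglongrightarrow> 0"
  shows "(\<lambda>n. LINT x|leb_Omega. \<bar>f n x\<bar>) \<longlonglongrightarrow> 0"
proof (rule LIMSEQ_I)
  fix e :: real assume "0 < e"
  define d where "d = e / 4"
  have d: "0 < d" using \<open>0 < e\<close> by (simp add: d_def)
  \<comment> \<open>Above the level d write |t| = |t|^(1-p) |t|^p; the first factor is at most
    d^(1-p). On an interval of length 2 the constant d costs 2d = e/2.\<close>
  have bound: "\<bar>t\<bar> \<le> d + d powr (1 - p) * \<bar>t\<bar> powr p" for t :: real
  proof (cases "\<bar>t\<bar> \<le> d")
    case False
    have "\<bar>t\<bar> = \<bar>t\<bar> powr (1 - p) * \<bar>t\<bar> powr p"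
      using False d by (simp add: powr_add[symmetric])
    also have "\<dots> \<le> d powr (1 - p) * \<bar>t\<bar> powr p"
      using False d p by (intro mult_right_mono powr_mono2') auto
    finally show ?thesis using d by linarith
  qed (simp add: add_increasing2)
  have *: "(LINT x|leb_Omega. \<bar>f n x\<bar>) \<le> 2 * d + d powr (1 - p) * (LINT x|leb_Omega. \<bar>f n x\<bar> powr p)" for n
  proof -
    have "(LINT x|leb_Omega. \<bar>f n x\<bar>) \<le> (LINT x|leb_Omega. d + d powr (1 - p) * \<bar>f n x\<bar> powr p)"
      using Lp_integrable[OF f[of n] p] LpD(2)[OF f[of n]] bound by (intro integral_mono) auto
    also have "\<dots> = 2 * d + d powr (1 - p) * (LINT x|leb_Omega. \<bar>f n x\<bar> powr p)"
      using LpD(2)[OF f[of n]] by (simp del: lebesgue_integral_const)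
    finally show ?thesis .
  qed
  have "(\<lambda>n. d powr (1 - p) * (LINT x|leb_Omega. \<bar>f n x\<bar> powr p)) \<longlonglongrightarrow> 0"
    using tendsto_mult_left[OF lim, of "d powr (1 - p)"] by simp
  from LIMSEQ_D[OF this, of "e / 2"] \<open>0 < e\<close> obtain N where
    "\<And>n. n \<ge> N \<Longrightarrow> d powr (1 - p) * (LINT x|leb_Omega. \<bar>f n x\<bar> powr p) < e / 2"
    by fastforce
  then have "norm ((LINT x|leb_Omega. \<bar>f n x\<bar>) - 0) < e" if "n \<ge> N" for n
    using *[of n] that d_def by fastforce
  then show "\<exists>N. \<forall>n\<ge>N. norm ((LINT x|leb_Omega. \<bar>f n x\<bar>) - 0) < e" by blast
qed

lemma integral_weak_deriv_powr:
  assumes "has_weak_deriv u g"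
  shows "(LINT x|leb_Omega. \<bar>weak_deriv u x\<bar> powr p) = (LINT x|leb_Omega. \<bar>g x\<bar> powr p)"
proof (rule integral_cong_AE)
  show "(\<lambda>x. \<bar>weak_deriv u x\<bar> powr p) \<in> borel_measurable leb_Omega"
    using weak_deriv_measurable[OF assms] by measurable
  show "(\<lambda>x. \<bar>g x\<bar> powr p) \<in> borel_measurable leb_Omega"
    using locally_integrable_measurable[OF has_weak_derivD(2)[OF assms]] by measurable
  show "AE x in leb_Omega. \<bar>weak_deriv u x\<bar> powr p = \<bar>g x\<bar> powr p"
    using weak_deriv_AE_eq[OF assms] by eventually_elim simp
qed

section \<open>The space of Sobolev functions vanishing at the boundary\<close>

lemma W01pD:
  assumes "u \<in> W01p p"
  obtains g where "u \<in> Lp p" "g \<in> Lp p" "has_weak_deriv u g"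
  using assms by (auto simp: W01p_def W1p_def)

lemma abs_integral_initial_le:
  fixes f :: "real \<Rightarrow> real"
  assumes f: "integrable leb_Omega f" and x: "x \<in> {-1..1}"
  shows "\<bar>integral {-1..x} f\<bar> \<le> (LINT x|leb_Omega. \<bar>f x\<bar>)"
proof -
  note HK = integrable_leb_Omega_HK[OF f]
  have sub: "{-1..x} \<subseteq> {-1..1}" using x by auto
  have "f integrable_on {-1..x}" "(\<lambda>x. \<bar>f x\<bar>) integrable_on {-1..x}"
    using integrable_subinterval_real[OF HK(1) sub] integrable_subinterval_real[OF HK(3) sub] by auto
  then have "\<bar>integral {-1..x} f\<bar> \<le> integral {-1..x} (\<lambda>x. \<bar>f x\<bar>)"
    using integral_norm_bound_integral[of f "{-1..x}" "\<lambda>x. \<bar>f x\<bar>"] by auto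
  also have "\<dots> \<le> integral {-1..1} (\<lambda>x. \<bar>f x\<bar>)"
    using HK(3) \<open>(\<lambda>x. \<bar>f x\<bar>) integrable_on {-1..x}\<close> sub by (intro integral_subset_le) auto
  also have "\<dots> = (LINT x|leb_Omega. \<bar>f x\<bar>)"
    using integrable_leb_Omega_HK(2)[of "\<lambda>x. \<bar>f x\<bar>"] f by simp
  finally show ?thesis .
qed

text \<open>The derivatives of the approximating test functions converge in L^p, hence in L^1, so
  the functions themselves converge uniformly to the primitive \<open>w\<close> of \<open>g\<close>.
  This yields the continuous representative and transports the zero boundary values. The
  approximating sequence is returned as well, for the later density argument.\<close>

lemma W01p_representative:
  assumes u: "u \<in> W01p p" and p: "1 \<le> p"
  obtains w g \<phi> e where "continuous_on {-1..1} w" "g \<in> Lp p" "has_weak_deriv u g"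
    "AE x in leb_Omega. u x = w x" "\<And>x. x \<in> {-1..1} \<Longrightarrow> w x = integral {-1..x} g" "w (-1) = 0" "w 1 = 0"
    "\<And>n. test_function (\<phi> n)" "(\<lambda>n. LINT x|leb_Omega. \<bar>deriv (\<phi> n) x - g x\<bar> powr p) \<longlonglongrightarrow> 0"
    "e \<longlonglongrightarrow> 0" "\<And>n x. x \<in> {-1..1} \<Longrightarrow> \<bar>\<phi> n x - w x\<bar> \<le> e n"
proof -
  obtain g where g: "u \<in> Lp p" "g \<in> Lp p" "has_weak_deriv u g"
    using W01pD[OF u] by blast
  obtain \<phi> where \<phi>: "\<And>n. test_function (\<phi> n)"
    and lim: "(\<lambda>n. sobolev_norm p (\<lambda>x. \<phi> n x - u x)) \<longlonglongrightarrow> 0"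
    using u by (auto simp: W01p_def)
  have wd: "has_weak_deriv (\<lambda>x. \<phi> n x - u x) (\<lambda>x. deriv (\<phi> n) x - g x)" for n
    using has_weak_deriv_lin[OF has_weak_deriv_test[OF \<phi>[of n]] g(3), of "- 1"] by simp
  have Lp1: "(\<lambda>x. \<phi> n x - u x) \<in> Lp p" "(\<lambda>x. deriv (\<phi> n) x - g x) \<in> Lp p" for n
    using Lp_lin[OF Lp_continuous[OF test_function_continuous_on[OF \<phi>[of n]]] g(1), of "- 1"]
      Lp_lin[OF Lp_continuous[OF test_function_continuous_on[OF test_function_deriv[OF \<phi>[of n]]]] g(2), of "- 1"] p
    by simp_all
  define a where "a n = (LINT x|leb_Omega. \<bar>\<phi> n x - u x\<bar> powr p)" for n
  define b where "b n = (LINT x|leb_Omega. \<bar>deriv (\<phi> n) x - g x\<bar> powr p)" for n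
  have ab0: "0 \<le> a n" "0 \<le> b n" for n by (auto simp: a_def b_def)
  have "sobolev_norm p (\<lambda>x. \<phi> n x - u x) powr p = a n + b n" for n
    using ab0[of n] p by (simp add: sobolev_norm_def integral_weak_deriv_powr[OF wd] powr_powr a_def b_def)
  moreover have "(\<lambda>n. sobolev_norm p (\<lambda>x. \<phi> n x - u x) powr p) \<longlonglongrightarrow> 0 powr p"
    using p by (intro tendsto_powr'[OF lim tendsto_const]) (auto simp: sobolev_norm_def)
  ultimately have ab: "(\<lambda>n. a n + b n) \<longlonglongrightarrow> 0" using p by simp
  have a: "a \<longlonglongrightarrow> 0" and b: "b \<longlonglongrightarrow> 0"
    by (rule tendsto_sandwich[OF _ _ tendsto_const ab]; use ab0 in simp)+
  have a1: "(\<lambda>n. LINT x|leb_Omega. \<bar>\<phi> n x - u x\<bar>) \<longlonglongrightarrow> 0"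
    by (rule L1_tendsto_0_if_Lp_tendsto_0[OF p Lp1(1) a[unfolded a_def]])
  define e where "e n = (LINT x|leb_Omega. \<bar>deriv (\<phi> n) x - g x\<bar>)" for n
  have e: "e \<longlonglongrightarrow> 0" unfolding e_def
    by (rule L1_tendsto_0_if_Lp_tendsto_0[OF p Lp1(2) b[unfolded b_def]])
  define w where "w x = integral {-1..x} g" for x
  have gi: "integrable leb_Omega g" by (rule Lp_integrable[OF g(2) p])
  have w: "continuous_on {-1..1} w"
    unfolding w_def by (rule indefinite_integral_continuous_1[OF integrable_leb_Omega_HK(1)[OF gi]])
  have unif: "\<bar>\<phi> n x - w x\<bar> \<le> e n" if x: "x \<in> {-1..1}" for n x
  proof -
    have sub: "{-1..x} \<subseteq> {-1..1}" using x by auto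
    have "\<phi> n x = integral {-1..x} (deriv (\<phi> n))"
      using integral_unique[OF test_function_has_integral[OF \<phi>[of n], of "-1" x]] x
        test_function_boundary[OF \<phi>[of n], of "-1"] by simp
    then have "\<phi> n x - w x = integral {-1..x} (\<lambda>x. deriv (\<phi> n) x - g x)"
      unfolding w_def using integrable_subinterval_real[OF integrable_leb_Omega_HK(1)[OF gi] sub]
      by (subst integral_diff)
        (auto intro: integrable_continuous_real test_function_continuous_on test_function_deriv \<phi>)
    then show ?thesis
      using abs_integral_initial_le[OF Lp_integrable[OF Lp1(2) p] x, of n] by (simp add: e_def)
  qed
  have "w 1 = 0"
  proof -
    have "(\<lambda>n. \<phi> n 1) \<longlonglongrightarrow> w 1"
      by (rule LIM_zero_cancel, rule Lim_null_comparison[OF _ e]) (use unif[of 1] in auto)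
    then show ?thesis
      using LIMSEQ_unique[OF _ tendsto_const[of 0]] test_function_boundary[OF \<phi>, of 1] by simp
  qed
  \<comment> \<open>Both \<open>u\<close> and \<open>w\<close> are L^1 limits of the same test
    functions, which identifies them almost everywhere.\<close>
  have "(LINT x|leb_Omega. \<bar>u x - w x\<bar>) \<le> (LINT x|leb_Omega. \<bar>\<phi> n x - u x\<bar>) + 2 * e n" for n
  proof -
    have i: "integrable leb_Omega (\<lambda>x. \<bar>\<phi> n x - u x\<bar>)" using Lp_integrable[OF Lp1(1) p] by simp
    have j: "integrable leb_Omega (\<lambda>x. \<bar>u x - w x\<bar>)"
      using Lp_integrable[OF g(1) p] lebesgue_on_Omega_continuous(1)[OF w] by simp
    have "(LINT x|leb_Omega. \<bar>u x - w x\<bar>) \<le> (LINT x|leb_Omega. \<bar>\<phi> n x - u x\<bar> + e n)"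
    proof (intro integral_mono)
      fix x assume "x \<in> space leb_Omega"
      then show "\<bar>u x - w x\<bar> \<le> \<bar>\<phi> n x - u x\<bar> + e n"
        using unif[of x n] by auto
    qed (use i j in auto)
    also have "\<dots> = (LINT x|leb_Omega. \<bar>\<phi> n x - u x\<bar>) + 2 * e n"
      using i by (simp del: lebesgue_integral_const)
    finally show ?thesis .
  qed
  moreover have "(\<lambda>n. (LINT x|leb_Omega. \<bar>\<phi> n x - u x\<bar>) + 2 * e n) \<longlonglongrightarrow> 0 + 2 * 0"
    by (intro tendsto_intros a1 e)
  ultimately have "(LINT x|leb_Omega. \<bar>u x - w x\<bar>) \<le> 0"
    by (intro LIMSEQ_le_const) auto
  then have "(LINT x|leb_Omega. \<bar>u x - w x\<bar>) = 0"
    by (intro antisym) auto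
  then have "AE x in leb_Omega. \<bar>u x - w x\<bar> = 0"
    using Lp_integrable[OF g(1) p] lebesgue_on_Omega_continuous(1)[OF w]
    by (subst (asm) integral_nonneg_eq_0_iff_AE) auto
  then have "AE x in leb_Omega. u x = w x" by simp
  then show ?thesis
    using that[OF w g(2,3), of \<phi> e] \<phi> b e unif \<open>w 1 = 0\<close> unfolding b_def w_def by simp
qed

lemma W01p_add_test:
  assumes u: "u \<in> W01p p" and \<eta>: "test_function \<eta>" and p: "1 \<le> p"
  shows "(\<lambda>x. u x + c * \<eta> x) \<in> W01p p"
proof -
  obtain g where g: "u \<in> Lp p" "g \<in> Lp p" "has_weak_deriv u g"
    using W01pD[OF u] by blast
  obtain \<phi> where \<phi>: "\<And>n. test_function (\<phi> n)"
    and lim: "(\<lambda>n. sobolev_norm p (\<lambda>x. \<phi> n x - u x)) \<longlonglongrightarrow> 0"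
    using u by (auto simp: W01p_def)
  have "(\<lambda>x. u x + c * \<eta> x) \<in> W1p p"
    unfolding W1p_def
    using Lp_lin[OF g(1) Lp_continuous[OF test_function_continuous_on[OF \<eta>]], of c]
      Lp_lin[OF g(2) Lp_continuous[OF test_function_continuous_on[OF test_function_deriv[OF \<eta>]]], of c]
      has_weak_deriv_lin[OF g(3) has_weak_deriv_test[OF \<eta>], of c] p by auto
  moreover have "(\<lambda>n. sobolev_norm p (\<lambda>x. (\<phi> n x + c * \<eta> x) - (u x + c * \<eta> x))) \<longlonglongrightarrow> 0"
    using lim by simp
  ultimately show ?thesis
    unfolding W01p_def using test_function_add[OF \<phi> test_function_cmult[OF \<eta>, of c]]
    by (intro CollectI conjI exI[of _ "\<lambda>n x. \<phi> n x + c * \<eta> x"]) auto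
qed

section \<open>Approximation of continuously differentiable functions by test functions\<close>

lemma cutoff_shrinking_tendsto:
  assumes x: "x \<in> Omega"
  shows "(\<lambda>n. cutoff (-1 + 1 / real (n + 2)) (1 - 1 / real (n + 2)) n x) \<longlonglongrightarrow> 1"
proof -
  have d: "(\<lambda>n. 1 / real (n + 2)) \<longlonglongrightarrow> 0"
    using LIMSEQ_ignore_initial_segment[OF lim_inverse_n', of 2] by simp
  have N: "filterlim (\<lambda>n. real (Suc n)) at_top sequentially"
    by (rule filterlim_compose[OF filterlim_real_sequentially filterlim_Suc])
  have pos: "0 < 1 + x" "0 < 1 - x" using x by auto
  have a: "(\<lambda>n. x - (-1 + 1 / real (n + 2))) \<longlonglongrightarrow> 1 + x" "(\<lambda>n. (1 - 1 / real (n + 2)) - x) \<longlonglongrightarrow> 1 - x"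
    using tendsto_diff[OF tendsto_const[of "1 + x"] d] tendsto_diff[OF tendsto_const[of "1 - x"] d]
    by (simp_all add: algebra_simps)
  have l: "(\<lambda>n. exp (- (1 / (real (Suc n) * (x - (-1 + 1 / real (n + 2))))))) \<longlonglongrightarrow> exp (- 0)"
    "(\<lambda>n. exp (- (1 / (real (Suc n) * ((1 - 1 / real (n + 2)) - x))))) \<longlonglongrightarrow> exp (- 0)"
    by (intro tendsto_exp tendsto_minus tendsto_divide_0[OF tendsto_const]
        filterlim_at_top_imp_at_infinity filterlim_at_top_mult_tendsto_pos[OF a(1) pos(1) N]
        filterlim_at_top_mult_tendsto_pos[OF a(2) pos(2) N])+
  have ev: "\<forall>\<^sub>F n in sequentially. -1 + 1 / real (n + 2) < x \<and> x < 1 - 1 / real (n + 2)"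
    using order_tendstoD(1)[OF a(1) pos(1)] order_tendstoD(1)[OF a(2) pos(2)]
    by eventually_elim auto
  have "(\<lambda>n. exp (- (1 / (real (Suc n) * (x - (-1 + 1 / real (n + 2)))))) *
      exp (- (1 / (real (Suc n) * ((1 - 1 / real (n + 2)) - x))))) \<longlonglongrightarrow> 1"
    using tendsto_mult[OF l] by simp
  then show ?thesis
    by (rule Lim_transform_eventually) (use ev in \<open>eventually_elim; simp add: cutoff_eq\<close>)
qed

text \<open>Applied to derivatives: Weierstrass polynomials are cut off near the boundary and their
  small mean is removed by a fixed bump, so that the primitives of the approximants are test
  functions again.\<close>

lemma continuous_approx_by_test:
  assumes g: "continuous_on {-1..1} g" and g0: "integral {-1..1} g = 0"
  obtains h M where "\<And>n. test_function (h n)" "\<And>n. integral {-1..1} (h n) = 0"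
    "\<And>x. x \<in> Omega \<Longrightarrow> (\<lambda>n. h n x) \<longlonglongrightarrow> g x" "\<And>n x. x \<in> Omega \<Longrightarrow> \<bar>h n x\<bar> \<le> M"
proof -
  have "\<exists>q. real_polynomial_function q \<and> (\<forall>x\<in>{-1..1}. \<bar>g x - q x\<bar> < inverse (real (Suc n)))" for n
    by (rule Stone_Weierstrass_real_polynomial_function[OF compact_Icc g, of "inverse (real (Suc n))"])
      (simp, blast)
  then obtain q where q: "\<And>n. real_polynomial_function (q n)"
    "\<And>n x. x \<in> {-1..1} \<Longrightarrow> \<bar>g x - q n x\<bar> < inverse (real (Suc n))" by metis
  define k where "k n x = q n x * cutoff (-1 + 1 / real (n + 2)) (1 - 1 / real (n + 2)) n x" for n x
  have k: "test_function (k n)" for n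
    unfolding k_def by (intro test_function_smooth_mult smooth_polynomial q test_function_cutoff) auto
  obtain G where G: "G > 0" "\<And>x. x \<in> {-1..1} \<Longrightarrow> \<bar>g x\<bar> \<le> G"
    using compact_imp_bounded[OF compact_continuous_image[OF g]] by (auto simp: bounded_pos)
  have kb: "\<bar>k n x\<bar> \<le> G + 1" if "x \<in> {-1..1}" for n x
  proof -
    have "inverse (real (Suc n)) \<le> 1" by (simp add: inverse_le_1_iff)
    then have "\<bar>q n x\<bar> \<le> G + 1" using q(2)[OF that, of n] G(2)[OF that] by linarith
    moreover have "\<bar>k n x\<bar> \<le> \<bar>q n x\<bar> * 1"
      unfolding k_def abs_mult using cutoff_bounds by (intro mult_left_mono) auto
    ultimately show ?thesis by simp
  qed
  have klim: "(\<lambda>n. k n x) \<longlonglongrightarrow> g x" if x: "x \<in> Omega" for x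
  proof -
    have "(\<lambda>n. q n x) \<longlonglongrightarrow> g x"
    proof (rule LIM_zero_cancel, rule Lim_null_comparison[OF _ LIMSEQ_inverse_real_of_nat], rule always_eventually, rule allI)
      fix n show "norm (q n x - g x) \<le> inverse (real (Suc n))"
        using q(2)[of x n] x by auto
    qed
    from tendsto_mult[OF this cutoff_shrinking_tendsto[OF x]] show ?thesis by (simp add: k_def)
  qed
  have "(\<lambda>n. LINT x|leb_Omega. k n x) \<longlonglongrightarrow> (LINT x|leb_Omega. g x)"
  proof (rule integral_dominated_convergence[where w="\<lambda>x. G + 1"])
    show "g \<in> borel_measurable leb_Omega"
      using lebesgue_on_Omega_continuous(1)[OF g] by blast
  qed (use kb klim test_function_measurable[OF k] in auto)
  then have klim': "(\<lambda>n. integral {-1..1} (k n)) \<longlonglongrightarrow> 0"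
    using lebesgue_on_Omega_continuous(2)[OF g] g0
      lebesgue_on_Omega_continuous(2)[OF test_function_continuous_on[OF k]] by simp
  define \<rho> where "\<rho> = cutoff (-1/2) (1/2) 0"
  have \<rho>: "test_function \<rho>" unfolding \<rho>_def by (rule test_function_cutoff) auto
  define I where "I = integral {-1..1} \<rho>"
  have "I \<noteq> 0"
  proof
    assume "I = 0"
    then have "\<rho> 0 = 0"
      using integral_eq_0_iff[of "-1" 1 \<rho>] test_function_continuous_on[OF \<rho>] cutoff_bounds
      unfolding I_def \<rho>_def by auto
    then show False by (simp add: \<rho>_def cutoff_eq)
  qed
  define c where "c n = integral {-1..1} (k n) / I" for n
  have c: "c \<longlonglongrightarrow> 0" using tendsto_divide[OF klim' tendsto_const[of I] \<open>I \<noteq> 0\<close>] unfolding c_def by simp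
  from convergent_imp_Bseq[OF convergentI[OF c]] obtain C where C: "\<And>n. \<bar>c n\<bar> \<le> C"
    by (auto simp: Bseq_def)
  define h where "h n x = k n x + (- c n) * \<rho> x" for n x
  have h: "test_function (h n)" for n
    unfolding h_def by (intro test_function_add test_function_cmult k \<rho>)
  have icont: "\<psi> integrable_on {-1..1}" if "test_function \<psi>" for \<psi>
    by (rule integrable_continuous_real[OF test_function_continuous_on[OF that]])
  have "integral {-1..1} (h n) = 0" for n
    unfolding h_def using integral_add[OF icont[OF k[of n]] icont[OF test_function_cmult[OF \<rho>, of "- c n"]]] \<open>I \<noteq> 0\<close>
    by (simp add: c_def I_def)
  moreover have "(\<lambda>n. h n x) \<longlonglongrightarrow> g x" if "x \<in> Omega" for x
    using tendsto_add[OF klim[OF that] tendsto_mult[OF tendsto_minus[OF c] tendsto_const[of "\<rho> x"]]]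
    by (simp add: h_def)
  moreover have "\<bar>h n x\<bar> \<le> G + 1 + C" if "x \<in> Omega" for n x
  proof -
    have "\<bar>c n\<bar> * \<bar>\<rho> x\<bar> \<le> C * 1"
      using C[of n] cutoff_bounds unfolding \<rho>_def by (intro mult_mono) auto
    then have "\<bar>(- c n) * \<rho> x\<bar> \<le> C" by (simp add: abs_mult)
    then show ?thesis
      using kb[of x n] that abs_triangle_ineq[of "k n x" "(- c n) * \<rho> x"] unfolding h_def by simp
  qed
  ultimately show ?thesis using that h by blast
qed

text \<open>Converse to the extraction of a representative: a continuously differentiable function
  vanishing at both ends is a Sobolev limit of test functions. It certifies the explicit competitors
  built from the generalized sine.\<close>

lemma W01p_C1:
  assumes p: "1 \<le> p" and g: "continuous_on {-1..1} g" and g0: "integral {-1..1} g = 0"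
    and u: "\<And>x. x \<in> {-1..1} \<Longrightarrow> u x = integral {-1..x} g"
  shows "u \<in> W01p p" "has_weak_deriv u g" "continuous_on {-1..1} u"
proof -
  obtain h M where h: "\<And>n. test_function (h n)" "\<And>n. integral {-1..1} (h n) = 0"
    "\<And>x. x \<in> Omega \<Longrightarrow> (\<lambda>n. h n x) \<longlonglongrightarrow> g x" "\<And>n x. x \<in> Omega \<Longrightarrow> \<bar>h n x\<bar> \<le> M"
    using continuous_approx_by_test[OF g g0] by blast
  have "\<exists>\<eta>. test_function \<eta> \<and> deriv \<eta> = h n \<and> (\<forall>x\<in>{-1..1}. \<eta> x = integral {-1..x} (h n))" for n
    using test_function_antideriv[OF h(1,2)] by metis
  then obtain \<phi> where \<phi>: "\<And>n. test_function (\<phi> n)" "\<And>n. deriv (\<phi> n) = h n"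
    "\<And>n x. x \<in> {-1..1} \<Longrightarrow> \<phi> n x = integral {-1..x} (h n)" by metis
  show cu: "continuous_on {-1..1} u"
    using indefinite_integral_continuous_1[OF integrable_continuous_real[OF g]] u
      continuous_on_cong[of "{-1..1}" "{-1..1}" u "\<lambda>x. integral {-1..x} g"] by simp
  show wd: "has_weak_deriv u g"
  proof (rule has_weak_deriv_C1[OF cu g])
    fix x :: real assume x: "x \<in> {-1<..<1}"
    have "((\<lambda>x. integral {-1..x} g) has_vector_derivative g x) (at x within {-1..1})"
      by (rule integral_has_vector_derivative[OF g]) (use x in auto)
    then have "((\<lambda>x. integral {-1..x} g) has_real_derivative g x) (at x)"
      using x by (simp add: has_real_derivative_iff_has_vector_derivative at_within_Icc_at)
    then show "(u has_real_derivative g x) (at x)"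
      by (rule has_field_derivative_transform_within_open[of _ _ _ "{-1<..<1}"]) (use x u in auto)
  qed
  have Lpu: "u \<in> Lp p" "g \<in> Lp p" using Lp_continuous[OF cu] Lp_continuous[OF g] p by auto
  then have W: "u \<in> W1p p" using wd by (auto simp: W1p_def)
  have hLp: "(\<lambda>x. h n x - g x) \<in> Lp p" for n
    using p by (intro Lp_continuous continuous_intros test_function_continuous_on h g) auto
  obtain G where G: "G > 0" "\<And>x. x \<in> {-1..1} \<Longrightarrow> \<bar>g x\<bar> \<le> G"
    using compact_imp_bounded[OF compact_continuous_image[OF g]] by (auto simp: bounded_pos)
  have b: "(\<lambda>n. LINT x|leb_Omega. \<bar>h n x - g x\<bar> powr p) \<longlonglongrightarrow> (LINT x|leb_Omega. 0)"
  proof (rule integral_dominated_convergence[where w="\<lambda>x. (M + G) powr p"])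
    show "AE x in leb_Omega. (\<lambda>n. \<bar>h n x - g x\<bar> powr p) \<longlonglongrightarrow> 0"
    proof (intro AE_I2)
      fix x assume "x \<in> space leb_Omega"
      then have "(\<lambda>n. \<bar>h n x - g x\<bar>) \<longlonglongrightarrow> 0"
        using tendsto_rabs_zero[OF LIM_zero[OF h(3)]] by auto
      from tendsto_powr'[OF this tendsto_const[of p]] p show "(\<lambda>n. \<bar>h n x - g x\<bar> powr p) \<longlonglongrightarrow> 0"
        by simp
    qed
    show "AE x in leb_Omega. norm (\<bar>h n x - g x\<bar> powr p) \<le> (M + G) powr p" for n
    proof (intro AE_I2)
      fix x assume "x \<in> space leb_Omega"
      then show "norm (\<bar>h n x - g x\<bar> powr p) \<le> (M + G) powr p"
        using h(4)[of x n] G(2)[of x] p by (auto intro!: powr_mono2)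
    qed
  qed (use LpD(2)[OF hLp] in auto)
  define e where "e n = (LINT x|leb_Omega. \<bar>h n x - g x\<bar>)" for n
  have e: "e \<longlonglongrightarrow> 0" unfolding e_def
    by (rule L1_tendsto_0_if_Lp_tendsto_0[OF p hLp]) (use b in simp)
  have wd': "has_weak_deriv (\<lambda>x. \<phi> n x - u x) (\<lambda>x. h n x - g x)" for n
    using has_weak_deriv_lin[OF has_weak_deriv_test[OF \<phi>(1)[of n]] wd, of "- 1"] by (simp add: \<phi>(2))
  have unif: "\<bar>\<phi> n x - u x\<bar> \<le> e n" if x: "x \<in> {-1..1}" for n x
  proof -
    have sub: "{-1..x} \<subseteq> {-1..1}" using x by auto
    have "\<phi> n x - u x = integral {-1..x} (\<lambda>x. h n x - g x)"
      unfolding \<phi>(3)[OF x] u[OF x]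
      by (subst integral_diff)
        (auto intro!: integrable_continuous_real test_function_continuous_on h continuous_on_subset[OF g sub])
    then show ?thesis
      using abs_integral_initial_le[OF Lp_integrable[OF hLp p] x, of n] by (simp add: e_def)
  qed
  have e0: "0 \<le> e n" for n by (simp add: e_def)
  have a: "(LINT x|leb_Omega. \<bar>\<phi> n x - u x\<bar> powr p) \<le> 2 * e n powr p" for n
  proof -
    have c: "continuous_on {-1..1} (\<lambda>x. \<phi> n x - u x)"
      by (intro continuous_intros test_function_continuous_on \<phi> cu)
    have "(LINT x|leb_Omega. \<bar>\<phi> n x - u x\<bar> powr p) \<le> (LINT x|leb_Omega. e n powr p)"
    proof (intro integral_mono LpD(2)[OF Lp_continuous[OF c]])
      fix x assume "x \<in> space leb_Omega"
      then show "\<bar>\<phi> n x - u x\<bar> powr p \<le> e n powr p"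
        using unif[of x n] p by (intro powr_mono2) auto
    qed (use p in auto)
    then show ?thesis by (simp del: lebesgue_integral_const)
  qed
  have ep: "(\<lambda>n. 2 * e n powr p) \<longlonglongrightarrow> 2 * 0 powr p"
    using p e0 by (intro tendsto_mult tendsto_const tendsto_powr'[OF e]) auto
  have "(\<lambda>n. LINT x|leb_Omega. \<bar>\<phi> n x - u x\<bar> powr p) \<longlonglongrightarrow> 0"
  proof (rule tendsto_sandwich[OF _ _ tendsto_const])
    show "(\<lambda>n. 2 * e n powr p) \<longlonglongrightarrow> 0" using ep p by simp
  qed (use a in \<open>auto simp: always_eventually\<close>)
  from tendsto_add[OF this b]
  have "(\<lambda>n. ((LINT x|leb_Omega. \<bar>\<phi> n x - u x\<bar> powr p) + (LINT x|leb_Omega. \<bar>h n x - g x\<bar> powr p)) powr (1/p)) \<longlonglongrightarrow> 0 powr (1/p)"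
    using p by (intro tendsto_powr'[OF _ tendsto_const]) (auto intro!: always_eventually add_nonneg_nonneg)
  then have "(\<lambda>n. sobolev_norm p (\<lambda>x. \<phi> n x - u x)) \<longlonglongrightarrow> 0"
    using p by (simp add: sobolev_norm_def integral_weak_deriv_powr[OF wd'])
  then show "u \<in> W01p p"
    unfolding W01p_def using W \<phi>(1) by blast
qed

section \<open>Signed powers and perturbed integrals\<close>

definition spow :: "real \<Rightarrow> real \<Rightarrow> real" where
  "spow q s = \<bar>s\<bar> powr (q - 1) * s"

text \<open>Up to the factor \<open>r\<close> the derivative of \<open>spow r\<close>; the case \<open>r = 1\<close> is separate because \<open>0 powr 0 = 0\<close>.\<close>

definition dpow :: "real \<Rightarrow> real \<Rightarrow> real" where
  "dpow r s = (if r = 1 then 1 else \<bar>s\<bar> powr (r - 1))"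

lemma abs_spow: "\<bar>spow q s\<bar> = \<bar>s\<bar> powr q"
  by (simp add: spow_def abs_mult mult.commute[of _ "\<bar>s\<bar>"] powr_mult_base)

lemma spow_0 [simp]: "spow q 0 = 0"
  by (simp add: spow_def)

lemma spow_1 [simp]: "spow q 1 = 1"
  by (simp add: spow_def)

lemma spow_minus: "spow q (- s) = - spow q s"
  by (simp add: spow_def)

lemma spow_nonneg: "0 \<le> s \<Longrightarrow> spow q s = s powr q"
  by (simp add: spow_def mult.commute[of _ s] powr_mult_base)

lemma spow_nonneg_iff: "0 \<le> spow q s \<longleftrightarrow> 0 \<le> s"
  by (auto simp: spow_def zero_le_mult_iff)

lemma spow_mult: "spow q (c * s) = spow q c * spow q s"
  by (simp add: spow_def abs_mult powr_mult)

lemma spow_inverse: "0 < q \<Longrightarrow> spow (1 / q) (spow q s) = s"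
proof (cases "s = 0")
  case False
  assume "0 < q"
  have "spow (1 / q) (spow q s) = \<bar>spow q s\<bar> powr (1 / q - 1) * spow q s"
    by (simp add: spow_def)
  also have "\<dots> = \<bar>s\<bar> powr (q * (1 / q - 1)) * (\<bar>s\<bar> powr (q - 1) * s)"
    unfolding abs_spow powr_powr by (simp add: spow_def)
  also have "\<dots> = \<bar>s\<bar> powr (q * (1 / q - 1) + (q - 1)) * s"
    by (simp add: powr_add)
  also have "q * (1 / q - 1) + (q - 1) = 0" using \<open>0 < q\<close> by (simp add: algebra_simps)
  finally show ?thesis using False by simp
qed simp

lemma continuous_on_spow:
  fixes f :: "real \<Rightarrow> real"
  assumes "0 < q" "continuous_on S f" shows "continuous_on S (\<lambda>x. spow q (f x))"
proof -
  have "spow q s = (max s 0) powr q - (max (- s) 0) powr q" for s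
    using spow_nonneg[of s q] spow_nonneg[of "- s" q] assms(1) by (cases "s \<ge> 0") (auto simp: spow_minus max_def)
  moreover have "continuous_on S (\<lambda>x. (max (f x) 0) powr q - (max (- f x) 0) powr q)"
    using assms by (intro continuous_on_diff continuous_on_powr' continuous_on_max continuous_on_minus
        continuous_on_const) auto
  ultimately show ?thesis by simp
qed

lemma measurable_spow [measurable]: "f \<in> borel_measurable M \<Longrightarrow> (\<lambda>x. spow q (f x)) \<in> borel_measurable M"
  unfolding spow_def by measurable

lemma continuous_on_dpow:
  fixes f :: "real \<Rightarrow> real"
  shows "1 \<le> r \<Longrightarrow> continuous_on S f \<Longrightarrow> continuous_on S (\<lambda>x. dpow r (f x))"
  using continuous_on_abs_powr[of S f "r - 1"] by (cases "r = 1") (auto simp: dpow_def)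

lemma abs_powr_tendsto_0:
  assumes "0 < a" shows "((\<lambda>h::real. \<bar>h\<bar> powr a) \<longlongrightarrow> 0) (at 0)"
proof -
  have "isCont (\<lambda>h::real. \<bar>h\<bar> powr a) 0"
    using continuous_on_abs_powr[of UNIV "\<lambda>x. x" a] assms by (simp add: continuous_on_eq_continuous_at)
  then show ?thesis by (simp add: isCont_def)
qed

lemma abs_powr_has_derivative:
  assumes "1 < p" shows "((\<lambda>s. \<bar>s\<bar> powr p) has_real_derivative p * spow (p - 1) s) (at s)"
proof -
  consider "s < 0" | "s = 0" | "s > 0" by linarith
  then show ?thesis
  proof cases
    case 1
    have "(- s) powr (p - 1) = (- s) * (- s) powr (p - 2)"
      using 1 powr_mult_base[of "- s" "p - 2"] by (simp add: algebra_simps)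
    then have "p * spow (p - 1) s = - (p * (- s) powr (p - 1))"
      using 1 by (simp add: spow_def)
    then have "((\<lambda>s. (- s) powr p) has_real_derivative p * spow (p - 1) s) (at s)"
      using 1 by (auto intro!: derivative_eq_intros)
    then show ?thesis
      by (rule has_field_derivative_transform_within_open[of _ _ _ "{..<0}"]) (use 1 in auto)
  next
    case 2
    have "((\<lambda>h::real. \<bar>h\<bar> powr p / h) \<longlongrightarrow> 0) (at 0)"
    proof (rule Lim_null_comparison[OF _ abs_powr_tendsto_0[of "p - 1"]])
      show "\<forall>\<^sub>F x in at 0. norm (\<bar>x\<bar> powr p / x) \<le> \<bar>x\<bar> powr (p - 1)"
        by (auto simp: eventually_at_filter powr_diff intro!: always_eventually)
    qed (use assms in auto)
    then show ?thesis using 2 by (simp add: DERIV_def)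
  next
    case 3
    have "((\<lambda>s. s powr p) has_real_derivative p * spow (p - 1) s) (at s)"
      using 3 by (auto intro!: derivative_eq_intros simp: spow_nonneg)
    then show ?thesis
      by (rule has_field_derivative_transform_within_open[of _ _ _ "{0<..}"]) (use 3 in auto)
  qed
qed

lemma spow_has_derivative:
  assumes "1 \<le> r" shows "(spow r has_real_derivative r * dpow r s) (at s)"
proof -
  consider "s < 0" | "s = 0" | "s > 0" by linarith
  then show ?thesis
  proof cases
    case 1
    have "r * dpow r s = r * (- s) powr (r - 1)"
      using 1 by (auto simp: dpow_def)
    moreover have "((\<lambda>s. - ((- s) powr r)) has_real_derivative r * (- s) powr (r - 1)) (at s)"
      using 1 by (auto intro!: derivative_eq_intros)
    ultimately have "((\<lambda>s. - ((- s) powr r)) has_real_derivative r * dpow r s) (at s)" by (simp only:)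
    then show ?thesis
      by (rule has_field_derivative_transform_within_open[of _ _ _ "{..<0}"])
        (use 1 in \<open>auto simp: spow_nonneg[of "- _" r, simplified spow_minus, symmetric]\<close>)
  next
    case 2
    have "((\<lambda>h. spow r h / h) \<longlongrightarrow> dpow r 0) (at 0)"
    proof (cases "r = 1")
      case True
      then show ?thesis
        by (intro Lim_transform_eventually[OF tendsto_const])
          (auto simp: eventually_at_filter spow_def dpow_def)
    next
      case False
      have "((\<lambda>h. spow r h / h) \<longlongrightarrow> 0) (at 0)"
        using assms False
        by (intro Lim_transform_eventually[OF abs_powr_tendsto_0[of "r - 1"]])
          (auto simp: eventually_at_filter spow_def)
      then show ?thesis using False by (simp add: dpow_def)
    qed
    then show ?thesis using 2 by (simp add: DERIV_def dpow_def split: if_splits)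
  next
    case 3
    have "r * dpow r s = r * s powr (r - 1)"
      using 3 by (auto simp: dpow_def)
    moreover have "((\<lambda>s. s powr r) has_real_derivative r * s powr (r - 1)) (at s)"
      using 3 by (auto intro!: derivative_eq_intros)
    ultimately have "((\<lambda>s. s powr r) has_real_derivative r * dpow r s) (at s)" by (simp only:)
    then show ?thesis
      by (rule has_field_derivative_transform_within_open[of _ _ _ "{0<..}"])
        (use 3 in \<open>auto simp: spow_nonneg\<close>)
  qed
qed

text \<open>For \<gamma> = 1 the absolute value has a corner at 0, but a stationary inner function
  flattens it. This covers \<open>r = p\<close> at moment zero.\<close>

lemma abs_powr_derivative_0:
  fixes j :: "real \<Rightarrow> real"
  assumes j: "(j has_real_derivative 0) (at x)" and "1 \<le> \<gamma>"
  shows "((\<lambda>e. \<bar>j e\<bar> powr \<gamma>) has_real_derivative 0) (at x)"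
proof (cases "\<gamma> = 1")
  case True
  have "((\<lambda>e. (\<bar>j e\<bar> - \<bar>j x\<bar>) / (e - x)) \<longlongrightarrow> 0) (at x)"
  proof (rule Lim_null_comparison)
    show "((\<lambda>e. \<bar>(j e - j x) / (e - x)\<bar>) \<longlongrightarrow> 0) (at x)"
      using j by (intro tendsto_rabs_zero) (simp add: has_field_derivative_iff)
    show "\<forall>\<^sub>F e in at x. norm ((\<bar>j e\<bar> - \<bar>j x\<bar>) / (e - x)) \<le> \<bar>(j e - j x) / (e - x)\<bar>"
      by (intro always_eventually allI) (simp add: abs_divide divide_right_mono)
  qed
  then show ?thesis using True by (simp add: has_field_derivative_iff)
next
  case False
  then show ?thesis
    using DERIV_chain2[OF abs_powr_has_derivative[of \<gamma> "j x"] j] assms(2) by simp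
qed

text \<open>Differentiation under the integral. The mean value theorem and the growth of order p of
  \<psi>' dominate the difference quotients, because the direction \<open>b\<close> is
  bounded.\<close>

lemma deriv_integral_perturbation:
  fixes \<psi> \<psi>' a b :: "real \<Rightarrow> real"
  assumes p: "0 \<le> p" and \<psi>: "\<And>s. (\<psi> has_real_derivative \<psi>' s) (at s)"
    and m': "\<psi>' \<in> borel_measurable borel"
    and bd: "\<And>s. \<bar>\<psi> s\<bar> \<le> c * (1 + \<bar>s\<bar> powr p)" "\<And>s. \<bar>\<psi>' s\<bar> \<le> c * (1 + \<bar>s\<bar> powr p)" and c: "0 \<le> c"
    and a: "a \<in> Lp p" and b: "b \<in> Lp p" "\<And>x. x \<in> Omega \<Longrightarrow> \<bar>b x\<bar> \<le> B"
  shows "((\<lambda>e. LINT x|leb_Omega. \<psi> (a x + e * b x)) has_real_derivative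
      (LINT x|leb_Omega. \<psi>' (a x) * b x)) (at 0)"
proof -
  have ma: "a \<in> borel_measurable leb_Omega" "b \<in> borel_measurable leb_Omega"
    using LpD(1) a b by auto
  have B: "0 \<le> B" using b(2)[of 0] by auto
  have "continuous_on UNIV \<psi>"
    using \<psi> DERIV_isCont continuous_at_imp_continuous_on by blast
  then have m: "\<psi> \<in> borel_measurable borel" by (rule borel_measurable_continuous_onI)
  have int: "integrable leb_Omega (\<lambda>x. \<psi> (a x + e * b x))" for e
  proof (rule Bochner_Integration.integrable_bound)
    show "integrable leb_Omega (\<lambda>x. c * (1 + \<bar>a x + e * b x\<bar> powr p))"
      using LpD(2)[OF Lp_lin[OF a b(1) p]] by simp
    show "(\<lambda>x. \<psi> (a x + e * b x)) \<in> borel_measurable leb_Omega"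
      using ma by (intro measurable_compose[OF _ m] borel_measurable_add borel_measurable_times borel_measurable_const)
  qed (use bd(1) c in \<open>auto simp: abs_of_nonneg add_nonneg_nonneg\<close>)
  have lip: "\<bar>\<psi> (s + d) - \<psi> s\<bar> \<le> c * (1 + (\<bar>s\<bar> + \<bar>d\<bar>) powr p) * \<bar>d\<bar>" for s d
  proof -
    have "norm (\<psi> (s + d) - \<psi> s) \<le> c * (1 + (\<bar>s\<bar> + \<bar>d\<bar>) powr p) * norm (s + d - s)"
    proof (rule field_differentiable_bound[where S="{- (\<bar>s\<bar> + \<bar>d\<bar>)..\<bar>s\<bar> + \<bar>d\<bar>}" and f'=\<psi>'])
      fix z assume z: "z \<in> {- (\<bar>s\<bar> + \<bar>d\<bar>)..\<bar>s\<bar> + \<bar>d\<bar>}"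
      show "(\<psi> has_field_derivative \<psi>' z) (at z within {- (\<bar>s\<bar> + \<bar>d\<bar>)..\<bar>s\<bar> + \<bar>d\<bar>})"
        using \<psi> has_field_derivative_at_within by blast
      have "\<bar>z\<bar> powr p \<le> (\<bar>s\<bar> + \<bar>d\<bar>) powr p" using z p by (intro powr_mono2) auto
      then show "norm (\<psi>' z) \<le> c * (1 + (\<bar>s\<bar> + \<bar>d\<bar>) powr p)"
        using bd(2)[of z] mult_left_mono[of "1 + \<bar>z\<bar> powr p" "1 + (\<bar>s\<bar> + \<bar>d\<bar>) powr p" c] c by auto
    qed auto
    then show ?thesis by simp
  qed
  have "((\<lambda>e. ((LINT x|leb_Omega. \<psi> (a x + e * b x)) - (LINT x|leb_Omega. \<psi> (a x + 0 * b x))) / (e - 0))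
      \<longlongrightarrow> (LINT x|leb_Omega. \<psi>' (a x) * b x)) (at 0)"
    unfolding tendsto_at_iff_sequentially comp_def
  proof (intro allI impI)
    fix X :: "nat \<Rightarrow> real" assume X: "\<forall>i. X i \<in> UNIV - {0}" "X \<longlonglongrightarrow> 0"
    from convergent_imp_Bseq[OF convergentI[OF X(2)]] obtain K where K: "\<And>n. \<bar>X n\<bar> \<le> K"
      by (auto simp: Bseq_def)
    let ?s = "\<lambda>i x. (\<psi> (a x + X i * b x) - \<psi> (a x)) / X i"
    have lim: "(\<lambda>i. LINT x|leb_Omega. ?s i x) \<longlonglongrightarrow> (LINT x|leb_Omega. \<psi>' (a x) * b x)"
    proof (rule integral_dominated_convergence[where w="\<lambda>x. c * (1 + 2 powr p * (\<bar>a x\<bar> powr p + (K * B) powr p)) * B"])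
      show "(\<lambda>x. \<psi>' (a x) * b x) \<in> borel_measurable leb_Omega"
        using ma by (intro borel_measurable_times measurable_compose[OF _ m'])
      show "?s i \<in> borel_measurable leb_Omega" for i
        using int[of "X i"] int[of 0] by auto
      show "integrable leb_Omega (\<lambda>x. c * (1 + 2 powr p * (\<bar>a x\<bar> powr p + (K * B) powr p)) * B)"
        using LpD(2)[OF a] by simp
      show "AE x in leb_Omega. (\<lambda>i. ?s i x) \<longlonglongrightarrow> \<psi>' (a x) * b x"
      proof (intro AE_I2)
        fix x
        have "((\<lambda>e. \<psi> (a x + e * b x)) has_real_derivative \<psi>' (a x) * b x) (at 0)"
          by (rule DERIV_chain2[where f=\<psi>]) (use \<psi>[of "a x"] in \<open>auto intro!: derivative_eq_intros\<close>)
        then have "((\<lambda>e. (\<psi> (a x + e * b x) - \<psi> (a x)) / e) \<longlongrightarrow> \<psi>' (a x) * b x) (at 0)"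
          by (simp add: has_field_derivative_iff)
        then show "(\<lambda>i. ?s i x) \<longlonglongrightarrow> \<psi>' (a x) * b x"
          using X unfolding tendsto_at_iff_sequentially comp_def by auto
      qed
      show "AE x in leb_Omega. norm (?s i x) \<le> c * (1 + 2 powr p * (\<bar>a x\<bar> powr p + (K * B) powr p)) * B" for i
      proof (intro AE_I2)
        fix x assume "x \<in> space leb_Omega"
        then have bx: "\<bar>b x\<bar> \<le> B" using b(2) by simp
        have d: "\<bar>X i * b x\<bar> \<le> K * B" unfolding abs_mult
          using bx K[of i] by (intro mult_mono) auto
        have "norm (?s i x) \<le> c * (1 + (\<bar>a x\<bar> + \<bar>X i * b x\<bar>) powr p) * \<bar>X i * b x\<bar> / \<bar>X i\<bar>"
          using lip[of "a x" "X i * b x"] by (simp add: divide_right_mono)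
        also have "\<dots> = c * (1 + (\<bar>a x\<bar> + \<bar>X i * b x\<bar>) powr p) * \<bar>b x\<bar>"
          using X(1) by (simp add: abs_mult)
        also have "\<dots> \<le> c * (1 + 2 powr p * (\<bar>a x\<bar> powr p + (K * B) powr p)) * B"
        proof (intro mult_mono add_mono order_refl c bx)
          have "(\<bar>a x\<bar> + \<bar>X i * b x\<bar>) powr p \<le> (\<bar>a x\<bar> + K * B) powr p"
            using d p by (intro powr_mono2) auto
          also have "\<dots> \<le> 2 powr p * (\<bar>a x\<bar> powr p + (K * B) powr p)"
            using abs_add_powr_le[OF p, of "\<bar>a x\<bar>" "K * B"] d by simp
          finally show "(\<bar>a x\<bar> + \<bar>X i * b x\<bar>) powr p \<le> 2 powr p * (\<bar>a x\<bar> powr p + (K * B) powr p)" .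
        qed (use c B in auto)
        finally show "norm (?s i x) \<le> c * (1 + 2 powr p * (\<bar>a x\<bar> powr p + (K * B) powr p)) * B" .
      qed
    qed
    have eq: "(LINT x|leb_Omega. ?s i x) =
      ((LINT x|leb_Omega. \<psi> (a x + X i * b x)) - (LINT x|leb_Omega. \<psi> (a x + 0 * b x))) / (X i - 0)" for i
      using int[of "X i"] int[of 0] X(1) by simp
    show "(\<lambda>i. ((LINT x|leb_Omega. \<psi> (a x + X i * b x)) - (LINT x|leb_Omega. \<psi> (a x + 0 * b x))) / (X i - 0))
      \<longlonglongrightarrow> (LINT x|leb_Omega. \<psi>' (a x) * b x)"
      using lim by (simp only: eq)
  qed
  then show ?thesis
    by (simp add: has_field_derivative_iff)
qed

lemma antideriv_has_derivative:
  fixes k :: "real \<Rightarrow> real"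
  assumes k: "continuous_on {a..b} k" and K: "\<And>x. x \<in> {a..b} \<Longrightarrow> K x = integral {a..x} k"
    and x: "x \<in> {a<..<b}"
  shows "(K has_real_derivative k x) (at x)"
proof -
  have "((\<lambda>x. integral {a..x} k) has_vector_derivative k x) (at x within {a..b})"
    by (rule integral_has_vector_derivative[OF k]) (use x in auto)
  then have "((\<lambda>x. integral {a..x} k) has_real_derivative k x) (at x)"
    using x by (simp add: has_real_derivative_iff_has_vector_derivative at_within_Icc_at)
  then show ?thesis
    by (rule has_field_derivative_transform_within_open[of _ _ _ "{a<..<b}"]) (use x K in auto)
qed

lemma antideriv_continuous_on:
  fixes k :: "real \<Rightarrow> real"
  assumes k: "continuous_on {a..b} k"
  shows "continuous_on {a..b} (\<lambda>x. integral {a..x} k)"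
  by (rule indefinite_integral_continuous_1[OF integrable_continuous_real[OF k]])

lemma antideriv_has_weak_deriv:
  assumes k: "continuous_on {-1..1} k"
  shows "has_weak_deriv (\<lambda>x. integral {-1..x} k) k"
  by (intro has_weak_deriv_C1 antideriv_continuous_on k antideriv_has_derivative[OF k]) auto

section \<open>The first integral of a minimizer\<close>

locale exponents =
  fixes p r :: real
  assumes p_ge: "2 \<le> p" and r_ge: "p / 2 \<le> r" and r_le: "r \<le> p"
begin

lemma r_ge_1: "1 \<le> r" using p_ge r_ge by linarith

lemma p_pos: "0 < p" and p_ge_1: "1 \<le> p" and r_pos: "0 < r" using p_ge r_ge by linarith+

lemma p_div_r_ge_1: "1 \<le> p / r" using r_le r_pos by simp

definition dirichlet :: "(real \<Rightarrow> real) \<Rightarrow> real" where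
  "dirichlet u = (LINT x|leb_Omega. \<bar>weak_deriv u x\<bar> powr p)"

definition mass :: "(real \<Rightarrow> real) \<Rightarrow> real" where
  "mass u = (LINT x|leb_Omega. \<bar>u x\<bar> powr p)"

definition moment :: "(real \<Rightarrow> real) \<Rightarrow> real" where
  "moment u = (LINT x|leb_Omega. spow r (u x))"

lemma Q_eq: "Q p r \<alpha> u = (dirichlet u + \<alpha> * \<bar>moment u\<bar> powr (p / r)) / mass u"
  by (simp add: Q_def dirichlet_def mass_def moment_def spow_def)

lemma dirichlet_nonneg: "0 \<le> dirichlet u" and mass_nonneg: "0 \<le> mass u"
  by (auto simp: dirichlet_def mass_def)

lemma mass_eq_0_iff:
  assumes "u \<in> Lp p" shows "mass u = 0 \<longleftrightarrow> (AE x in leb_Omega. u x = 0)"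
  unfolding mass_def using integral_nonneg_eq_0_iff_AE[OF LpD(2)[OF assms]] by simp

lemma mass_pos: "u \<in> W01p_nonzero p \<Longrightarrow> 0 < mass u"
  using mass_eq_0_iff[of u] mass_nonneg[of u]
  by (auto simp: W01p_nonzero_def W01p_def W1p_def less_le)

text \<open>In place of Hoelder: after scaling \<open>u\<close> by its L^p norm h, the bound t^r
  \<le> 1 + t^p integrates over length 2 to 2 + 1 = 3. This keeps the quotient bounded below for
  negative \<alpha>, so that the infimum is a genuine one.\<close>

lemma moment_bound:
  assumes u: "u \<in> Lp p" shows "\<bar>moment u\<bar> powr (p / r) \<le> 3 powr (p / r) * mass u"
proof (cases "mass u = 0")
  case True
  then have "AE x in leb_Omega. spow r (u x) = 0"
    using mass_eq_0_iff[OF u] by (auto elim!: eventually_mono)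
  then have "moment u = 0" unfolding moment_def by (rule integral_eq_zero_AE)
  then show ?thesis using True by simp
next
  case False
  define h where "h = mass u powr (1 / p)"
  have h: "0 < h" using False mass_nonneg[of u] by (simp add: h_def)
  have hp: "h powr p = mass u" using p_pos mass_nonneg[of u] by (simp add: h_def powr_powr)
  have "\<bar>u x\<bar> powr r \<le> h powr r + h powr r / mass u * \<bar>u x\<bar> powr p" for x
  proof -
    have "(\<bar>u x\<bar> / h) powr r \<le> 1 + (\<bar>u x\<bar> / h) powr p"
      using r_pos r_le h by (intro powr_le_one_plus) auto
    then have "\<bar>u x\<bar> powr r / h powr r \<le> 1 + \<bar>u x\<bar> powr p / mass u"
      using h by (simp add: powr_divide hp)
    then have "\<bar>u x\<bar> powr r \<le> (1 + \<bar>u x\<bar> powr p / mass u) * h powr r"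
      using h by (simp add: pos_divide_le_eq)
    then show ?thesis by (simp add: algebra_simps)
  qed
  moreover have ir: "integrable leb_Omega (\<lambda>x. \<bar>u x\<bar> powr r)"
    using r_pos r_le by (intro Lp_integrable_powr[OF u]) auto
  ultimately have "(LINT x|leb_Omega. \<bar>u x\<bar> powr r) \<le> (LINT x|leb_Omega. h powr r + h powr r / mass u * \<bar>u x\<bar> powr p)"
    using LpD(2)[OF u] by (intro integral_mono) auto
  also have "\<dots> = 2 * h powr r + h powr r / mass u * mass u"
    using LpD(2)[OF u] by (simp add: mass_def del: lebesgue_integral_const)
  also have "\<dots> = 3 * h powr r" using False by simp
  finally have *: "(LINT x|leb_Omega. \<bar>u x\<bar> powr r) \<le> 3 * h powr r" .
  have "\<bar>moment u\<bar> \<le> (LINT x|leb_Omega. \<bar>u x\<bar> powr r)"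
    unfolding moment_def using integral_abs_bound[of leb_Omega "\<lambda>x. spow r (u x)"] by (simp add: abs_spow)
  with * have "\<bar>moment u\<bar> powr (p / r) \<le> (3 * h powr r) powr (p / r)"
    using p_div_r_ge_1 by (intro powr_mono2) auto
  also have "\<dots> = 3 powr (p / r) * mass u"
    using r_pos hp by (simp add: powr_mult powr_powr)
  finally show ?thesis .
qed

lemma W01p_Lp: "u \<in> W01p p \<Longrightarrow> u \<in> Lp p" by (simp add: W01p_def W1p_def)

lemma Q_lower_bound:
  assumes u: "u \<in> W01p_nonzero p" shows "- (\<bar>\<alpha>\<bar> * 3 powr (p / r)) \<le> Q p r \<alpha> u"
proof -
  have "\<bar>\<alpha> * \<bar>moment u\<bar> powr (p / r)\<bar> \<le> \<bar>\<alpha>\<bar> * (3 powr (p / r) * mass u)"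
    unfolding abs_mult using moment_bound[OF W01p_Lp, of u] u
    by (intro mult_left_mono) (auto simp: W01p_nonzero_def)
  then have "- (\<bar>\<alpha>\<bar> * 3 powr (p / r)) * mass u \<le> dirichlet u + \<alpha> * \<bar>moment u\<bar> powr (p / r)"
    using dirichlet_nonneg[of u] by (simp add: algebra_simps)
  then show ?thesis
    using mass_pos[OF u] by (simp add: Q_eq pos_le_divide_eq)
qed

lemma bdd_below_Q: "bdd_below (Q p r \<alpha> ` W01p_nonzero p)"
  using Q_lower_bound by (auto intro!: bdd_belowI)

lemma lambda_eig_le: "u \<in> W01p_nonzero p \<Longrightarrow> lambda_eig p r \<alpha> \<le> Q p r \<alpha> u"
  unfolding lambda_eig_def by (intro cINF_lower bdd_below_Q)

text \<open>The quotient with its denominator cleared. This functional is nonnegative also at null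
  functions and zero at a minimizer, so it can be varied without a quotient rule.\<close>

lemma energy_nonneg:
  assumes v: "v \<in> W01p p"
  shows "0 \<le> dirichlet v + \<alpha> * \<bar>moment v\<bar> powr (p / r) - lambda_eig p r \<alpha> * mass v"
proof (cases "v \<in> W01p_nonzero p")
  case True
  then show ?thesis
    using lambda_eig_le[OF True, of \<alpha>] mass_pos[OF True] by (simp add: Q_eq pos_le_divide_eq)
next
  case False
  then have ae: "AE x in leb_Omega. v x = 0" using v by (simp add: W01p_nonzero_def)
  then have "mass v = 0" using mass_eq_0_iff[OF W01p_Lp[OF v]] by simp
  moreover have "AE x in leb_Omega. spow r (v x) = 0" using ae by eventually_elim simp
  then have "moment v = 0" unfolding moment_def by (rule integral_eq_zero_AE)
  ultimately show ?thesis using dirichlet_nonneg by simp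
qed

lemma integral_cong_AE_representative:
  fixes u w b :: "real \<Rightarrow> real" and \<psi> :: "real \<Rightarrow> real"
  assumes u: "u \<in> borel_measurable leb_Omega" and w: "continuous_on {-1..1} w"
    and ae: "AE x in leb_Omega. u x = w x" and b: "b \<in> borel_measurable leb_Omega"
    and \<psi>: "\<psi> \<in> borel_measurable borel"
  shows "(LINT x|leb_Omega. \<psi> (u x + e * b x)) = (LINT x|leb_Omega. \<psi> (w x + e * b x))"
proof (rule integral_cong_AE)
  have "w \<in> borel_measurable leb_Omega" using lebesgue_on_Omega_continuous(1)[OF w] by blast
  then show "(\<lambda>x. \<psi> (u x + e * b x)) \<in> borel_measurable leb_Omega"
     "(\<lambda>x. \<psi> (w x + e * b x)) \<in> borel_measurable leb_Omega"
    using u b by (intro measurable_compose[OF _ \<psi>] borel_measurable_add borel_measurable_times borel_measurable_const; simp)+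
  show "AE x in leb_Omega. \<psi> (u x + e * b x) = \<psi> (w x + e * b x)"
    using ae by eventually_elim simp
qed

lemma measurable_abs_powr: "(\<lambda>s::real. \<bar>s\<bar> powr q) \<in> borel_measurable borel" by measurable

lemma measurable_spow': "spow q \<in> borel_measurable borel"
  using measurable_spow[of "\<lambda>x. x" borel q] by simp

lemma measurable_dpow: "dpow r \<in> borel_measurable borel"
proof -
  have "continuous_on UNIV (\<lambda>x. dpow r x)"
    by (intro continuous_on_dpow r_ge_1 continuous_on_id)
  then show ?thesis by (simp add: borel_measurable_continuous_onI)
qed

text \<open>The Euler--Lagrange equation is only tested with variations that leave the moment stationary;
  this sidesteps its non-differentiability at moment zero when \<open>r = p\<close>.\<close>

lemma minimizer_first_variation:
  assumes min: "is_minimizer p r \<alpha> y" and w: "continuous_on {-1..1} w" "AE x in leb_Omega. y x = w x"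
    and g: "g \<in> Lp p" "has_weak_deriv y g" and \<eta>: "test_function \<eta>"
    and con: "(LINT x|leb_Omega. dpow r (w x) * \<eta> x) = 0"
  shows "(LINT x|leb_Omega. spow (p - 1) (g x) * deriv \<eta> x)
     = lambda_eig p r \<alpha> * (LINT x|leb_Omega. spow (p - 1) (w x) * \<eta> x)"
proof -
  have y: "y \<in> W01p p" using min by (simp add: is_minimizer_def W01p_nonzero_def)
  define v where "v e x = y x + e * \<eta> x" for e x
  have v: "v e \<in> W01p p" for e unfolding v_def by (rule W01p_add_test[OF y \<eta> p_ge_1])
  have wLp: "w \<in> Lp p" by (rule Lp_continuous[OF w(1) p_pos])
  have \<eta>Lp: "\<eta> \<in> Lp p" "deriv \<eta> \<in> Lp p"
    using \<eta> by (auto intro!: Lp_continuous p_pos test_function_continuous_on test_function_deriv)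
  obtain B1 B2 where B: "\<And>x. \<bar>\<eta> x\<bar> \<le> B1" "\<And>x. \<bar>deriv \<eta> x\<bar> \<le> B2"
    using test_function_bounded[OF \<eta>] test_function_bounded[OF test_function_deriv[OF \<eta>]] by metis
  have mass_eq: "mass (v e) = (LINT x|leb_Omega. \<bar>w x + e * \<eta> x\<bar> powr p)" for e
    unfolding mass_def v_def
    by (rule integral_cong_AE_representative[OF LpD(1)[OF W01p_Lp[OF y]] w LpD(1)[OF \<eta>Lp(1)] measurable_abs_powr])
  have moment_eq: "moment (v e) = (LINT x|leb_Omega. spow r (w x + e * \<eta> x))" for e
    unfolding moment_def v_def
    by (rule integral_cong_AE_representative[OF LpD(1)[OF W01p_Lp[OF y]] w LpD(1)[OF \<eta>Lp(1)] measurable_spow'])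
  have dirichlet_eq: "dirichlet (v e) = (LINT x|leb_Omega. \<bar>g x + e * deriv \<eta> x\<bar> powr p)" for e
    unfolding dirichlet_def v_def
    by (rule integral_weak_deriv_powr[OF has_weak_deriv_lin[OF g(2) has_weak_deriv_test[OF \<eta>]]])
  have bp: "\<bar>p * spow (p - 1) s\<bar> \<le> p * (1 + \<bar>s\<bar> powr p)" for s
    using powr_le_one_plus[of "p - 1" p "\<bar>s\<bar>"] p_ge by (simp add: abs_mult abs_spow)
  have bp': "\<bar>\<bar>s\<bar> powr p\<bar> \<le> p * (1 + \<bar>s\<bar> powr p)" for s :: real
    using mult_right_mono[of 1 p "1 + \<bar>s\<bar> powr p"] p_ge by auto
  have br: "\<bar>r * dpow r s\<bar> \<le> r * (1 + \<bar>s\<bar> powr p)" for s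
    using powr_le_one_plus[of "r - 1" p "\<bar>s\<bar>"] r_ge_1 r_le by (auto simp: abs_mult dpow_def)
  have br': "\<bar>spow r s\<bar> \<le> r * (1 + \<bar>s\<bar> powr p)" for s
    using powr_le_one_plus[of r p "\<bar>s\<bar>"] r_ge_1 r_le mult_right_mono[of 1 r "1 + \<bar>s\<bar> powr p"]
    by (auto simp: abs_spow)
  have dp: "((\<lambda>s. \<bar>s\<bar> powr p) has_real_derivative p * spow (p - 1) s) (at s)" for s
    using p_ge by (intro abs_powr_has_derivative) auto
  have m1: "(\<lambda>s. p * spow (p - 1) s) \<in> borel_measurable borel" by measurable
  have m2: "(\<lambda>s. r * dpow r s) \<in> borel_measurable borel" using measurable_dpow by measurable
  have D1: "((\<lambda>e. dirichlet (v e)) has_real_derivative (LINT x|leb_Omega. p * spow (p - 1) (g x) * deriv \<eta> x)) (at 0)"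
    unfolding dirichlet_eq
    by (rule deriv_integral_perturbation[OF _ dp m1 bp' bp]) (use p_pos g \<eta>Lp B in auto)
  have D2: "((\<lambda>e. mass (v e)) has_real_derivative (LINT x|leb_Omega. p * spow (p - 1) (w x) * \<eta> x)) (at 0)"
    unfolding mass_eq
    by (rule deriv_integral_perturbation[OF _ dp m1 bp' bp]) (use p_pos wLp \<eta>Lp B in auto)
  have "((\<lambda>e. moment (v e)) has_real_derivative (LINT x|leb_Omega. r * dpow r (w x) * \<eta> x)) (at 0)"
    unfolding moment_eq
    by (rule deriv_integral_perturbation[OF _ spow_has_derivative[OF r_ge_1] m2 br' br])
       (use p_pos r_pos wLp \<eta>Lp B in auto)
  also have "(LINT x|leb_Omega. r * dpow r (w x) * \<eta> x) = 0"
    using con by (simp add: mult.assoc)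
  finally have D3: "((\<lambda>e. \<bar>moment (v e)\<bar> powr (p / r)) has_real_derivative 0) (at 0)"
    by (rule abs_powr_derivative_0) (rule p_div_r_ge_1)
  let ?E = "\<lambda>e. dirichlet (v e) + \<alpha> * \<bar>moment (v e)\<bar> powr (p / r) - lambda_eig p r \<alpha> * mass (v e)"
  have DE: "(?E has_real_derivative (LINT x|leb_Omega. p * spow (p - 1) (g x) * deriv \<eta> x)
     + \<alpha> * 0 - lambda_eig p r \<alpha> * (LINT x|leb_Omega. p * spow (p - 1) (w x) * \<eta> x)) (at 0)"
    by (intro DERIV_add DERIV_diff DERIV_cmult D1 D2 D3)
  have "?E 0 \<le> ?E e" for e
  proof -
    have "v 0 = y" by (simp add: v_def fun_eq_iff)
    then have "?E 0 = 0"
      using min mass_pos[of y] by (auto simp: is_minimizer_def Q_eq field_simps)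
    then show ?thesis using energy_nonneg[OF v[of e], of \<alpha>] by simp
  qed
  then have "(LINT x|leb_Omega. p * spow (p - 1) (g x) * deriv \<eta> x)
     + \<alpha> * 0 - lambda_eig p r \<alpha> * (LINT x|leb_Omega. p * spow (p - 1) (w x) * \<eta> x) = 0"
    by (intro DERIV_local_min[OF DE, of 1]) auto
  then show ?thesis using p_pos by (simp add: mult.assoc)
qed

text \<open>The multiplier lemma gives the once integrated Euler-Lagrange equation almost
  everywhere. Inverting the signed power shows that the derivative has a continuous version, and
  conservation of energy follows.\<close>

lemma minimizer_first_integral:
  assumes min: "is_minimizer p r \<alpha> y"
  obtains w w' A B where "continuous_on {-1..1} w" "continuous_on {-1..1} w'"
    "\<And>x. x \<in> {-1<..<1} \<Longrightarrow> (w has_real_derivative w' x) (at x)"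
    "w (-1) = 0" "w 1 = 0" "AE x in leb_Omega. y x = w x" "has_weak_deriv y w'"
    "\<And>x. x \<in> {-1..1} \<Longrightarrow> (p - 1) * \<bar>w' x\<bar> powr p = A + B * spow r (w x) - lambda_eig p r \<alpha> * \<bar>w x\<bar> powr p"
proof -
  define L where "L = lambda_eig p r \<alpha>"
  have y: "y \<in> W01p p" "\<not> (AE x in leb_Omega. y x = 0)"
    using min by (auto simp: is_minimizer_def W01p_nonzero_def)
  obtain w g where w: "continuous_on {-1..1} w" and g: "g \<in> Lp p" "has_weak_deriv y g"
    and yw: "AE x in leb_Omega. y x = w x" and wg: "\<And>x. x \<in> {-1..1} \<Longrightarrow> w x = integral {-1..x} g"
    and bc: "w (-1) = 0" "w 1 = 0"
    by (rule W01p_representative[OF y(1) p_ge_1]) (rule that; assumption)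
  have kc: "continuous_on {-1..1} (\<lambda>x. dpow r (w x))" by (intro continuous_on_dpow r_ge_1 w)
  have Fc: "continuous_on {-1..1} (\<lambda>x. spow (p - 1) (w x))"
    using p_ge by (intro continuous_on_spow w) auto
  define T where "T x = integral {-1..x} (\<lambda>x. dpow r (w x))" for x
  define P where "P x = integral {-1..x} (\<lambda>x. spow (p - 1) (w x))" for x
  have Tc: "continuous_on {-1..1} T" and Pc: "continuous_on {-1..1} P"
    unfolding T_def P_def by (intro antideriv_continuous_on kc Fc)+
  have Tw: "has_weak_deriv T (\<lambda>x. dpow r (w x))" and Pw: "has_weak_deriv P (\<lambda>x. spow (p - 1) (w x))"
    unfolding T_def P_def by (intro antideriv_has_weak_deriv kc Fc)+
  have Ti: "integrable leb_Omega T" and Pi: "integrable leb_Omega P"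
    by (intro lebesgue_on_Omega_continuous Tc Pc)+
  have gi: "integrable leb_Omega (\<lambda>x. spow (p - 1) (g x))"
  proof (rule Bochner_Integration.integrable_bound[OF Lp_integrable_powr[OF g(1), of "p - 1"]])
    show "(\<lambda>x. spow (p - 1) (g x)) \<in> borel_measurable leb_Omega"
      using LpD(1)[OF g(1)] by measurable
  qed (use p_ge in \<open>auto simp: abs_spow\<close>)
  define f where "f x = spow (p - 1) (g x) + L * P x" for x
  have fi: "integrable leb_Omega f" unfolding f_def using gi Pi by simp
  \<comment> \<open>If \<open>T\<close> were constant, its weak derivative
    \<open>dpow r (w x)\<close> would vanish almost everywhere, and \<open>y\<close> with
    it.\<close>
  have nc: "\<not> (\<exists>c. AE x in leb_Omega. T x = c)"
  proof
    assume "\<exists>c. AE x in leb_Omega. T x = c"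
    then obtain c where c: "AE x in leb_Omega. T x = c" by blast
    have "AE x in leb_Omega. dpow r (w x) = 0"
    proof (rule AE_zero_if_test_integrals_zero[OF has_weak_derivD(2)[OF Tw]])
      fix \<phi> assume \<phi>: "test_function \<phi>"
      note \<phi>' = test_function_deriv[OF \<phi>]
      have "(LINT x|leb_Omega. T x * deriv \<phi> x) = (LINT x|leb_Omega. c * deriv \<phi> x)"
      proof (rule integral_cong_AE)
        show "(\<lambda>x. T x * deriv \<phi> x) \<in> borel_measurable leb_Omega" "(\<lambda>x. c * deriv \<phi> x) \<in> borel_measurable leb_Omega"
          using integrable_mult_test[OF Ti \<phi>'] test_function_measurable[OF \<phi>'] by auto
        show "AE x in leb_Omega. T x * deriv \<phi> x = c * deriv \<phi> x"
          using c by eventually_elim simp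
      qed
      also have "\<dots> = 0"
        using lebesgue_on_Omega_continuous(2)[OF test_function_continuous_on[OF \<phi>']]
          integral_unique[OF test_function_has_integral[OF \<phi>, of "-1" 1]] test_function_boundary[OF \<phi>]
        by simp
      finally show "(LINT x|leb_Omega. dpow r (w x) * \<phi> x) = 0"
        using has_weak_derivD(3)[OF Tw \<phi>] by simp
    qed
    then have "AE x in leb_Omega. y x = 0"
      using yw by eventually_elim (auto simp: dpow_def split: if_splits)
    then show False using y(2) by blast
  qed
  have "\<exists>b c. AE x in leb_Omega. f x = c + b * T x"
  proof (rule du_Bois_Reymond_constraint[OF fi Ti nc])
    fix h assume h: "test_function h" "integral {-1..1} h = 0" "(LINT x|leb_Omega. T x * h x) = 0"
    obtain \<eta> where \<eta>: "test_function \<eta>" "deriv \<eta> = h"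
      using test_function_antideriv[OF h(1,2)] by blast
    have con: "(LINT x|leb_Omega. dpow r (w x) * \<eta> x) = 0"
      using has_weak_derivD(3)[OF Tw \<eta>(1)] h(3) \<eta>(2) by simp
    have "(LINT x|leb_Omega. f x * h x)
        = (LINT x|leb_Omega. spow (p - 1) (g x) * h x + L * (P x * h x))"
      by (intro Bochner_Integration.integral_cong) (auto simp: f_def algebra_simps)
    also have "\<dots> = (LINT x|leb_Omega. spow (p - 1) (g x) * h x) + L * (LINT x|leb_Omega. P x * h x)"
      using integrable_mult_test[OF gi h(1)] integrable_mult_test[OF Pi h(1)] by simp
    also have "(LINT x|leb_Omega. spow (p - 1) (g x) * h x) = L * (LINT x|leb_Omega. spow (p - 1) (w x) * \<eta> x)"
      using minimizer_first_variation[OF min w yw g \<eta>(1) con] by (simp add: \<eta>(2) L_def)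
    also have "(LINT x|leb_Omega. P x * h x) = - (LINT x|leb_Omega. spow (p - 1) (w x) * \<eta> x)"
      using has_weak_derivD(3)[OF Pw \<eta>(1)] \<eta>(2) by simp
    finally show "(LINT x|leb_Omega. f x * h x) = 0" by simp
  qed
  then obtain b c where bcT: "AE x in leb_Omega. f x = c + b * T x" by blast
  \<comment> \<open>The continuous version of the momentum |w'|^(p-2) w'.\<close>
  define \<omega> where "\<omega> x = c + b * T x - L * P x" for x
  have \<omega>c: "continuous_on {-1..1} \<omega>" unfolding \<omega>_def by (intro continuous_intros Tc Pc)
  define w' where "w' x = spow (1 / (p - 1)) (\<omega> x)" for x
  have w'c: "continuous_on {-1..1} w'"
    unfolding w'_def using p_ge by (intro continuous_on_spow \<omega>c) auto
  have gw': "AE x in leb_Omega. g x = w' x"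
    using bcT
  proof eventually_elim
    case (elim x)
    then have "spow (p - 1) (g x) = \<omega> x" by (simp add: f_def \<omega>_def)
    then show ?case using spow_inverse[of "p - 1" "g x"] p_ge by (simp add: w'_def)
  qed
  have w'i: "integrable leb_Omega w'" by (rule lebesgue_on_Omega_continuous[OF w'c])
  have gint: "integrable leb_Omega g" by (rule Lp_integrable[OF g(1) p_ge_1])
  have ww': "w x = integral {-1..x} w'" if x: "x \<in> {-1..1}" for x
  proof -
    have "(LINT x|leb_Omega. \<bar>g x - w' x\<bar>) = 0"
      by (rule integral_eq_zero_AE) (use gw' in \<open>eventually_elim; simp\<close>)
    then have "integral {-1..x} (\<lambda>x. g x - w' x) = 0"
      using abs_integral_initial_le[of "\<lambda>x. g x - w' x", OF _ x] gint w'i by simp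
    moreover have sub: "{-1..x} \<subseteq> {-1..1}" using x by auto
    ultimately show ?thesis
      using integrable_subinterval_real[OF integrable_leb_Omega_HK(1)[OF gint] sub]
        integrable_subinterval_real[OF integrable_leb_Omega_HK(1)[OF w'i] sub] wg[OF x]
      by (simp add: integral_diff)
  qed
  have dw: "(w has_real_derivative w' x) (at x)" if "x \<in> {-1<..<1}" for x
    by (rule antideriv_has_derivative[OF w'c ww' that])
  have wdw': "has_weak_deriv y w'"
    unfolding has_weak_deriv_def
  proof (intro conjI allI impI)
    show "locally_integrable y" by (rule has_weak_derivD(1)[OF g(2)])
    show "locally_integrable w'" by (rule integrable_imp_locally_integrable[OF w'i])
    fix \<phi> assume \<phi>: "test_function \<phi>"
    have "(LINT x|leb_Omega. g x * \<phi> x) = (LINT x|leb_Omega. w' x * \<phi> x)"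
    proof (rule integral_cong_AE)
      show "(\<lambda>x. g x * \<phi> x) \<in> borel_measurable leb_Omega" "(\<lambda>x. w' x * \<phi> x) \<in> borel_measurable leb_Omega"
        using integrable_mult_test[OF gint \<phi>] integrable_mult_test[OF w'i \<phi>] by auto
      show "AE x in leb_Omega. g x * \<phi> x = w' x * \<phi> x" using gw' by eventually_elim simp
    qed
    then show "(LINT x|leb_Omega. y x * deriv \<phi> x) = - (LINT x|leb_Omega. w' x * \<phi> x)"
      using has_weak_derivD(3)[OF g(2) \<phi>] by simp
  qed
  define p' where "p' = p / (p - 1)"
  have p': "1 < p'" "p' - 1 = 1 / (p - 1)" "(p - 1) * p' = p" "1 / (p - 1) * p = p'"
    using p_ge by (auto simp: p'_def field_simps)
  \<comment> \<open>The energy is written in \<omega> and not in \<open>w'\<close>: where \<omega>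
    vanishes, its signed power of exponent 1/(p-1) need not be differentiable, whereas |\<omega>|^p'
    is, since p' > 1.\<close>
  define \<Xi> where "\<Xi> x = (p - 1) * \<bar>\<omega> x\<bar> powr p' - p * b / r * spow r (w x) + L * \<bar>w x\<bar> powr p" for x
  have \<Xi>c: "continuous_on {-1..1} \<Xi>"
    unfolding \<Xi>_def using p' p_pos r_pos
    by (intro continuous_intros continuous_on_abs_powr continuous_on_spow \<omega>c w) auto
  have d\<Xi>: "(\<Xi> has_real_derivative 0) (at x)" if x: "x \<in> {-1<..<1}" for x
  proof -
    have dT: "(T has_real_derivative dpow r (w x)) (at x)"
      by (rule antideriv_has_derivative[OF kc T_def x])
    have dP: "(P has_real_derivative spow (p - 1) (w x)) (at x)"
      by (rule antideriv_has_derivative[OF Fc P_def x])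
    have d\<omega>: "(\<omega> has_real_derivative b * dpow r (w x) - L * spow (p - 1) (w x)) (at x)"
      unfolding \<omega>_def by (auto intro!: derivative_eq_intros dT dP)
    have 1: "((\<lambda>x. \<bar>\<omega> x\<bar> powr p') has_real_derivative p' * w' x * (b * dpow r (w x) - L * spow (p - 1) (w x))) (at x)"
      using DERIV_chain2[OF abs_powr_has_derivative[OF p'(1)] d\<omega>] by (simp add: p'(2) w'_def)
    have 2: "((\<lambda>x. spow r (w x)) has_real_derivative r * dpow r (w x) * w' x) (at x)"
      by (rule DERIV_chain2[OF spow_has_derivative[OF r_ge_1] dw[OF x]])
    have 3: "((\<lambda>x. \<bar>w x\<bar> powr p) has_real_derivative p * spow (p - 1) (w x) * w' x) (at x)"
      by (rule DERIV_chain2[OF abs_powr_has_derivative dw[OF x]]) (use p_ge in auto)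
    have "(\<Xi> has_real_derivative (p - 1) * (p' * w' x * (b * dpow r (w x) - L * spow (p - 1) (w x)))
       - p * b / r * (r * dpow r (w x) * w' x) + L * (p * spow (p - 1) (w x) * w' x)) (at x)"
      unfolding \<Xi>_def by (intro DERIV_add DERIV_diff DERIV_cmult 1 2 3)
    moreover have "(p - 1) * (p' * w' x * (b * dpow r (w x) - L * spow (p - 1) (w x)))
       - p * b / r * (r * dpow r (w x) * w' x) + L * (p * spow (p - 1) (w x) * w' x)
       = ((p - 1) * p' - p) * w' x * (b * dpow r (w x) - L * spow (p - 1) (w x))"
      using r_pos by (simp add: algebra_simps)
    ultimately show ?thesis using p'(3) by simp
  qed
  have first: "(p - 1) * \<bar>w' x\<bar> powr p = \<Xi> (-1) + p * b / r * spow r (w x) - lambda_eig p r \<alpha> * \<bar>w x\<bar> powr p"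
    if x: "x \<in> {-1..1}" for x
  proof -
    have "\<Xi> x = \<Xi> (-1)"
      by (rule DERIV_isconst2[OF _ \<Xi>c]) (use d\<Xi> x in auto)
    moreover have "\<bar>w' x\<bar> powr p = \<bar>\<omega> x\<bar> powr p'"
      unfolding w'_def abs_spow powr_powr p'(4) ..
    ultimately show ?thesis by (simp add: \<Xi>_def L_def algebra_simps)
  qed
  show ?thesis
    by (rule that[OF w w'c dw bc yw wdw' first])
qed

end

section \<open>Half-period integrals\<close>

lemma spow_times_self: "spow a t * t = \<bar>t\<bar> powr (a + 1)"
proof -
  have "spow a t * t = \<bar>t\<bar> * (\<bar>t\<bar> * \<bar>t\<bar> powr (a - 1))"
    by (simp add: spow_def)
  also have "\<dots> = \<bar>t\<bar> powr (a + 1)"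
    by (simp add: powr_mult_base algebra_simps)
  finally show ?thesis .
qed

lemma lipschitz_from_derivative:
  fixes f :: "real \<Rightarrow> real"
  assumes xy: "x \<le> y" and f: "continuous_on {x..y} f"
    and d: "\<And>z. x < z \<Longrightarrow> z < y \<Longrightarrow> \<exists>d. (f has_real_derivative d) (at z) \<and> \<bar>d\<bar> \<le> l"
  shows "\<bar>f y - f x\<bar> \<le> l * (y - x)"
proof -
  have "l * x - f x \<le> l * y - f y"
  proof (rule DERIV_nonneg_imp_increasing_open[OF xy])
    show "\<exists>d. ((\<lambda>x. l * x - f x) has_real_derivative d) (at z) \<and> 0 \<le> d" if z: "x < z" "z < y" for z
    proof -
      obtain d where d: "(f has_real_derivative d) (at z)" "\<bar>d\<bar> \<le> l" using d[OF z] by blast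
      show ?thesis by (rule exI[of _ "l - d"]) (use d in \<open>auto intro!: derivative_eq_intros\<close>)
    qed
  qed (intro continuous_intros f)
  moreover have "l * x + f x \<le> l * y + f y"
  proof (rule DERIV_nonneg_imp_increasing_open[OF xy])
    show "\<exists>d. ((\<lambda>x. l * x + f x) has_real_derivative d) (at z) \<and> 0 \<le> d" if z: "x < z" "z < y" for z
    proof -
      obtain d where d: "(f has_real_derivative d) (at z)" "\<bar>d\<bar> \<le> l" using d[OF z] by blast
      show ?thesis by (rule exI[of _ "l + d"]) (use d in \<open>auto intro!: derivative_eq_intros\<close>)
    qed
  qed (intro continuous_intros f)
  ultimately show ?thesis by (simp add: abs_le_iff algebra_simps)
qed

text \<open>A function that starts and ends at level c and visits both values has variation at least
  twice their difference. \<open>V\<close> majorizes the variation: a multiple of length in the time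
  bound, the accumulated action in the calibration.\<close>

lemma lipschitz_travel:
  fixes f :: "real \<Rightarrow> real"
  assumes lip: "\<And>x y. x \<in> {-1..1} \<Longrightarrow> y \<in> {-1..1} \<Longrightarrow> x \<le> y \<Longrightarrow> \<bar>f y - f x\<bar> \<le> V y - V x"
    and x: "x1 \<in> {-1..1}" "x2 \<in> {-1..1}" and b: "f (-1) = c" "f 1 = c"
  shows "2 * (f x1 - f x2) \<le> V 1 - V (-1)"
proof (cases "x1 \<le> x2")
  case True
  then show ?thesis
    using lip[of "-1" x1] lip[of x1 x2] lip[of x2 1] x b by (auto simp: abs_le_iff)
next
  case False
  then show ?thesis
    using lip[of "-1" x2] lip[of x2 x1] lip[of x1 1] x b by (auto simp: abs_le_iff)
qed

context exponents
begin

definition q :: real where "q = r / p"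

lemma q_ge: "1 / 2 \<le> q" and q_le: "q \<le> 1"
  using p_pos r_ge r_le by (auto simp: q_def field_simps)

lemma powr_conjugate:
  assumes "0 \<le> x" shows "x powr ((p - 1) / p) = x * x powr (- (1 / p))"
proof -
  have "1 + - (1 / p) = (p - 1) / p" using p_pos by (simp add: field_simps)
  then show ?thesis using powr_mult_base[OF assms, of "- (1 / p)"] by simp
qed

definition \<rho> :: "real \<Rightarrow> real" where "\<rho> t = (1 - \<bar>t\<bar> powr p) powr (- (1 / p))"

text \<open>The time in which a solution of |u'|^p = 1 - |u|^p runs from -1 to 1. It equals \<pi>_p
  / (p-1)^(1/p), see \<open>pi_p_eq\<close>.\<close>

definition L :: real where "L = integral {-1..1} \<rho>"

lemma abs_powr_p_less_1: "\<bar>t\<bar> < 1 \<Longrightarrow> \<bar>t\<bar> powr p < 1"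
  using powr_less_mono2[of p "\<bar>t\<bar>" 1] p_pos by simp

lemma abs_powr_p_le_1: "\<bar>t\<bar> \<le> 1 \<Longrightarrow> \<bar>t\<bar> powr p \<le> 1"
  using powr_mono2[of p "\<bar>t\<bar>" 1] p_pos by simp

lemma \<rho>_nonneg: "0 \<le> \<rho> t" by (simp add: \<rho>_def)

lemma \<rho>_pos: "\<bar>t\<bar> < 1 \<Longrightarrow> 0 < \<rho> t"
  using abs_powr_p_less_1[of t] by (simp add: \<rho>_def)

lemma continuous_on_\<rho>: "continuous_on {-1<..<1} \<rho>"
proof -
  have "1 - \<bar>t\<bar> powr p \<noteq> 0" if "t \<in> {-1<..<1}" for t :: real
    using abs_powr_p_less_1[of t] that by (auto simp: abs_less_iff)
  then show ?thesis
    unfolding \<rho>_def[abs_def] using p_pos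
    by (intro continuous_on_powr continuous_intros continuous_on_abs_powr) auto
qed

lemma majorant_integrable: "(\<lambda>t. (1 - \<bar>t\<bar>) powr (- (1 / p))) integrable_on {-1..1}"
proof -
  have e: "0 < (p - 1) / p" "(p - 1) / p - 1 = - (1 / p)" "p / (p - 1) * ((p - 1) / p) = 1"
    using p_ge by (auto simp: field_simps)
  have "((\<lambda>t. (1 - \<bar>t\<bar>) powr (- (1 / p))) has_integral
      (- (p / (p - 1) * (1 - 1) powr ((p - 1) / p)) - - (p / (p - 1) * (1 - 0) powr ((p - 1) / p)))) {0..1::real}"
  proof (rule fundamental_theorem_of_calculus_interior)
    show "continuous_on {0..1} (\<lambda>t::real. - (p / (p - 1) * (1 - t) powr ((p - 1) / p)))"
      using e by (intro continuous_intros continuous_on_powr') auto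
    fix t :: real assume t: "t \<in> {0<..<1}"
    have "((\<lambda>t. - (p / (p - 1) * (1 - t) powr ((p - 1) / p))) has_real_derivative
        p / (p - 1) * ((p - 1) / p) * (1 - t) powr ((p - 1) / p - 1)) (at t)"
      using t by (auto intro!: derivative_eq_intros)
    then show "((\<lambda>t. - (p / (p - 1) * (1 - t) powr ((p - 1) / p))) has_vector_derivative
        (1 - \<bar>t\<bar>) powr (- (1 / p))) (at t)"
      using t unfolding e by (simp add: has_real_derivative_iff_has_vector_derivative)
  qed simp
  then have 1: "(\<lambda>t. (1 - \<bar>t\<bar>) powr (- (1 / p))) integrable_on {0..1::real}" by blast
  have 2: "(\<lambda>t. (1 - \<bar>t\<bar>) powr (- (1 / p))) integrable_on {-1..0::real}"
    using 1 Henstock_Kurzweil_Integration.integrable_reflect_real[where f="\<lambda>t. (1 - \<bar>t\<bar>) powr (- (1 / p))" and a=0 and b=1] by simp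
  show ?thesis
    by (rule Henstock_Kurzweil_Integration.integrable_combine[OF _ _ 2 1]) auto
qed

lemma \<rho>_le_majorant:
  assumes "t \<in> {-1<..<1}" shows "\<rho> t \<le> (1 - \<bar>t\<bar>) powr (- (1 / p))"
proof -
  have t: "\<bar>t\<bar> < 1" using assms by (auto simp: abs_less_iff)
  have "\<bar>t\<bar> powr p \<le> \<bar>t\<bar> powr 1" using t p_ge by (intro powr_mono') auto
  then show ?thesis unfolding \<rho>_def using t p_pos by (intro powr_mono2') auto
qed

text \<open>Domination by \<rho> suffices: |t|^p \<le> |t| bounds \<rho> by (1 - |t|)^(-1/p), whose
  exponent exceeds -1.\<close>

lemma singular_integrable:
  assumes k: "continuous_on {-1<..<1} k" and bd: "\<And>t. t \<in> {-1<..<1} \<Longrightarrow> \<bar>k t\<bar> \<le> C * \<rho> t" and "0 \<le> C"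
  shows "k integrable_on {-1..1}"
proof -
  have "k integrable_on {-1<..<1}"
  proof (rule measurable_bounded_by_integrable_imp_integrable)
    show "k \<in> borel_measurable (lebesgue_on {-1<..<1})"
      by (rule continuous_imp_measurable_on_sets_lebesgue[OF k]) auto
    show "(\<lambda>t. C * (1 - \<bar>t\<bar>) powr (- (1 / p))) integrable_on {-1<..<1}"
      using integrable_on_cmult_left[OF majorant_integrable, of C]
      by (simp add: integrable_on_Icc_iff_Ioo)
    show "norm (k t) \<le> C * (1 - \<bar>t\<bar>) powr (- (1 / p))" if "t \<in> {-1<..<1}" for t
      using bd[OF that] mult_left_mono[OF \<rho>_le_majorant[OF that] assms(3)] by simp
  qed auto
  then show ?thesis by (simp add: integrable_on_Icc_iff_Ioo)
qed

lemma singular_antiderivative: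
  assumes k: "continuous_on {-1<..<1} k" and int: "k integrable_on {-1..1}" and t: "t \<in> {-1<..<1}"
  shows "((\<lambda>t. integral {-1..t} k) has_real_derivative k t) (at t)"
proof -
  have "isCont k t" using k t by (simp add: continuous_on_eq_continuous_at)
  then have "((\<lambda>t. integral {-1..t} k) has_vector_derivative k t) (at t within {-1..1} - {})"
    using t by (intro integral_has_vector_derivative_continuous_at int) (auto intro: continuous_at_imp_continuous_at_within)
  then show ?thesis
    using t by (simp add: has_real_derivative_iff_has_vector_derivative at_within_Icc_at)
qed

lemma \<rho>_integrable: "\<rho> integrable_on {-1..1}"
  by (rule singular_integrable[OF continuous_on_\<rho>, of 1]) (auto simp: \<rho>_nonneg)

lemma integral_odd:
  fixes k :: "real \<Rightarrow> real"
  assumes "\<And>t. k (- t) = - k t" shows "integral {-1..1} k = 0"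
  using Henstock_Kurzweil_Integration.integral_reflect_real[of 1 "-1" k] assms by simp


text \<open>The function t (1 - |t|^p)^((p-1)/p) vanishes at both ends, so its derivative p (1 -
  |t|^p)^((p-1)/p) - (p-1) \<rho> integrates to zero.\<close>

lemma integral_compl_powr: "integral {-1..1} (\<lambda>t. (1 - \<bar>t\<bar> powr p) powr ((p - 1) / p)) = (p - 1) / p * L"
proof -
  let ?e = "(p - 1) / p"
  have e: "0 < ?e" "?e - 1 = - (1 / p)" using p_ge by (auto simp: field_simps)
  have c: "continuous_on {-1..1} (\<lambda>t. (1 - \<bar>t\<bar> powr p) powr ?e)"
    using e p_pos abs_powr_p_le_1
    by (intro continuous_on_powr' continuous_intros continuous_on_abs_powr) (auto simp: abs_le_iff)
  have "((\<lambda>t. p * (1 - \<bar>t\<bar> powr p) powr ?e - (p - 1) * \<rho> t) has_integral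
      (1 * (1 - \<bar>1\<bar> powr p) powr ?e - (- 1) * (1 - \<bar>- 1\<bar> powr p) powr ?e)) {-1..1}"
  proof (rule fundamental_theorem_of_calculus_interior)
    show "continuous_on {-1..1} (\<lambda>t. t * (1 - \<bar>t\<bar> powr p) powr ?e)"
      by (intro continuous_intros c)
    fix t :: real assume t: "t \<in> {-1<..<1}"
    then have pos: "0 < 1 - \<bar>t\<bar> powr p" using abs_powr_p_less_1[of t] by (auto simp: abs_less_iff)
    have d: "((\<lambda>t. 1 - \<bar>t\<bar> powr p) has_real_derivative - (p * spow (p - 1) t)) (at t)"
      using DERIV_diff[OF DERIV_const[of 1] abs_powr_has_derivative[of p t]] p_ge by simp
    have "((\<lambda>t. t * (1 - \<bar>t\<bar> powr p) powr ?e) has_real_derivative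
       1 * (1 - \<bar>t\<bar> powr p) powr ?e + ?e * (1 - \<bar>t\<bar> powr p) powr (?e - 1) * - (p * spow (p - 1) t) * t) (at t)"
      by (rule DERIV_cong[OF DERIV_mult[OF DERIV_ident DERIV_fun_powr[OF d pos]]]) simp
    moreover have "1 * (1 - \<bar>t\<bar> powr p) powr ?e + ?e * (1 - \<bar>t\<bar> powr p) powr (?e - 1) * - (p * spow (p - 1) t) * t
       = p * (1 - \<bar>t\<bar> powr p) powr ?e - (p - 1) * \<rho> t"
    proof -
      have s: "spow (p - 1) t * t = \<bar>t\<bar> powr p" using spow_times_self[of "p - 1" t] by simp
      have w: "(1 - \<bar>t\<bar> powr p) powr ?e = (1 - \<bar>t\<bar> powr p) * \<rho> t"
        unfolding \<rho>_def using pos by (intro powr_conjugate) simp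
      have "?e * (1 - \<bar>t\<bar> powr p) powr (?e - 1) * - (p * spow (p - 1) t) * t
          = - (?e * p) * \<rho> t * (spow (p - 1) t * t)"
      proof -
        have "E * X * - (p * S) * t = - (E * p) * X * (S * t)" for E X S :: real
          by (simp add: algebra_simps)
        then show ?thesis unfolding e(2) \<rho>_def .
      qed
      also have "\<dots> = - (p - 1) * \<rho> t * \<bar>t\<bar> powr p" unfolding s using p_pos by simp
      finally show ?thesis unfolding w by (simp add: algebra_simps)
    qed
    ultimately show "((\<lambda>t. t * (1 - \<bar>t\<bar> powr p) powr ?e) has_vector_derivative
        p * (1 - \<bar>t\<bar> powr p) powr ?e - (p - 1) * \<rho> t) (at t)"
      by (simp add: has_real_derivative_iff_has_vector_derivative)
  qed simp
  then have "integral {-1..1} (\<lambda>t. p * (1 - \<bar>t\<bar> powr p) powr ?e - (p - 1) * \<rho> t) = 0"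
    by (simp add: integral_unique)
  moreover have "integral {-1..1} (\<lambda>t. p * (1 - \<bar>t\<bar> powr p) powr ?e - (p - 1) * \<rho> t)
     = p * integral {-1..1} (\<lambda>t. (1 - \<bar>t\<bar> powr p) powr ?e) - (p - 1) * L"
    unfolding L_def
    using integral_diff[OF integrable_on_mult_right[OF integrable_continuous_real[OF c], of p]
        integrable_on_mult_right[OF \<rho>_integrable, of "p - 1"]] by simp
  ultimately show ?thesis using p_pos by (simp add: field_simps)
qed

lemma L_pos: "0 < L"
proof -
  let ?e = "(p - 1) / p"
  have e: "0 < ?e" using p_ge by (auto simp: field_simps)
  have c: "continuous_on {-1..1} (\<lambda>t. (1 - \<bar>t\<bar> powr p) powr ?e)"
    using e p_pos abs_powr_p_le_1
    by (intro continuous_on_powr' continuous_intros continuous_on_abs_powr) (auto simp: abs_le_iff)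
  have "0 \<le> integral {-1..1} (\<lambda>t. (1 - \<bar>t\<bar> powr p) powr ?e)"
    by (intro integral_nonneg integrable_continuous_real c) auto
  moreover have "integral {-1..1} (\<lambda>t. (1 - \<bar>t\<bar> powr p) powr ?e) \<noteq> 0"
    using integral_eq_0_iff[of "-1" 1 "\<lambda>t. (1 - \<bar>t\<bar> powr p) powr ?e"] c by (auto dest!: bspec[of _ _ 0])
  ultimately have "0 < ?e * L"
    unfolding integral_compl_powr by linarith
  then show ?thesis using e zero_less_mult_pos by blast
qed

text \<open>\<open>R m\<close> is chosen such that \<open>gf (R m)\<close> vanishes at \<open>1\<close> and at \<open>- m\<close>.\<close>

definition R :: "real \<Rightarrow> real" where "R m = (1 - m powr p) / (1 + m powr r)"

definition gf :: "real \<Rightarrow> real \<Rightarrow> real" where "gf B s = 1 - B + B * spow r s - \<bar>s\<bar> powr p"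

lemma R_bounds:
  assumes "0 \<le> m" "m \<le> 1" shows "0 \<le> R m" "R m \<le> 1"
  using assms abs_powr_p_le_1[of m] by (auto simp: R_def field_simps add_pos_nonneg)

lemma R_eq: "1 - R m = R m * m powr r + m powr p"
proof -
  have "1 + m powr r > 0" by (simp add: add_pos_nonneg)
  then have "R m * (1 + m powr r) = 1 - m powr p" by (simp add: R_def)
  then show ?thesis by (simp add: algebra_simps)
qed

lemma R_eq_0: "0 \<le> m \<Longrightarrow> m \<le> 1 \<Longrightarrow> R m = 0 \<Longrightarrow> m = 1"
  using R_eq[of m] abs_powr_p_less_1[of m] by (cases "m = 1") auto

lemma gf_continuous: "continuous_on S (gf B)"
  unfolding gf_def[abs_def]
  by (intro continuous_intros continuous_on_abs_powr continuous_on_spow p_pos r_pos)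

lemma gf_nonneg:
  assumes m: "0 \<le> m" "m \<le> 1" and s: "- m \<le> s" "s \<le> 1" shows "0 \<le> gf (R m) s"
proof (cases "0 \<le> s")
  case True
  have "s powr p \<le> s powr r" using True s r_le by (intro powr_mono') auto
  moreover have "s powr r \<le> 1" using powr_mono2[of r s 1] True s r_pos by simp
  ultimately have "R m * (1 - s powr r) \<le> 1 * (1 - s powr p)"
    using R_bounds[OF m] by (intro mult_mono) auto
  then show ?thesis using True by (simp add: gf_def spow_nonneg algebra_simps)
next
  case False
  then have "(- s) powr r \<le> m powr r" "(- s) powr p \<le> m powr p"
    using s p_pos r_pos by (auto intro!: powr_mono2)
  moreover from this(1) have "R m * (- s) powr r \<le> R m * m powr r"
    using R_bounds[OF m] by (intro mult_left_mono) auto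
  ultimately show ?thesis
    using False R_eq[of m] spow_minus[of r "-s"] by (simp add: gf_def spow_nonneg[of "-s"])
qed

text \<open>After subtraction the terms of degree p in s cancel, and (1 - R)(1 - \<theta>^p)
  outweighs the possibly negative term of degree r. Hence a profile shrunk by \<theta> obeys the
  first integral as an inequality in the useful direction, while its values avoid the zeros of
  g.\<close>

lemma gf_scale:
  assumes m: "0 \<le> m" "m \<le> 1" and s: "- m \<le> s" "s \<le> 1" and \<theta>: "0 \<le> \<theta>" "\<theta> \<le> 1"
  shows "\<theta> powr p * gf (R m) s \<le> gf (R m) (\<theta> * s)"
proof -
  have \<theta>': "\<theta> powr p \<le> \<theta> powr r" "\<theta> powr r \<le> 1" "\<theta> powr p \<le> 1"
    using \<theta> r_le powr_mono2[of r \<theta> 1] powr_mono2[of p \<theta> 1] p_pos r_pos by (auto intro!: powr_mono')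
  have "- (m powr r) \<le> spow r s"
  proof (cases "0 \<le> s")
    case False
    have "(- s) powr r \<le> m powr r" using False s r_pos by (intro powr_mono2) auto
    then show ?thesis using False spow_minus[of r "-s"] by (simp add: spow_nonneg[of "-s"])
  qed (simp add: spow_nonneg order_trans[of _ 0])
  then have 1: "R m * spow r s \<ge> - (R m * m powr r)"
    using mult_left_mono[of "- (m powr r)" "spow r s" "R m"] R_bounds[OF m] by simp
  have "(R m * m powr r) * (\<theta> powr r - \<theta> powr p) \<le> (1 - R m) * (1 - \<theta> powr p)"
    using \<theta>' R_bounds[OF m] R_eq[of m] by (intro mult_mono) auto
  moreover have "- (R m * m powr r) * (\<theta> powr r - \<theta> powr p) \<le> R m * spow r s * (\<theta> powr r - \<theta> powr p)"
    using 1 \<theta>' by (intro mult_right_mono) auto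
  moreover have "gf (R m) (\<theta> * s) - \<theta> powr p * gf (R m) s
     = (1 - R m) * (1 - \<theta> powr p) + R m * spow r s * (\<theta> powr r - \<theta> powr p)"
    using \<theta>(1) by (simp add: gf_def spow_mult spow_nonneg abs_mult powr_mult algebra_simps)
  ultimately show ?thesis by simp
qed

end

section \<open>The time map of an arc\<close>

lemma dpow_times_self: "s * dpow r s = spow r s"
  by (simp add: dpow_def spow_def)

context exponents
begin

lemma spow_ge:
  assumes "0 \<le> m" "- m \<le> s" shows "- (m powr r) \<le> spow r s"
proof (cases "0 \<le> s")
  case False
  have "(- s) powr r \<le> m powr r" using False assms r_pos by (intro powr_mono2) auto
  then show ?thesis using False spow_minus[of r "-s"] by (simp add: spow_nonneg[of "-s"])
qed (simp add: spow_nonneg order_trans[of _ 0])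

lemma spow_le_1: "s \<le> 1 \<Longrightarrow> spow r s \<le> 1"
proof (cases "0 \<le> s")
  case True
  then show "s \<le> 1 \<Longrightarrow> spow r s \<le> 1" using powr_mono2[of r s 1] r_pos by (simp add: spow_nonneg)
next
  case False
  then show "s \<le> 1 \<Longrightarrow> spow r s \<le> 1" using spow_nonneg_iff[of r s] by simp
qed

text \<open>For q = 1/2, equality in (1 + l)(1 - q a/(1+a)) = 1 means l = a/(2+a). Expressed through
  z = a/sqrt(1+a) this is the odd function (z/2)/sqrt(1 + z^2/4). For q > 1/2 the added term in the
  denominator keeps the absolute value at most 1.\<close>

definition Lam :: "real \<Rightarrow> real" where
  "Lam z = q * z / (sqrt (1 + z\<^sup>2 / 4) + (q - 1 / 2) * \<bar>z\<bar>)"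

lemma Lam_denominator_pos: "0 < sqrt (1 + z\<^sup>2 / 4) + (q - 1 / 2) * \<bar>z\<bar>"
proof -
  have "0 < sqrt (1 + z\<^sup>2 / 4)" by (simp add: add_pos_nonneg)
  then show ?thesis using q_ge by (intro add_pos_nonneg mult_nonneg_nonneg) auto
qed

lemma Lam_minus: "Lam (- z) = - Lam z"
  by (simp add: Lam_def)

lemma abs_Lam_le_1: "\<bar>Lam z\<bar> \<le> 1"
proof -
  have "\<bar>z\<bar> / 2 \<le> sqrt (1 + z\<^sup>2 / 4)"
    by (rule real_le_rsqrt) (simp add: power_divide)
  then have "q * \<bar>z\<bar> \<le> sqrt (1 + z\<^sup>2 / 4) + (q - 1 / 2) * \<bar>z\<bar>"
    by (simp add: algebra_simps)
  then show ?thesis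
    using Lam_denominator_pos[of z] q_ge by (simp add: Lam_def abs_mult)
qed

lemma continuous_on_Lam: "continuous_on S f \<Longrightarrow> continuous_on S (\<lambda>t. Lam (f t))"
  unfolding Lam_def using Lam_denominator_pos
  by (intro continuous_intros) (auto simp: less_imp_neq[symmetric] simp del: abs_eq_0)

text \<open>The correction \<open>Lam\<close> trades time between a positive and a negative arc of an extremal. For
  \<open>q = 1 / 2\<close> the inequality is an equality; this is the borderline exponent \<open>r = p / 2\<close>.\<close>

lemma Lam_key:
  assumes a: "-1 < a" and z: "z = a * (1 + a) powr (- q)"
  shows "(1 + Lam z) * (1 - q * a / (1 + a)) \<le> 1"
proof -
  define W where "W = sqrt (1 + z\<^sup>2 / 4)"
  define E where "E = W + (q - 1 / 2) * \<bar>z\<bar>"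
  have W: "0 \<le> W" "W\<^sup>2 = 1 + z\<^sup>2 / 4" by (simp_all add: W_def add_nonneg_nonneg)
  have E: "0 < E" using Lam_denominator_pos[of z] by (simp add: E_def W_def)
  have Lz: "Lam z = q * z / E" by (simp add: Lam_def E_def W_def)
  \<comment> \<open>Here \<open>r \<ge> p / 2\<close> enters: the exponent 1 - 2q is nonpositive, so
    the power is at most 1 for a \<ge> 0 and at least 1 for a < 0, as the two cases below
    need.\<close>
  have z2: "z\<^sup>2 * (1 + a) = a\<^sup>2 * (1 + a) powr (1 - 2 * q)"
  proof -
    have "((1 + a) powr (- q))\<^sup>2 = (1 + a) powr (- 2 * q)"
      using a by (simp add: power2_eq_square powr_add[symmetric])
    moreover have "(1 + a) * (1 + a) powr (- 2 * q) = (1 + a) powr (1 - 2 * q)"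
      using a powr_mult_base[of "1 + a" "- 2 * q"] by simp
    moreover have "z\<^sup>2 * (1 + a) = a\<^sup>2 * ((1 + a) * ((1 + a) powr (- q))\<^sup>2)"
      by (simp add: z power_mult_distrib algebra_simps)
    ultimately show ?thesis by simp
  qed
  \<comment> \<open>The claim with denominators cleared. Both cases compare nonnegative quantities
    through their squares, using W^2 = 1 + z^2/4.\<close>
  have main: "q * z * (1 + (1 - q) * a) \<le> q * a * E"
  proof (cases "0 \<le> a")
    case True
    have z0: "0 \<le> z" using True by (simp add: z)
    have "(1 + a) powr (1 - 2 * q) \<le> 1" using True q_ge
      using powr_mono[of "1 - 2 * q" 0 "1 + a"] by simp
    then have zz: "z\<^sup>2 * (1 + a) \<le> a\<^sup>2" unfolding z2 using mult_left_mono[of _ 1 "a\<^sup>2"] by fastforce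
    have "z * (1 + a / 2) \<le> a * W"
    proof (rule power2_le_imp_le)
      have "(z * (1 + a / 2))\<^sup>2 = z\<^sup>2 * (1 + a) + a\<^sup>2 * z\<^sup>2 / 4"
        by (simp add: power2_eq_square algebra_simps)
      also have "\<dots> \<le> (a * W)\<^sup>2" using zz by (simp add: power_mult_distrib W(2) algebra_simps)
      finally show "(z * (1 + a / 2))\<^sup>2 \<le> (a * W)\<^sup>2" .
    qed (use True W in simp)
    moreover have "z * (1 + (1 - q) * a) \<le> z * (1 + a / 2) + a * (q - 1 / 2) * z"
    proof -
      have "0 \<le> (2 * q - 1) * (a * z)" using q_ge True z0 by simp
      then show ?thesis by (simp add: algebra_simps)
    qed
    ultimately have "z * (1 + (1 - q) * a) \<le> a * E"
      using z0 by (simp add: E_def algebra_simps)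
    then have "q * (z * (1 + (1 - q) * a)) \<le> q * (a * E)" using q_ge by (intro mult_left_mono) auto
    then show ?thesis by (simp add: mult.assoc)
  next
    case False
    have z0: "z \<le> 0" using False a by (simp add: z mult_nonpos_nonneg)
    have "1 \<le> (1 + a) powr (1 - 2 * q)" using False a q_ge
      using powr_mono'[of "1 - 2 * q" 0 "1 + a"] by simp
    then have zz: "a\<^sup>2 \<le> z\<^sup>2 * (1 + a)" unfolding z2 using mult_left_mono[of 1 _ "a\<^sup>2"] by fastforce
    have "(- a) * W \<le> (- z) * (1 + a / 2)"
    proof (rule power2_le_imp_le)
      have "(- a * W)\<^sup>2 = a\<^sup>2 + a\<^sup>2 * z\<^sup>2 / 4"
        by (simp add: power_mult_distrib W(2) algebra_simps)
      also have "\<dots> \<le> (- z * (1 + a / 2))\<^sup>2"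
        using zz by (simp add: power2_eq_square algebra_simps)
      finally show "(- a * W)\<^sup>2 \<le> (- z * (1 + a / 2))\<^sup>2" .
    qed (use a z0 in \<open>simp add: mult_nonpos_nonneg\<close>)
    then have "z * (1 + (1 - q) * a) \<le> a * E"
      using z0 by (simp add: E_def algebra_simps)
    then have "q * (z * (1 + (1 - q) * a)) \<le> q * (a * E)" using q_ge by (intro mult_left_mono) auto
    then show ?thesis by (simp add: mult.assoc)
  qed
  have eq: "1 - q * a / (1 + a) = (1 + (1 - q) * a) / (1 + a)"
    using a by (simp add: field_simps)
  have "(1 + Lam z) * (1 - q * a / (1 + a)) = ((E + q * z) * (1 + (1 - q) * a)) / (E * (1 + a))"
    unfolding eq Lz using E a by (simp add: field_simps)
  also have "\<dots> \<le> 1"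
  proof -
    have "0 < E * (1 + a)" using E a by simp
    moreover have "(E + q * z) * (1 + (1 - q) * a) \<le> E * (1 + a)"
      using main by (simp add: algebra_simps)
    ultimately show ?thesis by simp
  qed
  finally show ?thesis .
qed

end

locale half_range = exponents +
  fixes m :: real
  assumes m_pos: "0 < m" and m_le: "m \<le> 1"
begin

section \<open>The change of variable that matches the positive and the negative arc\<close>

definition A :: real where "A = 1 - R m"

definition D :: "real \<Rightarrow> real" where "D s = A + R m * spow r s"

text \<open>Since g = D (1 - |T|^p), an extremal satisfies |u'|^p / |u|^p = C (|T|^(-p) - 1). Thus
  |T| encodes the ratio |u'|/|u|, and the new variables t and -t belong to matched points of the two
  arcs.\<close>

definition T :: "real \<Rightarrow> real" where "T s = s * D s powr (- (1 / p))"

definition T' :: "real \<Rightarrow> real" where "T' s = D s powr (- (1 / p)) * (1 - q * (R m * spow r s) / D s)"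

lemma R_m: "0 \<le> R m" "R m \<le> 1" using R_bounds m_pos m_le by auto

lemma A_eq: "A = R m * m powr r + m powr p" by (simp add: A_def R_eq)

lemma A_pos: "0 < A" unfolding A_eq using m_pos R_m by (intro add_nonneg_pos mult_nonneg_nonneg) auto

lemma D_pos: assumes "- m \<le> s" shows "0 < D s"
proof -
  have "R m * - (m powr r) \<le> R m * spow r s"
    using spow_ge[OF _ assms] m_pos R_m by (intro mult_left_mono) auto
  then have "m powr p \<le> D s" by (simp add: D_def A_eq)
  then show ?thesis using m_pos by (smt (verit) powr_gt_zero)
qed

lemma D_le_1: "s \<le> 1 \<Longrightarrow> D s \<le> 1"
  using mult_left_mono[OF spow_le_1, of s "R m"] R_m by (simp add: D_def A_def)

lemma gf_eq: assumes s: "- m \<le> s" shows "gf (R m) s = D s * (1 - \<bar>T s\<bar> powr p)"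
proof -
  have "\<bar>T s\<bar> powr p = \<bar>s\<bar> powr p * ((D s powr (- (1 / p))) powr p)"
    by (simp add: T_def abs_mult powr_mult)
  also have "(D s powr (- (1 / p))) powr p = 1 / D s"
  proof -
    have "(D s powr (- (1 / p))) powr p = D s powr (- 1)" using p_pos by (simp add: powr_powr)
    then show ?thesis using D_pos[OF s] by (simp add: powr_minus_divide)
  qed
  finally show ?thesis using D_pos[OF s] by (simp add: gf_def D_def A_def field_simps)
qed

lemma gf_pos: assumes s: "- m < s" "s < 1" shows "0 < gf (R m) s"
proof (cases "0 \<le> s")
  case True
  have "s powr p \<le> s powr r" using True s r_le by (intro powr_mono') auto
  then have "R m * (1 - s powr r) \<le> R m * (1 - s powr p)"
    using R_m by (intro mult_left_mono) auto
  moreover have "0 < (1 - R m) * (1 - s powr p)"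
    using A_pos abs_powr_p_less_1[of s] True s by (simp add: A_def)
  ultimately show ?thesis using True by (simp add: gf_def spow_nonneg algebra_simps)
next
  case False
  then have "(- s) powr r \<le> m powr r" "(- s) powr p < m powr p"
    using s p_pos r_pos by (auto intro!: powr_mono2 powr_less_mono2)
  moreover from this(1) have "R m * (- s) powr r \<le> R m * m powr r"
    using R_m by (intro mult_left_mono) auto
  ultimately show ?thesis
    using False R_eq[of m] spow_minus[of r "-s"] by (simp add: gf_def spow_nonneg[of "-s"])
qed

lemma abs_T_less_1: assumes s: "- m < s" "s < 1" shows "\<bar>T s\<bar> < 1"
proof (rule ccontr)
  assume "\<not> \<bar>T s\<bar> < 1"
  then have "1 powr p \<le> \<bar>T s\<bar> powr p" using p_pos by (intro powr_mono2) auto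
  then show False
    using gf_pos[OF s] gf_eq[of s] D_pos[of s] s by (simp add: zero_less_mult_iff)
qed

lemma T_1: "T 1 = 1" by (simp add: T_def D_def A_def)

lemma T_neg_m: "T (- m) = - 1"
proof -
  have "D (- m) = m powr p" using m_pos by (simp add: D_def A_eq spow_minus spow_nonneg)
  then show ?thesis using m_pos p_pos by (simp add: T_def powr_powr powr_minus)
qed

lemma continuous_on_D: "continuous_on S D"
  unfolding D_def[abs_def] by (intro continuous_intros continuous_on_spow r_pos)

lemma continuous_on_T: "continuous_on {- m..1} T"
  unfolding T_def[abs_def] using D_pos
  by (intro continuous_intros continuous_on_powr continuous_on_D) (auto simp: less_imp_neq[symmetric])

lemma T_image: "s \<in> {- m..1} \<Longrightarrow> T s \<in> {-1..1}"
  using abs_T_less_1[of s] T_1 T_neg_m by (cases "s = 1"; cases "s = - m") (auto simp: abs_less_iff)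

lemma T_has_derivative: assumes s: "- m \<le> s" shows "(T has_real_derivative T' s) (at s)"
proof -
  note pos = D_pos[OF s]
  have dD: "(D has_real_derivative R m * (r * dpow r s)) (at s)"
    unfolding D_def[abs_def] using spow_has_derivative[OF r_ge_1]
    by (auto intro!: derivative_eq_intros)
  have e: "D s powr (- (1 / p) - 1) = D s powr (- (1 / p)) / D s"
    using pos by (simp add: powr_diff)
  have "(T has_real_derivative 1 * D s powr (- (1 / p)) +
      (- (1 / p) * D s powr (- (1 / p) - 1) * (R m * (r * dpow r s))) * s) (at s)"
    unfolding T_def[abs_def]
    by (rule DERIV_cong[OF DERIV_mult[OF DERIV_ident DERIV_fun_powr[OF dD pos]]]) simp
  also have "1 * D s powr (- (1 / p)) + (- (1 / p) * D s powr (- (1 / p) - 1) * (R m * (r * dpow r s))) * s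
     = D s powr (- (1 / p)) * (1 - r / p * (R m * (s * dpow r s)) / D s)"
    unfolding e by (simp add: algebra_simps)
  finally show ?thesis by (simp add: T'_def q_def dpow_times_self)
qed

text \<open>Relative size of the signed term in \<open>D\<close>; in this variable the Jacobian of
  \<open>T\<close> becomes the factor occurring in \<open>Lam_key\<close>.\<close>

definition a where "a s = R m * spow r s / A"

lemma D_eq: "D s = A * (1 + a s)" using A_pos by (simp add: D_def a_def field_simps)

lemma a_gt: assumes "- m \<le> s" shows "-1 < a s"
  using D_pos[OF assms] A_pos by (simp add: D_eq zero_less_mult_iff)

lemma T'_eq: assumes "- m \<le> s" shows "T' s = D s powr (- (1 / p)) * (1 - q * a s / (1 + a s))"
proof -
  have "R m * spow r s = A * a s" using A_pos by (simp add: a_def)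
  then show ?thesis using A_pos by (simp add: T'_def D_eq)
qed

lemma factor_pos: assumes "- m \<le> s" shows "0 < 1 - q * a s / (1 + a s)"
proof -
  have a: "-1 < a s" by (rule a_gt[OF assms])
  have "0 < 1 + (1 - q) * a s"
  proof (cases "0 \<le> a s")
    case True then show ?thesis using q_le by (simp add: add_pos_nonneg)
  next
    case False
    have "(1 - q) * - a s \<le> 1 * - a s" using False q_ge by (intro mult_right_mono) auto
    then show ?thesis using a by simp
  qed
  moreover have "1 - q * a s / (1 + a s) = (1 + (1 - q) * a s) / (1 + a s)"
    using a by (simp add: field_simps)
  ultimately show ?thesis using a by simp
qed

lemma T'_nonneg: "- m \<le> s \<Longrightarrow> 0 \<le> T' s"
  using factor_pos[of s] by (simp add: T'_eq)

text \<open>The quantity z = a (1+a)^(-q) of \<open>Lam_key\<close> is a constant multiple of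
  \<open>spow r\<close> of the new variable. An odd function of z is therefore an odd function of t
  alone.\<close>

lemma spow_T: assumes "- m \<le> s"
  shows "R m * A powr q * spow r (T s) = A * (a s * (1 + a s) powr (- q))"
proof -
  have a: "0 < 1 + a s" using a_gt[OF assms] by simp
  have "spow r (T s) = spow r s * D s powr (- q)"
    using p_pos by (simp add: T_def spow_mult spow_nonneg powr_powr q_def)
  also have "D s powr (- q) = A powr (- q) * (1 + a s) powr (- q)"
    using A_pos a by (simp add: D_eq powr_mult)
  finally have "R m * A powr q * spow r (T s) = (A powr q * A powr (- q)) * (R m * spow r s) * (1 + a s) powr (- q)"
    by (simp add: algebra_simps)
  moreover have "A powr q * A powr (- q) = 1" using A_pos by (simp add: powr_add[symmetric])
  moreover have "R m * spow r s = A * a s" using A_pos by (simp add: a_def)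
  ultimately show ?thesis by simp
qed

text \<open>The correction by \<open>Lam\<close> is odd in t, so it does not alter the integral over
  [-1,1], while it compensates the Jacobian of \<open>T\<close> pointwise.\<close>

definition th :: "real \<Rightarrow> real" where "th t = \<rho> t * (1 + Lam (R m * A powr q / A * spow r t))"

lemma th_nonneg: "0 \<le> th t"
  using abs_Lam_le_1[of "R m * A powr q / A * spow r t"] \<rho>_nonneg[of t] by (simp add: th_def abs_le_iff)

lemma continuous_on_th: "continuous_on {-1<..<1} th"
  unfolding th_def[abs_def]
  by (intro continuous_intros continuous_on_\<rho> continuous_on_Lam continuous_on_spow r_pos)

lemma th_integrable: "th integrable_on {-1..1}"
proof (rule singular_integrable[OF continuous_on_th, of 2])
  show "\<bar>th t\<bar> \<le> 2 * \<rho> t" for t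
    using mult_left_mono[of "1 + Lam (R m * A powr q / A * spow r t)" 2 "\<rho> t"]
      abs_Lam_le_1[of "R m * A powr q / A * spow r t"] \<rho>_nonneg[of t] th_nonneg[of t]
    by (simp add: th_def abs_le_iff algebra_simps)
qed simp

lemma integral_th: "integral {-1..1} th = L"
proof -
  have "(\<lambda>t. th t - \<rho> t) integrable_on {-1..1}"
    by (intro integrable_diff th_integrable \<rho>_integrable)
  moreover have "integral {-1..1} (\<lambda>t. th t - \<rho> t) = 0"
    by (rule integral_odd) (simp add: th_def \<rho>_def spow_minus Lam_minus algebra_simps)
  ultimately show ?thesis
    using integral_diff[OF th_integrable \<rho>_integrable] by (simp add: L_def)
qed

text \<open>Pulled back to [- m, 1], the corrected density lies below the time density of an
  extremal with C = 1. After integration, one passage takes at least time \<open>L\<close>.\<close>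

lemma th_T_le: assumes s: "- m < s" "s < 1"
  shows "th (T s) * T' s \<le> gf (R m) s powr (- (1 / p))"
proof -
  have sm: "- m \<le> s" using s by simp
  have z: "R m * A powr q / A * spow r (T s) = a s * (1 + a s) powr (- q)"
    using spow_T[OF sm] A_pos by (simp add: field_simps)
  have "th (T s) * T' s = (D s powr (- (1 / p)) * \<rho> (T s)) *
     ((1 + Lam (a s * (1 + a s) powr (- q))) * (1 - q * a s / (1 + a s)))"
    unfolding th_def z T'_eq[OF sm] by (simp add: algebra_simps)
  also have "\<dots> \<le> (D s powr (- (1 / p)) * \<rho> (T s)) * 1"
    using Lam_key[OF a_gt[OF sm] refl] \<rho>_nonneg by (intro mult_left_mono) auto
  also have "\<dots> = gf (R m) s powr (- (1 / p))"
    unfolding gf_eq[OF sm] \<rho>_def using D_pos[OF sm] abs_powr_p_less_1[OF abs_T_less_1[OF s]]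
    by (simp add: powr_mult)
  finally show ?thesis .
qed

text \<open>The analogue of \<open>th\<close> for the action density g^((p-1)/p). The coefficient 1
  + q of the odd term produces a difference of squares, (1 + (1+q)a)(1 + (1-q)a) = (1+a)^2 - q^2
  a^2, and the negative square becomes the gain in \<open>R\<close>.\<close>

definition kk :: "real \<Rightarrow> real" where
  "kk t = (1 - \<bar>t\<bar> powr p) powr ((p - 1) / p) * (A + (1 + q) * (R m * A powr q * spow r t))"

lemma continuous_on_kk: "continuous_on {-1..1} kk"
proof -
  have "continuous_on {-1..1} (\<lambda>t. (1 - \<bar>t\<bar> powr p) powr ((p - 1) / p))"
    using p_ge abs_powr_p_le_1
    by (intro continuous_on_powr' continuous_intros continuous_on_abs_powr) (auto simp: abs_le_iff)
  then show ?thesis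
    unfolding kk_def[abs_def]
    by (intro continuous_on_mult[OF _ continuous_on_add] continuous_on_mult continuous_on_const
        continuous_on_spow continuous_on_id r_pos)
qed

lemma integral_kk: "integral {-1..1} kk = A * ((p - 1) / p * L)"
proof -
  have c: "continuous_on {-1..1} (\<lambda>t. (1 - \<bar>t\<bar> powr p) powr ((p - 1) / p))"
    using p_ge abs_powr_p_le_1
    by (intro continuous_on_powr' continuous_intros continuous_on_abs_powr) (auto simp: abs_le_iff)
  have i: "(\<lambda>t. A * (1 - \<bar>t\<bar> powr p) powr ((p - 1) / p)) integrable_on {-1..1}"
    by (intro integrable_continuous_real continuous_intros c)
  have "integral {-1..1} (\<lambda>t. kk t - A * (1 - \<bar>t\<bar> powr p) powr ((p - 1) / p)) = 0"
    by (rule integral_odd) (simp add: kk_def spow_minus algebra_simps)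
  then show ?thesis
    using integral_diff[OF integrable_continuous_real[OF continuous_on_kk] i] by (simp add: integral_compl_powr)
qed

lemma kk_T_le: assumes s: "- m \<le> s" "s \<le> 1"
  shows "kk (T s) * T' s \<le> gf (R m) s powr ((p - 1) / p) * (1 - q\<^sup>2 * (R m)\<^sup>2 * \<bar>s\<bar> powr (2 * r))"
proof -
  define e where "e = (p - 1) / p"
  have a: "0 < 1 + a s" using a_gt[OF s(1)] by simp
  have D: "0 < D s" "D s \<le> 1" using D_pos D_le_1 s by auto
  have T1: "0 \<le> 1 - \<bar>T s\<bar> powr p" using abs_powr_p_le_1[of "T s"] T_image[of s] s by (auto simp: abs_le_iff)
  define X where "X = (1 - \<bar>T s\<bar> powr p) powr e * D s powr (- (1 / p))"
  have X: "0 \<le> X" by (simp add: X_def)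
  \<comment> \<open>The power is at most 1 for a \<ge> 0 and at least 1 for a < 0; multiplied by a,
    both cases point the same way.\<close>
  have "a s * (1 + a s) powr (- q) \<le> a s"
  proof (cases "0 \<le> a s")
    case True
    have "(1 + a s) powr (- q) \<le> 1" using powr_mono[of "- q" 0 "1 + a s"] True q_ge by simp
    then show ?thesis using mult_left_mono[OF _ True] by fastforce
  next
    case False
    have "1 \<le> (1 + a s) powr (- q)" using powr_mono'[of "- q" 0 "1 + a s"] False a q_ge by simp
    then show ?thesis using mult_left_mono_neg[of 1 "(1 + a s) powr (- q)" "a s"] False by simp
  qed
  then have "A + (1 + q) * (R m * A powr q * spow r (T s)) \<le> A * (1 + (1 + q) * a s)"
    unfolding spow_T[OF s(1)] using A_pos q_ge
    using mult_left_mono[of "a s * (1 + a s) powr (- q)" "a s" "A * (1 + q)"] by (simp add: algebra_simps)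
  then have "(A + (1 + q) * (R m * A powr q * spow r (T s))) * (1 - q * a s / (1 + a s))
      \<le> A * (1 + (1 + q) * a s) * (1 - q * a s / (1 + a s))"
    using factor_pos[OF s(1)] by (intro mult_right_mono) auto
  also have "\<dots> = D s - q\<^sup>2 * (A * a s)\<^sup>2 / D s"
  proof -
    have "A * (1 + (1 + q) * a s) * (1 - q * a s / (1 + a s)) = A * ((1 + a s)\<^sup>2 - q\<^sup>2 * (a s)\<^sup>2) / (1 + a s)"
      using a by (simp add: field_simps power2_eq_square)
    also have "\<dots> = D s - q\<^sup>2 * (A * a s)\<^sup>2 / D s"
    proof -
      have "q\<^sup>2 * (A * a s)\<^sup>2 / (A * (1 + a s)) = A * (q\<^sup>2 * (a s)\<^sup>2) / (1 + a s)"
        using A_pos by (simp add: power2_eq_square)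
      moreover have "A * ((1 + a s)\<^sup>2 - q\<^sup>2 * (a s)\<^sup>2) / (1 + a s) = A * (1 + a s) - A * (q\<^sup>2 * (a s)\<^sup>2) / (1 + a s)"
        using a by (simp add: right_diff_distrib diff_divide_distrib power2_eq_square)
      ultimately show ?thesis unfolding D_eq by simp
    qed
    finally show ?thesis .
  qed
  \<comment> \<open>\<open>D s \<le> 1\<close> trades the denominator for a factor, so that
    \<open>D s\<close> splits off and recombines with 1 - |T|^p into g.\<close>
  also have "\<dots> \<le> D s - q\<^sup>2 * (A * a s)\<^sup>2 * D s"
  proof -
    have "D s * D s \<le> 1" using D mult_mono[of "D s" 1 "D s" 1] by simp
    then have "D s \<le> 1 / D s" using D by (simp add: field_simps)
    then have "q\<^sup>2 * (A * a s)\<^sup>2 * D s \<le> q\<^sup>2 * (A * a s)\<^sup>2 * (1 / D s)"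
      by (intro mult_left_mono) auto
    then show ?thesis by simp
  qed
  also have "\<dots> = D s * (1 - q\<^sup>2 * (R m)\<^sup>2 * \<bar>s\<bar> powr (2 * r))"
  proof -
    have "A * a s = R m * spow r s" using A_pos by (simp add: a_def)
    moreover have "(spow r s)\<^sup>2 = \<bar>s\<bar> powr (2 * r)"
      using abs_spow[of r s] by (metis mult_2 power2_abs power2_eq_square powr_add)
    ultimately show ?thesis by (simp add: power_mult_distrib algebra_simps)
  qed
  finally have main: "(A + (1 + q) * (R m * A powr q * spow r (T s))) * (1 - q * a s / (1 + a s))
     \<le> D s * (1 - q\<^sup>2 * (R m)\<^sup>2 * \<bar>s\<bar> powr (2 * r))" .
  have "kk (T s) * T' s = X * ((A + (1 + q) * (R m * A powr q * spow r (T s))) * (1 - q * a s / (1 + a s)))"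
    unfolding kk_def T'_eq[OF s(1)] X_def e_def by (simp add: algebra_simps)
  also have "\<dots> \<le> X * (D s * (1 - q\<^sup>2 * (R m)\<^sup>2 * \<bar>s\<bar> powr (2 * r)))"
    by (rule mult_left_mono[OF main X])
  also have "\<dots> = gf (R m) s powr e * (1 - q\<^sup>2 * (R m)\<^sup>2 * \<bar>s\<bar> powr (2 * r))"
  proof -
    have "gf (R m) s powr e = D s powr e * (1 - \<bar>T s\<bar> powr p) powr e"
      unfolding gf_eq[OF s(1)] using D T1 by (simp add: powr_mult)
    also have "D s powr e = D s * D s powr (- (1 / p))"
      unfolding e_def using D by (intro powr_conjugate) simp
    finally show ?thesis by (simp add: X_def)
  qed
  finally show ?thesis by (simp add: e_def)
qed

end

section \<open>Minimizers without constant sign\<close>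

lemma tendsto_shrink:
  fixes f :: "real \<Rightarrow> real"
  assumes f: "continuous_on {- c..1} f" and c: "0 \<le> c" and s: "s \<in> {- c..1}"
  shows "(\<lambda>n. f ((1 - 1 / real (n + 2)) * s)) \<longlonglongrightarrow> f s"
proof (rule continuous_on_tendsto_compose[OF f _ s])
  have "(\<lambda>n. (1 - 1 / real (n + 2)) * s) \<longlonglongrightarrow> (1 - 0) * s"
    by (intro tendsto_intros LIMSEQ_ignore_initial_segment[OF lim_inverse_n', of 2])
  then show "(\<lambda>n. (1 - 1 / real (n + 2)) * s) \<longlonglongrightarrow> s" by simp
  have "(1 - 1 / real (n + 2)) * s \<in> {- c..1}" for n
  proof -
    define \<theta> where "\<theta> = 1 - 1 / real (n + 2)"
    have \<theta>: "0 \<le> \<theta>" "\<theta> \<le> 1" by (auto simp: \<theta>_def)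
    have "\<theta> * s \<le> 1" using mult_left_mono[of s 1 \<theta>] \<theta> s by simp
    moreover have "\<theta> * - c \<le> \<theta> * s" using \<theta> s by (intro mult_left_mono) auto
    moreover have "- c \<le> \<theta> * - c" using mult_right_mono[of \<theta> 1 c] \<theta> c by simp
    ultimately show ?thesis unfolding \<theta>_def[symmetric] by simp
  qed
  then show "\<forall>\<^sub>F n in sequentially. (1 - 1 / real (n + 2)) * s \<in> {- c..1}" by simp
qed

text \<open>An estimate proved for shrunk profiles, away from the singular endpoints, survives the
  limit by continuity. The factors 1 - 1/(n+2) lie strictly between 0 and 1 also for n = 0.\<close>

lemma lipschitz_shrink_limit:
  fixes f w :: "real \<Rightarrow> real"
  assumes f: "continuous_on {- c..1} f" "0 \<le> c" and w: "w x \<in> {- c..1}" "w y \<in> {- c..1}"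
    and lip: "\<And>\<theta>. 0 < \<theta> \<Longrightarrow> \<theta> < 1 \<Longrightarrow> \<bar>f (\<theta> * w y) - f (\<theta> * w x)\<bar> \<le> B"
  shows "\<bar>f (w y) - f (w x)\<bar> \<le> B"
proof -
  have "(\<lambda>n. \<bar>f ((1 - 1 / real (n + 2)) * w y) - f ((1 - 1 / real (n + 2)) * w x)\<bar>) \<longlonglongrightarrow> \<bar>f (w y) - f (w x)\<bar>"
    by (intro tendsto_rabs tendsto_diff tendsto_shrink[OF f] w)
  moreover have "\<bar>f ((1 - 1 / real (n + 2)) * w y) - f ((1 - 1 / real (n + 2)) * w x)\<bar> \<le> B" for n
    by (rule lip) auto
  ultimately show ?thesis by (intro LIMSEQ_le_const2) auto
qed

definition C1_0 :: "(real \<Rightarrow> real) \<Rightarrow> (real \<Rightarrow> real) \<Rightarrow> bool" where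
  "C1_0 w w' \<longleftrightarrow> continuous_on {-1..1} w \<and> continuous_on {-1..1} w' \<and>
     (\<forall>x\<in>{-1<..<1}. (w has_real_derivative w' x) (at x)) \<and> w (-1) = 0 \<and> w 1 = 0"

lemma C1_0D:
  assumes "C1_0 w w'"
  shows "continuous_on {-1..1} w" "continuous_on {-1..1} w'"
    "\<And>x. x \<in> {-1<..<1} \<Longrightarrow> (w has_real_derivative w' x) (at x)" "w (-1) = 0" "w 1 = 0"
  using assms by (auto simp: C1_0_def)

lemma C1_0_scale: "C1_0 w w' \<Longrightarrow> C1_0 (\<lambda>x. c * w x) (\<lambda>x. c * w' x)"
  unfolding C1_0_def by (auto intro!: continuous_intros derivative_eq_intros)

context half_range
begin

definition Theta :: "real \<Rightarrow> real" where "Theta t = integral {-1..t} th"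

lemma continuous_on_Theta: "continuous_on {-1..1} Theta"
  unfolding Theta_def[abs_def] by (rule indefinite_integral_continuous_1[OF th_integrable])

lemma continuous_on_Theta_T: "continuous_on {- m..1} (\<lambda>s. Theta (T s))"
  by (rule continuous_on_compose2[OF continuous_on_Theta continuous_on_T]) (use T_image in auto)

text \<open>For the shrunk profile the derivative of the composition is at most g(\<theta> w)^(-1/p)
  times \<theta> |w'|. By the first integral and \<open>gf_scale\<close> the latter is at most
  C^(1/p) g(\<theta> w)^(1/p), and the powers of g cancel.\<close>

lemma Theta_T_lipschitz:
  assumes w: "C1_0 w w'" and range: "\<And>x. x \<in> {-1..1} \<Longrightarrow> w x \<in> {- m..1}"
    and first: "\<And>x. x \<in> {-1..1} \<Longrightarrow> \<bar>w' x\<bar> powr p = C * gf (R m) (w x)" and C: "0 \<le> C"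
    and x: "x \<in> {-1..1}" and y: "y \<in> {-1..1}" and xy: "x \<le> y"
  shows "\<bar>Theta (T (w y)) - Theta (T (w x))\<bar> \<le> C powr (1 / p) * (y - x)"
proof (rule lipschitz_shrink_limit[OF continuous_on_Theta_T, where w=w])
  fix \<theta> :: real assume \<theta>: "0 < \<theta>" "\<theta> < 1"
  have strict: "- m < \<theta> * w z" "\<theta> * w z < 1" if "z \<in> {-1..1}" for z
  proof -
    have 1: "\<theta> * - m \<le> \<theta> * w z" by (rule mult_left_mono) (use range[OF that] \<theta> in auto)
    have 2: "\<theta> * w z \<le> \<theta> * 1" by (rule mult_left_mono) (use range[OF that] \<theta> in auto)
    have "\<theta> * m < m" using \<theta> m_pos by simp
    then show "- m < \<theta> * w z" "\<theta> * w z < 1" using 1 2 \<theta> by linarith+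
  qed
  show "\<bar>Theta (T (\<theta> * w y)) - Theta (T (\<theta> * w x))\<bar> \<le> C powr (1 / p) * (y - x)"
  proof (rule lipschitz_from_derivative[OF xy])
    have "continuous_on {x..y} w" using C1_0D(1)[OF w] by (rule continuous_on_subset) (use x y in auto)
    then have "continuous_on {x..y} (\<lambda>z. \<theta> * w z)" by (intro continuous_intros)
    then show "continuous_on {x..y} (\<lambda>z. Theta (T (\<theta> * w z)))"
      by (rule continuous_on_compose2[OF continuous_on_Theta_T]) (use strict x y in \<open>force simp: less_imp_le\<close>)
    fix z assume "x < z" "z < y"
    then have z: "z \<in> {-1<..<1}" "z \<in> {-1..1}" using x y by auto
    let ?s = "\<theta> * w z"
    have s: "- m < ?s" "?s < 1" using strict[OF z(2)] by auto
    have Ts: "T ?s \<in> {-1<..<1}" using abs_T_less_1[OF s] by (auto simp: abs_less_iff)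
    have d1: "((\<lambda>z. \<theta> * w z) has_real_derivative \<theta> * w' z) (at z)"
      by (intro DERIV_cmult C1_0D(3)[OF w z(1)])
    have d2: "((\<lambda>z. T (\<theta> * w z)) has_real_derivative T' ?s * (\<theta> * w' z)) (at z)"
      by (rule DERIV_chain2[OF T_has_derivative d1]) (use s in simp)
    have d3: "(Theta has_real_derivative th (T ?s)) (at (T ?s))"
      unfolding Theta_def[abs_def] by (rule singular_antiderivative[OF continuous_on_th th_integrable Ts])
    have d: "((\<lambda>z. Theta (T (\<theta> * w z))) has_real_derivative th (T ?s) * (T' ?s * (\<theta> * w' z))) (at z)"
      by (rule DERIV_chain2[OF d3 d2])
    have g: "0 < gf (R m) ?s" by (rule gf_pos[OF s])
    have gw: "0 \<le> gf (R m) (w z)" using gf_nonneg[of m "w z"] range[OF z(2)] m_pos m_le by auto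
    have "\<theta> * \<bar>w' z\<bar> = \<theta> * (C * gf (R m) (w z)) powr (1 / p)"
      unfolding first[OF z(2), symmetric] using p_pos by (simp add: powr_powr)
    also have "\<dots> = C powr (1 / p) * (\<theta> powr p * gf (R m) (w z)) powr (1 / p)"
      using \<theta> C gw p_pos by (simp add: powr_mult powr_powr)
    also have "\<dots> \<le> C powr (1 / p) * gf (R m) ?s powr (1 / p)"
      using gf_scale[of m "w z" \<theta>] range[OF z(2)] m_pos m_le \<theta> gw p_pos
      by (intro mult_left_mono powr_mono2) auto
    finally have 1: "\<theta> * \<bar>w' z\<bar> \<le> C powr (1 / p) * gf (R m) ?s powr (1 / p)" .
    have "\<bar>th (T ?s) * (T' ?s * (\<theta> * w' z))\<bar> = (th (T ?s) * T' ?s) * (\<theta> * \<bar>w' z\<bar>)"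
      using th_nonneg[of "T ?s"] T'_nonneg[of ?s] s \<theta> by (simp add: abs_mult)
    also have "\<dots> \<le> gf (R m) ?s powr (- (1 / p)) * (C powr (1 / p) * gf (R m) ?s powr (1 / p))"
      by (rule mult_mono[OF th_T_le[OF s] 1]) (use \<theta> in auto)
    also have "\<dots> = C powr (1 / p)" using g by (simp add: powr_minus)
    finally show "\<exists>d. ((\<lambda>z. Theta (T (\<theta> * w z))) has_real_derivative d) (at z) \<and> \<bar>d\<bar> \<le> C powr (1 / p)"
      using d by blast
  qed
qed (use m_pos range x y in auto)

lemma L_le:
  assumes w: "C1_0 w w'" and range: "\<And>x. x \<in> {-1..1} \<Longrightarrow> w x \<in> {- m..1}"
    and first: "\<And>x. x \<in> {-1..1} \<Longrightarrow> \<bar>w' x\<bar> powr p = C * gf (R m) (w x)" and C: "0 \<le> C"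
    and x: "x1 \<in> {-1..1}" "w x1 = 1" "x2 \<in> {-1..1}" "w x2 = - m"
  shows "L \<le> C powr (1 / p)"
proof -
  have "2 * (Theta (T (w x1)) - Theta (T (w x2))) \<le> C powr (1 / p) * 1 - C powr (1 / p) * (-1)"
    by (rule lipschitz_travel[where c="Theta (T 0)"])
      (use Theta_T_lipschitz[OF w range first C] x C1_0D[OF w] in \<open>auto simp: algebra_simps\<close>)
  then show ?thesis
    using integral_th x by (simp add: T_1 T_neg_m Theta_def)
qed

end

section \<open>Nonnegative profiles that touch zero, and the bound for extremals\<close>

context exponents
begin

lemma integral_\<rho>_half: "integral {-1..0} \<rho> = L / 2"
proof -
  have "integral {-1..0} (\<lambda>t. \<rho> (- t)) = integral {0..1} \<rho>"
    using Henstock_Kurzweil_Integration.integral_reflect_real[where f=\<rho> and a=0 and b=1] by simp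
  moreover have "(\<lambda>t. \<rho> (- t)) = \<rho>" by (simp add: \<rho>_def fun_eq_iff)
  ultimately show ?thesis
    using Henstock_Kurzweil_Integration.integral_combine[of "-1" 0 1 \<rho>] \<rho>_integrable by (simp add: L_def)
qed

lemma nearest_zeros:
  fixes w :: "real \<Rightarrow> real"
  assumes w: "continuous_on {-1..1} w" "w (-1) = 0" "w 1 = 0" and x: "x1 \<in> {-1..1}" "w x1 \<noteq> 0"
  obtains a b where "-1 \<le> a" "a < x1" "x1 < b" "b \<le> 1" "w a = 0" "w b = 0"
    "\<And>x. a < x \<Longrightarrow> x < b \<Longrightarrow> w x \<noteq> 0"
proof -
  have comp: "compact {x \<in> {c..d}. w x = 0}" if "{c..d} \<subseteq> {-1..1}" for c d
  proof -
    have "closed {x \<in> {c..d}. w x = 0}"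
      by (rule continuous_closed_preimage_constant[OF continuous_on_subset[OF w(1) that] closed_atLeastAtMost])
    moreover have "bounded {x \<in> {c..d}. w x = 0}"
      by (rule bounded_subset[OF compact_imp_bounded[OF compact_Icc[of c d]]]) auto
    ultimately show ?thesis by (simp add: compact_eq_bounded_closed)
  qed
  have "compact {x \<in> {-1..x1}. w x = 0}" "compact {x \<in> {x1..1}. w x = 0}"
    using comp[of "-1" x1] comp[of x1 1] x by auto
  moreover have "{x \<in> {-1..x1}. w x = 0} \<noteq> {}" "{x \<in> {x1..1}. w x = 0} \<noteq> {}"
    using w x by auto
  ultimately obtain a b where a: "a \<in> {x \<in> {-1..x1}. w x = 0}" "\<And>y. y \<in> {x \<in> {-1..x1}. w x = 0} \<Longrightarrow> y \<le> a"
    and b: "b \<in> {x \<in> {x1..1}. w x = 0}" "\<And>y. y \<in> {x \<in> {x1..1}. w x = 0} \<Longrightarrow> b \<le> y"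
    by (meson compact_attains_sup compact_attains_inf)
  show ?thesis
  proof (rule that[of a b])
    show "a < x1" "x1 < b" using a(1) b(1) x by (auto simp: less_le)
    fix x assume ab: "a < x" "x < b"
    show "w x \<noteq> 0"
    proof
      assume "w x = 0"
      then show False using a(1) a(2)[of x] b(1) b(2)[of x] ab by (cases "x \<le> x1") auto
    qed
  qed (use a b in auto)
qed

text \<open>The limiting case m = 0: here g s = s^r - s^p, the constant \<open>A\<close> is zero and
  the change of variable \<open>T\<close> degenerates. The power z = w^(1-q) restores the normal
  form |z'| = (1-q) C^(1/p) (1 - z^p)^(1/p), and q \<ge> 1/2 makes 2(1-q) at most 1. For r = p, g
  vanishes on the range and no motion is possible.\<close>

lemma L_le_nonneg:
  assumes w: "C1_0 w w'" and range: "\<And>x. x \<in> {-1..1} \<Longrightarrow> w x \<in> {0..1}"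
    and first: "\<And>x. x \<in> {-1..1} \<Longrightarrow> \<bar>w' x\<bar> powr p = C * gf 1 (w x)" and C: "0 \<le> C"
    and x1: "x1 \<in> {-1..1}" "w x1 = 1"
  shows "L \<le> C powr (1 / p)"
proof (cases "r = p")
  case True
  have "w' x = 0" if "x \<in> {-1..1}" for x
  proof -
    have "gf 1 (w x) = w x powr r - w x powr p" using range[OF that] by (simp add: gf_def spow_nonneg)
    also have "\<dots> = 0" using True by simp
    finally show ?thesis using first[OF that] by simp
  qed
  then have "w x1 = w (-1)"
    using C1_0D(3)[OF w] x1 by (intro DERIV_isconst2[OF _ C1_0D(1)[OF w]]) auto
  then show ?thesis using x1 C1_0D(4)[OF w] by simp
next
  case False
  have q1: "q < 1" using False r_le p_pos by (simp add: q_def)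
  \<comment> \<open>The power w^(1-q) is differentiated only where w is positive, hence on the
    component of the nonzero set around the maximum.\<close>
  obtain a b where ab: "-1 \<le> a" "a < x1" "x1 < b" "b \<le> 1" "w a = 0" "w b = 0"
    "\<And>x. a < x \<Longrightarrow> x < b \<Longrightarrow> w x \<noteq> 0"
    using nearest_zeros[OF C1_0D(1,4,5)[OF w] x1(1)] x1 by auto
  define z where "z x = w x powr (1 - q)" for x
  define F where "F t = integral {-1..t} \<rho>" for t
  have Fc: "continuous_on {-1..1} F"
    unfolding F_def by (rule indefinite_integral_continuous_1[OF \<rho>_integrable])
  have wc: "continuous_on {a..b} w" using C1_0D(1)[OF w] by (rule continuous_on_subset) (use ab in auto)
  have zc: "continuous_on {a..b} z"
    unfolding z_def using q1 range ab by (intro continuous_on_powr' wc continuous_intros) auto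
  have z01: "z x \<in> {0..1}" if "x \<in> {a..b}" for x
    using range[of x] that ab q1 powr_mono2[of "1 - q" "w x" 1] by (auto simp: z_def)
  define l where "l = (1 - q) * C powr (1 / p)"
  have lip: "\<bar>F (z y) - F (z x)\<bar> \<le> l * (y - x)" if xy: "x \<in> {a..b}" "y \<in> {a..b}" "x \<le> y" for x y
  proof (rule lipschitz_shrink_limit[OF Fc, where w=z])
    fix \<theta> :: real assume \<theta>: "0 < \<theta>" "\<theta> < 1"
    have strict: "0 \<le> \<theta> * z u" "\<theta> * z u < 1" if "u \<in> {a..b}" for u
    proof -
      have "\<theta> * z u \<le> \<theta> * 1" by (rule mult_left_mono) (use z01[OF that] \<theta> in auto)
      then show "0 \<le> \<theta> * z u" "\<theta> * z u < 1" using z01[OF that] \<theta> by (simp, linarith)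
    qed
    show "\<bar>F (\<theta> * z y) - F (\<theta> * z x)\<bar> \<le> l * (y - x)"
    proof (rule lipschitz_from_derivative[OF xy(3)])
      have "continuous_on {x..y} z" by (rule continuous_on_subset[OF zc]) (use xy in auto)
      then have "continuous_on {x..y} (\<lambda>u. \<theta> * z u)" by (intro continuous_intros)
      moreover have "\<theta> * z u \<in> {-1..1}" if "u \<in> {x..y}" for u
        using strict[of u] that xy by auto
      ultimately show "continuous_on {x..y} (\<lambda>u. F (\<theta> * z u))"
        by (intro continuous_on_compose2[OF Fc]) auto
      fix u assume "x < u" "u < y"
      then have u: "u \<in> {a..b}" "a < u" "u < b" "u \<in> {-1<..<1}" "u \<in> {-1..1}" using xy ab by auto
      have wu: "0 < w u" "w u \<le> 1" using range[OF u(5)] ab(7)[OF u(2,3)] by auto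
      have d1: "(z has_real_derivative (1 - q) * w u powr (- q) * w' u) (at u)"
        unfolding z_def using DERIV_fun_powr[OF C1_0D(3)[OF w u(4)] wu(1), of "1 - q"] by simp
      have d2: "((\<lambda>u. \<theta> * z u) has_real_derivative \<theta> * ((1 - q) * w u powr (- q) * w' u)) (at u)"
        by (rule DERIV_cmult[OF d1])
      have d3: "(F has_real_derivative \<rho> (\<theta> * z u)) (at (\<theta> * z u))"
        unfolding F_def by (rule singular_antiderivative[OF continuous_on_\<rho> \<rho>_integrable]) (use strict[OF u(1)] in auto)
      have d: "((\<lambda>u. F (\<theta> * z u)) has_real_derivative
          \<rho> (\<theta> * z u) * (\<theta> * ((1 - q) * w u powr (- q) * w' u))) (at u)"
        by (rule DERIV_chain2[OF d3 d2])
      have zp: "z u powr p = w u powr (p - r)"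
        using p_pos by (simp add: z_def powr_powr q_def left_diff_distrib)
      have zp1: "z u powr p \<le> 1" using abs_powr_p_le_1[of "z u"] z01[OF u(1)] by simp
      have "gf 1 (w u) = w u powr r * (1 - z u powr p)"
        using wu unfolding zp by (simp add: gf_def spow_nonneg right_diff_distrib powr_add[symmetric])
      then have "\<bar>w' u\<bar> = (C * (w u powr r * (1 - z u powr p))) powr (1 / p)"
        using first[OF u(5)] p_pos by (metis abs_ge_zero nonzero_divide_eq_eq not_less_iff_gr_or_eq powr_one powr_powr times_divide_eq_right mult.right_neutral abs_abs)
      also have "\<dots> = C powr (1 / p) * w u powr q * (1 - z u powr p) powr (1 / p)"
        using C zp1 by (simp add: powr_mult powr_powr q_def)
      finally have w'u: "\<bar>w' u\<bar> = C powr (1 / p) * w u powr q * (1 - z u powr p) powr (1 / p)" .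
      have th: "0 < 1 - (\<theta> * z u) powr p"
        using abs_powr_p_less_1[of "\<theta> * z u"] strict[OF u(1)] by simp
      have "(\<theta> * z u) powr p \<le> z u powr p"
        using z01[OF u(1)] \<theta> p_pos mult_right_mono[of \<theta> 1 "z u"] by (intro powr_mono2) auto
      then have "(1 - z u powr p) powr (1 / p) \<le> (1 - (\<theta> * z u) powr p) powr (1 / p)"
        using zp1 p_pos by (intro powr_mono2) auto
      then have "\<rho> (\<theta> * z u) * (1 - z u powr p) powr (1 / p) \<le> \<rho> (\<theta> * z u) * (1 - (\<theta> * z u) powr p) powr (1 / p)"
        using \<rho>_nonneg by (intro mult_left_mono)
      also have "\<dots> = 1"
        using th strict[OF u(1)] by (simp add: \<rho>_def powr_add[symmetric])
      finally have \<rho>1: "\<rho> (\<theta> * z u) * (1 - z u powr p) powr (1 / p) \<le> 1" .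
      have wq: "w u powr (- q) * w u powr q = 1" using wu by (simp add: powr_add[symmetric])
      have "\<bar>\<rho> (\<theta> * z u) * (\<theta> * ((1 - q) * w u powr (- q) * w' u))\<bar>
          = \<theta> * l * (\<rho> (\<theta> * z u) * (1 - z u powr p) powr (1 / p)) * (w u powr (- q) * w u powr q)"
        using \<theta> q1 \<rho>_nonneg[of "\<theta> * z u"] by (simp add: abs_mult w'u l_def)
      also have "\<dots> \<le> 1 * l * 1 * 1"
        unfolding wq using \<theta> \<rho>1 q1 \<rho>_nonneg by (intro mult_mono) (auto simp: l_def)
      finally show "\<exists>d. ((\<lambda>u. F (\<theta> * z u)) has_real_derivative d) (at u) \<and> \<bar>d\<bar> \<le> l"
        using d by auto
    qed
  qed (use z01[OF xy(1)] z01[OF xy(2)] in auto)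
  have "z a = 0" "z b = 0" "z x1 = 1" using ab x1 by (auto simp: z_def)
  moreover have "F 0 = L / 2" "F 1 = L" by (simp_all add: F_def integral_\<rho>_half L_def)
  ultimately have "L / 2 \<le> l * (x1 - a)" "L / 2 \<le> l * (b - x1)"
    using lip[of a x1] lip[of x1 b] ab by (auto simp: abs_le_iff)
  then have "L \<le> l * (b - a)" by (simp add: algebra_simps)
  also have "\<dots> \<le> l * 2" using ab q1 by (intro mult_left_mono) (auto simp: l_def)
  also have "\<dots> \<le> C powr (1 / p)"
    using mult_right_mono[of "2 * (1 - q)" 1 "C powr (1 / p)"] q_ge by (simp add: l_def algebra_simps)
  finally show ?thesis .
qed

lemma DERIV_0_at_interior_max:
  assumes w: "C1_0 w w'" and x: "x \<in> {-1<..<1}" and max: "\<And>y. y \<in> {-1..1} \<Longrightarrow> w y \<le> w x"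
  shows "w' x = 0"
proof (rule DERIV_local_max[OF C1_0D(3)[OF w x], of "min (1 - x) (1 + x)"])
  show "\<forall>y. \<bar>x - y\<bar> < min (1 - x) (1 + x) \<longrightarrow> w y \<le> w x"
    using max by (auto simp: abs_less_iff)
qed (use x in auto)

text \<open>The derivative vanishes at an interior maximum and minimum, so the right-hand side of
  the normalized first integral has zeros at 1 and at - m. These two linear equations leave only the
  multiple c of \<open>gf (R m)\<close>.\<close>

lemma extremal_bound:
  assumes w: "C1_0 w w'" and M: "0 < M" "x1 \<in> {-1..1}" "w x1 = M" "\<And>x. x \<in> {-1..1} \<Longrightarrow> \<bar>w x\<bar> \<le> M"
    and x0: "x0 \<in> {-1<..<1}" "w x0 \<le> 0"
    and first: "\<And>x. x \<in> {-1..1} \<Longrightarrow> (p - 1) * \<bar>w' x\<bar> powr p = a + b * spow r (w x) - c * \<bar>w x\<bar> powr p"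
  shows "(p - 1) * L powr p \<le> c"
proof -
  define v where "v x = (1 / M) * w x" for x
  define v' where "v' x = (1 / M) * w' x" for x
  have v: "C1_0 v v'" using C1_0_scale[OF w, of "1 / M"] by (simp add: v_def[abs_def] v'_def[abs_def])
  have vb: "\<bar>v x\<bar> \<le> 1" if "x \<in> {-1..1}" for x using M(1) M(4)[OF that] by (simp add: v_def abs_mult)
  obtain x3 where x3: "x3 \<in> {-1..1}" "\<And>x. x \<in> {-1..1} \<Longrightarrow> v x3 \<le> v x"
    using continuous_attains_inf[OF _ _ C1_0D(1)[OF v]] by auto
  define m where "m = - v x3"
  have m: "0 \<le> m" "m \<le> 1"
    using x3(2)[of 1] vb[OF x3(1)] C1_0D(5)[OF v] by (auto simp: m_def)
  \<comment> \<open>If the profile is nonnegative, the given point x0 is itself an interior minimum.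
    Otherwise the minimum is negative and cannot lie on the boundary.\<close>
  have "\<exists>x2 \<in> {-1<..<1}. v x2 = - m"
  proof (cases "m = 0")
    case True
    have "0 \<le> v x0" using x3(2)[of x0] True x0 by (simp add: m_def)
    then have "0 \<le> w x0" using M(1) by (simp add: v_def zero_le_divide_iff)
    then have "v x0 = - m" using x0 True by (simp add: v_def)
    then show ?thesis using x0 by blast
  next
    case False
    then have "x3 \<noteq> 1" "x3 \<noteq> -1" using C1_0D[OF v] by (auto simp: m_def)
    then show ?thesis using x3(1) by (auto simp: m_def intro!: bexI[of _ x3])
  qed
  then obtain x2 where x2: "x2 \<in> {-1<..<1}" "v x2 = - m" by blast
  have vx1: "v x1 = 1" using M by (simp add: v_def)
  have x1: "x1 \<in> {-1<..<1}" using M(2) vx1 C1_0D[OF v] by (cases "x1 = 1"; cases "x1 = -1") auto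
  have v'x1: "v' x1 = 0"
    by (rule DERIV_0_at_interior_max[OF v x1]) (use vb vx1 in \<open>force simp: abs_le_iff\<close>)
  have "(\<lambda>x. - 1 * v' x) x2 = 0"
    by (rule DERIV_0_at_interior_max[OF C1_0_scale[OF v] x2(1)]) (use x3 x2 in \<open>auto simp: m_def\<close>)
  then have v'x2: "v' x2 = 0" by simp
  define a1 where "a1 = a * M powr (- p)"
  define b1 where "b1 = b * M powr (r - p)"
  have first1: "(p - 1) * \<bar>v' x\<bar> powr p = a1 + b1 * spow r (v x) - c * \<bar>v x\<bar> powr p" if x: "x \<in> {-1..1}" for x
  proof -
    have wv: "w x = M * v x" "w' x = M * v' x" using M(1) by (simp_all add: v_def v'_def)
    have sp: "spow r (M * v x) = M powr r * spow r (v x)" using M(1) by (simp add: spow_mult spow_nonneg)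
    have "M powr (- p) * ((p - 1) * (M powr p * \<bar>v' x\<bar> powr p))
        = M powr (- p) * (a + b * (M powr r * spow r (v x)) - c * (M powr p * \<bar>v x\<bar> powr p))"
      using first[OF x] M(1) unfolding wv sp by (simp add: abs_mult powr_mult)
    moreover have "M powr (- p) * M powr p = 1" "M powr (- p) * M powr r = M powr (r - p)"
      using M(1) by (simp_all add: powr_add[symmetric])
    moreover have "P * ((p - 1) * (N * V)) = (P * N) * ((p - 1) * V)"
      "P * (a + b * (K * S) - c * (N * U)) = a * P + b * (P * K) * S - c * ((P * N) * U)" for P N V K S U
      by (simp_all add: algebra_simps)
    ultimately show ?thesis by (simp only: a1_def b1_def mult_1)
  qed
  have e1: "a1 + b1 = c"
    using first1[of x1] x1 v'x1 vx1 by simp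
  have e2: "a1 - b1 * m powr r = c * m powr p"
    using first1[of x2] x2 v'x2 m by (simp add: spow_minus spow_nonneg)
  have pos: "0 < 1 + m powr r" by (simp add: add_pos_nonneg)
  have "b1 * (1 + m powr r) = c * (1 - m powr p)" using e1 e2 by (simp add: algebra_simps)
  then have b1: "b1 = c * R m" using pos by (simp add: R_def field_simps)
  then have a1: "a1 = c * (1 - R m)" using e1 by (simp add: algebra_simps)
  have first2: "\<bar>v' x\<bar> powr p = c / (p - 1) * gf (R m) (v x)" if x: "x \<in> {-1..1}" for x
  proof -
    have "(p - 1) * \<bar>v' x\<bar> powr p = c * gf (R m) (v x)"
      unfolding first1[OF x] a1 b1 gf_def by (simp add: algebra_simps)
    then show ?thesis using p_ge by (simp add: field_simps)
  qed
  have range: "v x \<in> {- m..1}" if "x \<in> {-1..1}" for x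
    using vb[OF that] x3(2)[OF that] by (simp add: m_def abs_le_iff)
  \<comment> \<open>A negative c would force the derivative to vanish, because g is nonnegative on
    the range.\<close>
  have c0: "0 \<le> c"
  proof (rule ccontr)
    assume neg: "\<not> 0 \<le> c"
    have "v' x = 0" if x: "x \<in> {-1..1}" for x
    proof -
      have "c / (p - 1) * gf (R m) (v x) \<le> 0"
      proof (rule mult_nonpos_nonneg)
        show "c / (p - 1) \<le> 0" using neg p_ge by (intro divide_nonpos_pos) auto
        show "0 \<le> gf (R m) (v x)" using gf_nonneg[OF m, of "v x"] range[OF x] by auto
      qed
      then show ?thesis using first2[OF x] by (metis abs_eq_0 linorder_not_less powr_gt_zero)
    qed
    then have "v x1 = v (-1)"
      using C1_0D(3)[OF v] x1 by (intro DERIV_isconst2[OF _ C1_0D(1)[OF v]]) auto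
    then show False using vx1 C1_0D(4)[OF v] by simp
  qed
  have C: "0 \<le> c / (p - 1)" using c0 p_ge by simp
  have "L \<le> (c / (p - 1)) powr (1 / p)"
  proof (cases "m = 0")
    case True
    then have "R m = 1" by (simp add: R_def)
    show ?thesis
      by (rule L_le_nonneg[OF v _ _ C, of x1])
        (use range first2 True \<open>R m = 1\<close> x1 vx1 in auto)
  next
    case False
    interpret half_range p r m using m False by unfold_locales auto
    show ?thesis
      by (rule L_le[OF v range first2 C, of x1 x2]) (use x1 x2 vx1 in auto)
  qed
  then have "L powr p \<le> ((c / (p - 1)) powr (1 / p)) powr p"
    using L_pos p_pos by (intro powr_mono2) auto
  also have "\<dots> = c / (p - 1)" using p_ge c0 by (simp add: powr_powr)
  finally show ?thesis using p_ge by (simp add: field_simps)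
qed

text \<open>The sign is chosen so that the value of largest modulus is a positive maximum; passing
  to -w merely changes the sign of b. Failure of strict constant sign supplies the interior point
  with a nonpositive value.\<close>

theorem minimizer_without_constant_sign:
  assumes min: "is_minimizer p r \<alpha> y" and sign: "\<not> has_constant_sign y"
  shows "(p - 1) * L powr p \<le> lambda_eig p r \<alpha>"
proof -
  obtain w w' a b where w: "continuous_on {-1..1} w" "continuous_on {-1..1} w'"
    "\<And>x. x \<in> {-1<..<1} \<Longrightarrow> (w has_real_derivative w' x) (at x)"
    "w (-1) = 0" "w 1 = 0" "AE x in leb_Omega. y x = w x" "has_weak_deriv y w'"
    "\<And>x. x \<in> {-1..1} \<Longrightarrow> (p - 1) * \<bar>w' x\<bar> powr p = a + b * spow r (w x) - lambda_eig p r \<alpha> * \<bar>w x\<bar> powr p"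
    by (rule minimizer_first_integral[OF min]) (rule that; assumption)
  have C1: "C1_0 w w'" using w by (simp add: C1_0_def)
  have sgn: "\<not> (\<forall>x\<in>Omega. w x > 0)" "\<not> (\<forall>x\<in>Omega. w x < 0)"
    using sign w(1,6) unfolding has_constant_sign_def continuous_representative_def by blast+
  obtain u where u: "u \<in> {-1..1}" "\<And>x. x \<in> {-1..1} \<Longrightarrow> \<bar>w x\<bar> \<le> \<bar>w u\<bar>"
    using continuous_attains_sup[of "{-1..1}" "\<lambda>x. \<bar>w x\<bar>"] continuous_on_rabs[OF w(1)] by auto
  have nz: "w u \<noteq> 0"
  proof
    assume "w u = 0"
    then have "w x = 0" if "x \<in> {-1..1}" for x using u(2)[OF that] by simp
    then have "AE x in leb_Omega. w x = 0" by (intro AE_I2) auto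
    with w(6) have "AE x in leb_Omega. y x = 0" by eventually_elim simp
    then show False using min by (simp add: is_minimizer_def W01p_nonzero_def)
  qed
  show ?thesis
  proof (cases "0 < w u")
    case True
    then show ?thesis
      using sgn(1) extremal_bound[OF C1 True u(1) refl _ _ _ w(8)] u(2) by (auto simp: not_less)
  next
    case False
    have C1': "C1_0 (\<lambda>x. - 1 * w x) (\<lambda>x. - 1 * w' x)" by (rule C1_0_scale[OF C1])
    obtain x0 where x0: "x0 \<in> Omega" "0 \<le> w x0" using sgn(2) by (auto simp: not_less)
    show ?thesis
      by (rule extremal_bound[OF C1', of "- w u" u x0 a "- b"])
        (use False nz u x0 w(8) in \<open>auto simp: spow_minus\<close>)
  qed
qed

end

section \<open>Calibration\<close>

context exponents
begin

definition e :: real where "e = (p - 1) / p"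

lemma e_pos: "0 < e" using p_ge by (simp add: e_def)

lemma continuous_on_gf_powr: "continuous_on S (\<lambda>s. max (gf B s) 0 powr e)"
  using e_pos by (intro continuous_on_powr' continuous_on_max gf_continuous continuous_on_const) auto

text \<open>The action of one passage from - m to 1. For m in [0,1], clamping g at zero changes
  nothing on [- m, 1] and makes the integrand continuous everywhere.\<close>

definition K :: "real \<Rightarrow> real" where
  "K m = integral {- m..1} (\<lambda>s. max (gf (R m) s) 0 powr e)"

text \<open>Only the positive arc is counted: the domain is then independent of m, which permits a
  bound uniform in m.\<close>

definition J2 :: "real \<Rightarrow> real" where
  "J2 B = integral {0..1} (\<lambda>s. max (gf B s) 0 powr e * \<bar>s\<bar> powr (2 * r))"

lemma continuous_on_J2: "continuous_on S (\<lambda>s. max (gf B s) 0 powr e * \<bar>s\<bar> powr (2 * r))"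
  using r_pos by (intro continuous_on_mult continuous_on_gf_powr continuous_on_abs_powr continuous_on_id) auto

end

text \<open>Integrated form of \<open>kk_T_le\<close>. Instead of substituting in the integral, the
  difference of the two primitives is shown to be nondecreasing. The odd part of \<open>kk\<close>
  drops out and leaves A e L.\<close>

lemma (in half_range) K_lower:
  "A * (e * L) + q\<^sup>2 * (R m)\<^sup>2 * integral {- m..1} (\<lambda>s. max (gf (R m) s) 0 powr e * \<bar>s\<bar> powr (2 * r)) \<le> K m"
proof -
  define h where "h s = max (gf (R m) s) 0 powr e * (1 - q\<^sup>2 * (R m)\<^sup>2 * \<bar>s\<bar> powr (2 * r))" for s
  have hc: "continuous_on S h" for S
    unfolding h_def using r_pos
    by (intro continuous_on_mult continuous_on_gf_powr continuous_on_diff continuous_on_const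
        continuous_on_abs_powr continuous_on_id) auto
  define H where "H s = integral {- m..s} h" for s
  define Kt where "Kt t = integral {-1..t} kk" for t
  have Ktc: "continuous_on {-1..1} Kt"
    unfolding Kt_def by (rule antideriv_continuous_on[OF continuous_on_kk])
  have "H (- m) - Kt (T (- m)) \<le> H 1 - Kt (T 1)"
  proof (rule DERIV_nonneg_imp_increasing_open[where f="\<lambda>s. H s - Kt (T s)"])
    show "continuous_on {- m..1} (\<lambda>s. H s - Kt (T s))"
      unfolding H_def
      by (intro continuous_on_diff antideriv_continuous_on hc continuous_on_compose2[OF Ktc continuous_on_T])
        (use T_image in auto)
    fix s assume s: "- m < s" "s < 1"
    have dH: "(H has_real_derivative h s) (at s)"
      by (rule antideriv_has_derivative[OF hc H_def]) (use s in auto)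
    have dK: "(Kt has_real_derivative kk (T s)) (at (T s))"
      by (rule antideriv_has_derivative[OF continuous_on_kk Kt_def])
        (use abs_T_less_1[OF s] in \<open>auto simp: abs_less_iff\<close>)
    have "((\<lambda>s. H s - Kt (T s)) has_real_derivative h s - kk (T s) * T' s) (at s)"
      by (intro DERIV_diff dH DERIV_chain2[where f=Kt and g=T, OF dK] T_has_derivative) (use s in simp)
    moreover have "kk (T s) * T' s \<le> h s"
      using kk_T_le[of s] gf_pos[OF s] s by (simp add: h_def e_def)
    ultimately show "\<exists>d. ((\<lambda>s. H s - Kt (T s)) has_real_derivative d) (at s) \<and> 0 \<le> d"
      by (intro exI[of _ "h s - kk (T s) * T' s"]) auto
  qed (use m_pos in simp)
  then have "A * (e * L) \<le> integral {- m..1} h"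
    using integral_kk by (simp add: T_1 T_neg_m H_def Kt_def e_def)
  also have "integral {- m..1} h = integral {- m..1} (\<lambda>s. max (gf (R m) s) 0 powr e
      - q\<^sup>2 * (R m)\<^sup>2 * (max (gf (R m) s) 0 powr e * \<bar>s\<bar> powr (2 * r)))"
    by (intro integral_cong) (simp add: h_def algebra_simps)
  also have "\<dots> = K m - q\<^sup>2 * (R m)\<^sup>2 * integral {- m..1} (\<lambda>s. max (gf (R m) s) 0 powr e * \<bar>s\<bar> powr (2 * r))"
    unfolding K_def
    by (subst integral_diff) (auto intro!: integrable_continuous_real continuous_on_gf_powr continuous_on_J2
        continuous_on_mult continuous_on_const)
  finally show ?thesis by simp
qed

context exponents
begin

lemma K_lower_bound:
  assumes m: "0 \<le> m" "m \<le> 1"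
  shows "(1 - R m) * (e * L) + q\<^sup>2 * (R m)\<^sup>2 * J2 (R m) \<le> K m"
proof (cases "m = 0")
  case True
  have R1: "R m = 1" using True by (simp add: R_def)
  have "q\<^sup>2 * J2 1 \<le> J2 1"
  proof -
    have "0 \<le> J2 1" unfolding J2_def by (intro integral_nonneg integrable_continuous_real continuous_on_J2) auto
    moreover have "q\<^sup>2 \<le> 1" using q_ge q_le by (simp add: power_le_one)
    ultimately show ?thesis using mult_right_mono[of "q\<^sup>2" 1 "J2 1"] by simp
  qed
  also have "J2 1 \<le> K 0"
    unfolding J2_def K_def minus_zero
  proof (rule integral_le)
    fix s :: real assume s: "s \<in> {0..1}"
    have "\<bar>s\<bar> powr (2 * r) \<le> 1" using s r_pos powr_mono2[of "2 * r" "\<bar>s\<bar>" 1] by simp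
    then show "max (gf 1 s) 0 powr e * \<bar>s\<bar> powr (2 * r) \<le> max (gf (R 0) s) 0 powr e"
      using mult_left_mono[of "\<bar>s\<bar> powr (2 * r)" 1 "max (gf 1 s) 0 powr e"] R1 True by simp
  qed (auto intro!: integrable_continuous_real continuous_on_J2 continuous_on_gf_powr)
  finally show ?thesis using True R1 by simp
next
  case False
  interpret half_range p r m using m False by unfold_locales auto
  have "J2 (R m) \<le> integral {- m..1} (\<lambda>s. max (gf (R m) s) 0 powr e * \<bar>s\<bar> powr (2 * r))"
    unfolding J2_def
    by (intro integral_subset_le integrable_continuous_real continuous_on_J2) (use m in auto)
  then have "q\<^sup>2 * (R m)\<^sup>2 * J2 (R m) \<le> q\<^sup>2 * (R m)\<^sup>2 * integral {- m..1} (\<lambda>s. max (gf (R m) s) 0 powr e * \<bar>s\<bar> powr (2 * r))"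
    by (intro mult_left_mono) auto
  then show ?thesis using K_lower by (simp add: A_def)
qed

lemma J2_pos:
  assumes "0 < gf B (1 / 2)" shows "0 < J2 B"
proof -
  have c: "continuous_on {0..1} (\<lambda>s. max (gf B s) 0 powr e * \<bar>s\<bar> powr (2 * r))" by (rule continuous_on_J2)
  have "0 \<le> J2 B" unfolding J2_def by (intro integral_nonneg integrable_continuous_real c) auto
  moreover have "J2 B \<noteq> 0"
  proof
    assume "J2 B = 0"
    then have "max (gf B (1/2)) 0 powr e * \<bar>1/2\<bar> powr (2 * r) = 0"
      using integral_eq_0_iff[OF c] unfolding J2_def by auto
    then show False using assms by simp
  qed
  ultimately show ?thesis by simp
qed

text \<open>On [0,1] the function g decreases in its parameter. As R m \<le> 1, this gives a gain
  independent of m.\<close>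

lemma J2_mono:
  assumes "B \<le> 1" shows "J2 1 \<le> J2 B"
  unfolding J2_def
proof (rule integral_le)
  fix s :: real assume s: "s \<in> {0..1}"
  have "s powr r \<le> 1" using s powr_mono2[of r s 1] r_pos by simp
  then have "B * (1 - s powr r) \<le> 1 * (1 - s powr r)" using assms by (intro mult_right_mono) auto
  then have "gf 1 s \<le> gf B s" using s by (simp add: gf_def spow_nonneg algebra_simps)
  then show "max (gf 1 s) 0 powr e * \<bar>s\<bar> powr (2 * r) \<le> max (gf B s) 0 powr e * \<bar>s\<bar> powr (2 * r)"
    using e_pos by (intro mult_right_mono powr_mono2) auto
qed (auto intro!: integrable_continuous_real continuous_on_J2)

lemma young_conjugate:
  assumes "0 \<le> x" "0 \<le> y" shows "p * (x * y powr e) \<le> x powr p + (p - 1) * y"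
proof -
  have "x * y powr e \<le> x powr p / p + (y powr e) powr (p / (p - 1)) / (p / (p - 1))"
    using p_ge assms by (intro Youngs_inequality) (auto simp: field_simps)
  also have "(y powr e) powr (p / (p - 1)) = y"
    using p_ge assms by (simp add: powr_powr e_def)
  finally have "p * (x * y powr e) \<le> p * (x powr p / p + y / (p / (p - 1)))"
    using p_pos by (intro mult_left_mono) auto
  also have "\<dots> = x powr p + (p - 1) * y" using p_ge by (simp add: field_simps)
  finally show ?thesis .
qed

definition P :: real where "P = (p - 1) * L powr p"

lemma P_pos: "0 < P" using p_ge L_pos by (simp add: P_def)

text \<open>Young's inequality with y = L^p g(w) holds for every profile with range [- m, 1],
  extremal or not, and is an equality for the generalized sine. Its mixed term integrates to at
  least twice the action of one passage.\<close>

lemma calibration: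
  assumes w: "C1_0 w w'" and m: "0 \<le> m" "m \<le> 1" and range: "\<And>x. x \<in> {-1..1} \<Longrightarrow> w x \<in> {- m..1}"
    and x: "x1 \<in> {-1..1}" "w x1 = 1" "x2 \<in> {-1..1}" "w x2 = - m"
  shows "P * (integral {-1..1} (\<lambda>x. \<bar>w x\<bar> powr p) - R m * integral {-1..1} (\<lambda>x. spow r (w x)))
      + 2 * p * L powr (p - 1) * (q\<^sup>2 * (R m)\<^sup>2 * J2 (R m)) \<le> integral {-1..1} (\<lambda>x. \<bar>w' x\<bar> powr p)"
proof -
  define k where "k s = max (gf (R m) s) 0 powr e" for s
  \<comment> \<open>The base point -2 keeps the values of w in the interior of the domain, so this
    primitive is differentiable at the turning values as well.\<close>
  define G where "G s = integral {-2..s} k" for s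
  have kc: "continuous_on S k" for S unfolding k_def by (rule continuous_on_gf_powr)
  have wc: "continuous_on {-1..1} w" and w'c: "continuous_on {-1..1} w'" using C1_0D[OF w] by auto
  have Gc: "continuous_on {-2..2} G" unfolding G_def by (rule antideriv_continuous_on[OF kc])
  have kwc: "continuous_on {-1..1} (\<lambda>x. k (w x))" by (rule continuous_on_compose2[OF kc wc]) auto
  have vc: "continuous_on {-1..1} (\<lambda>x. \<bar>w' x\<bar> * k (w x))"
    by (intro continuous_intros kwc w'c)
  define V where "V x = integral {-1..x} (\<lambda>x. \<bar>w' x\<bar> * k (w x))" for x
  have Vc: "continuous_on {-1..1} V" unfolding V_def by (rule antideriv_continuous_on[OF vc])
  have w2: "w z \<in> {-2<..<2}" "w z \<in> {-2..2}" if "z \<in> {-1..1}" for z using range[OF that] m by auto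
  have GV: "\<bar>G (w v) - G (w u)\<bar> \<le> V v - V u" if u: "u \<in> {-1..1}" and v: "v \<in> {-1..1}" and uv: "u \<le> v" for u v
  proof -
    have sub: "{u..v} \<subseteq> {-1..1}" using u v by auto
    have c: "continuous_on {u..v} (\<lambda>x. G (w x))" "continuous_on {u..v} V"
      using continuous_on_subset[OF wc sub] continuous_on_subset[OF Vc sub] w2 sub
      by (auto intro!: continuous_on_compose2[OF Gc])
    have d: "((\<lambda>x. G (w x)) has_real_derivative k (w z) * w' z) (at z)"
        "(V has_real_derivative \<bar>w' z\<bar> * k (w z)) (at z)" if z: "u < z" "z < v" for z
    proof -
      have z': "z \<in> {-1<..<1}" "z \<in> {-1..1}" using z u v by auto
      have "(G has_real_derivative k (w z)) (at (w z))"
        by (rule antideriv_has_derivative[OF kc G_def w2(1)[OF z'(2)]])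
      then show "((\<lambda>x. G (w x)) has_real_derivative k (w z) * w' z) (at z)"
        by (rule DERIV_chain2[OF _ C1_0D(3)[OF w z'(1)]])
      show "(V has_real_derivative \<bar>w' z\<bar> * k (w z)) (at z)"
        by (rule antideriv_has_derivative[OF vc V_def z'(1)])
    qed
    have k0: "0 \<le> k s" for s by (simp add: k_def)
    have kw: "\<bar>k (w z) * w' z\<bar> = \<bar>w' z\<bar> * k (w z)" for z using k0[of "w z"] by (simp add: abs_mult)
    have "V u - G (w u) \<le> V v - G (w v)"
    proof (rule DERIV_nonneg_imp_increasing_open[OF uv, where f="\<lambda>a. V a - G (w a)"])
      show "\<exists>y. ((\<lambda>a. V a - G (w a)) has_real_derivative y) (at z) \<and> 0 \<le> y" if z: "u < z" "z < v" for z
        using DERIV_diff[OF d(2)[OF z] d(1)[OF z]] kw[of z] by (intro exI conjI) (assumption, linarith)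
    qed (intro continuous_intros c)
    moreover have "V u + G (w u) \<le> V v + G (w v)"
    proof (rule DERIV_nonneg_imp_increasing_open[OF uv, where f="\<lambda>a. V a + G (w a)"])
      show "\<exists>y. ((\<lambda>a. V a + G (w a)) has_real_derivative y) (at z) \<and> 0 \<le> y" if z: "u < z" "z < v" for z
        using DERIV_add[OF d(2)[OF z] d(1)[OF z]] kw[of z] by (intro exI conjI) (assumption, linarith)
    qed (intro continuous_intros c)
    ultimately show ?thesis by (simp add: abs_le_iff)
  qed
  have "2 * (G (w x1) - G (w x2)) \<le> V 1 - V (-1)"
    by (rule lipschitz_travel[where c="G 0"]) (use GV x C1_0D[OF w] in auto)
  moreover have "G 1 - G (- m) = K m"
    using Henstock_Kurzweil_Integration.integral_combine[of "-2" "- m" 1 k] integrable_continuous_real[OF kc] m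
    by (simp add: G_def K_def k_def[abs_def])
  ultimately have travel: "2 * K m \<le> integral {-1..1} (\<lambda>x. \<bar>w' x\<bar> * k (w x))"
    using x by (simp add: V_def)
  have gc: "continuous_on {-1..1} (\<lambda>x. gf (R m) (w x))"
    by (rule continuous_on_compose2[OF gf_continuous wc]) auto
  have pc: "continuous_on {-1..1} (\<lambda>x. \<bar>w' x\<bar> powr p)" "continuous_on {-1..1} (\<lambda>x. \<bar>w x\<bar> powr p)"
      "continuous_on {-1..1} (\<lambda>x. spow r (w x))"
    by (intro continuous_on_abs_powr continuous_on_spow w'c wc p_pos r_pos)+
  have "integral {-1..1} (\<lambda>x. p * L powr (p - 1) * (\<bar>w' x\<bar> * k (w x)) - P * gf (R m) (w x))
      \<le> integral {-1..1} (\<lambda>x. \<bar>w' x\<bar> powr p)"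
  proof (rule integral_le)
    show "(\<lambda>x. p * L powr (p - 1) * (\<bar>w' x\<bar> * k (w x)) - P * gf (R m) (w x)) integrable_on {-1..1}"
      by (intro integrable_continuous_real continuous_intros kwc w'c gc)
    show "(\<lambda>x. \<bar>w' x\<bar> powr p) integrable_on {-1..1}" by (intro integrable_continuous_real pc)
    fix x :: real assume x: "x \<in> {-1..1}"
    have g: "0 \<le> gf (R m) (w x)" using gf_nonneg[OF m] range[OF x] by auto
    have "(L powr p * gf (R m) (w x)) powr e = L powr (p - 1) * k (w x)"
      using g p_pos by (simp add: powr_mult powr_powr k_def e_def)
    then show "p * L powr (p - 1) * (\<bar>w' x\<bar> * k (w x)) - P * gf (R m) (w x) \<le> \<bar>w' x\<bar> powr p"
      using young_conjugate[of "\<bar>w' x\<bar>" "L powr p * gf (R m) (w x)"] g by (simp add: P_def algebra_simps)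
  qed
  also have "integral {-1..1} (\<lambda>x. p * L powr (p - 1) * (\<bar>w' x\<bar> * k (w x)) - P * gf (R m) (w x))
     = p * L powr (p - 1) * integral {-1..1} (\<lambda>x. \<bar>w' x\<bar> * k (w x)) - P * integral {-1..1} (\<lambda>x. gf (R m) (w x))"
    by (subst integral_diff) (auto intro!: integrable_continuous_real continuous_on_mult continuous_on_const vc gc)
  also have "integral {-1..1} (\<lambda>x. gf (R m) (w x))
     = 2 * (1 - R m) + R m * integral {-1..1} (\<lambda>x. spow r (w x)) - integral {-1..1} (\<lambda>x. \<bar>w x\<bar> powr p)"
  proof -
    have i: "(\<lambda>x. 1 - R m) integrable_on {-1..1::real}" "(\<lambda>x. R m * spow r (w x)) integrable_on {-1..1}"
       "(\<lambda>x. \<bar>w x\<bar> powr p) integrable_on {-1..1}"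
      by (intro integrable_continuous_real continuous_intros pc)+
    have "integral {-1..1} (\<lambda>x. gf (R m) (w x)) = integral {-1..1} (\<lambda>x. (1 - R m) + R m * spow r (w x)) - integral {-1..1} (\<lambda>x. \<bar>w x\<bar> powr p)"
      unfolding gf_def by (rule integral_diff[OF integrable_add[OF i(1,2)] i(3)])
    also have "integral {-1..1} (\<lambda>x. (1 - R m) + R m * spow r (w x)) = 2 * (1 - R m) + R m * integral {-1..1} (\<lambda>x. spow r (w x))"
      by (subst integral_add[OF i(1,2)]) simp
    finally show ?thesis .
  qed
  finally have "p * L powr (p - 1) * integral {-1..1} (\<lambda>x. \<bar>w' x\<bar> * k (w x)) \<le> integral {-1..1} (\<lambda>x. \<bar>w' x\<bar> powr p)
    + P * (2 * (1 - R m) + R m * integral {-1..1} (\<lambda>x. spow r (w x)) - integral {-1..1} (\<lambda>x. \<bar>w x\<bar> powr p))"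
    by simp
  moreover have "p * L powr (p - 1) * (2 * ((1 - R m) * (e * L) + q\<^sup>2 * (R m)\<^sup>2 * J2 (R m)))
      \<le> p * L powr (p - 1) * integral {-1..1} (\<lambda>x. \<bar>w' x\<bar> * k (w x))"
    using travel K_lower_bound[OF m] p_pos by (intro mult_left_mono) auto
  \<comment> \<open>Because p e = p - 1, the constant 2 P (1 - R) coming from the integral of g
    cancels exactly against the main term of the action. Only the gain in R^2 survives.\<close>
  moreover have "p * L powr (p - 1) * (2 * ((1 - R m) * (e * L) + X)) = P * (2 * (1 - R m)) + 2 * p * L powr (p - 1) * X" for X
  proof -
    have LL: "L powr (p - 1) * L = L powr p"
      using powr_mult_base[of L "p - 1"] L_pos by (simp add: mult.commute)
    have "p * L powr (p - 1) * (2 * ((1 - R m) * (e * L) + X)) = (p * e) * (L powr (p - 1) * L) * (2 * (1 - R m)) + 2 * p * L powr (p - 1) * X"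
      by (simp add: algebra_simps)
    also have "p * e = p - 1" using p_pos by (simp add: e_def)
    finally show ?thesis unfolding LL P_def .
  qed
  ultimately show ?thesis by (simp add: algebra_simps)
qed

end

section \<open>Saturation for large parameters\<close>

lemma continuous_on_Icc_bounded:
  fixes f :: "real \<Rightarrow> real"
  assumes "continuous_on {a..b} f" obtains B where "\<And>x. x \<in> {a..b} \<Longrightarrow> \<bar>f x\<bar> \<le> B"
proof -
  have "bounded (f ` {a..b})"
    by (rule compact_imp_bounded[OF compact_continuous_image[OF assms compact_Icc]])
  then obtain B where "\<forall>y\<in>f ` {a..b}. norm y \<le> B" by (auto simp only: bounded_iff)
  then show ?thesis using that[of B] by simp
qed

text \<open>As d tends to 0 the first coefficient tends to 1, so the Dirichlet term passes to the
  limit without losing a constant.\<close>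

lemma abs_add_powr_le_weighted:
  fixes a b :: real
  assumes p: "0 \<le> p" and d: "0 < d"
  shows "\<bar>a + b\<bar> powr p \<le> (1 + d) powr p * \<bar>a\<bar> powr p + (1 + 1 / d) powr p * \<bar>b\<bar> powr p"
proof (cases "\<bar>b\<bar> \<le> d * \<bar>a\<bar>")
  case True
  have "\<bar>a + b\<bar> powr p \<le> ((1 + d) * \<bar>a\<bar>) powr p"
    using True p by (intro powr_mono2) (auto simp: algebra_simps)
  also have "\<dots> = (1 + d) powr p * \<bar>a\<bar> powr p" using d by (simp add: powr_mult)
  finally show ?thesis by (simp add: add_increasing2)
next
  case False
  then have "\<bar>a\<bar> \<le> \<bar>b\<bar> / d" using d by (simp add: field_simps)
  then have "\<bar>a + b\<bar> powr p \<le> ((1 + 1 / d) * \<bar>b\<bar>) powr p"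
    using p by (intro powr_mono2) (auto simp: algebra_simps)
  also have "\<dots> = (1 + 1 / d) powr p * \<bar>b\<bar> powr p" using d by (simp add: powr_mult)
  finally show ?thesis by (simp add: add_increasing)
qed

context exponents
begin

lemma C1_0_normalize:
  assumes w: "C1_0 w w'" and nz: "\<exists>x\<in>{-1..1}. w x \<noteq> 0"
  obtains x1 M where "M \<noteq> 0" "x1 \<in> {-1..1}" "w x1 = M" "\<And>x. x \<in> {-1..1} \<Longrightarrow> \<bar>w x\<bar> \<le> \<bar>M\<bar>"
proof -
  obtain u where u: "u \<in> {-1..1}" "\<And>x. x \<in> {-1..1} \<Longrightarrow> \<bar>w x\<bar> \<le> \<bar>w u\<bar>"
    using continuous_attains_sup[of "{-1..1}" "\<lambda>x. \<bar>w x\<bar>"] continuous_on_rabs[OF C1_0D(1)[OF w]] by auto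
  moreover have "w u \<noteq> 0" using nz u(2) by force
  ultimately show ?thesis using that by blast
qed

lemma C1_0_min:
  assumes v: "C1_0 v v'" and b: "\<And>x. x \<in> {-1..1} \<Longrightarrow> \<bar>v x\<bar> \<le> 1"
  obtains m x2 where "0 \<le> m" "m \<le> 1" "x2 \<in> {-1..1}" "v x2 = - m" "\<And>x. x \<in> {-1..1} \<Longrightarrow> v x \<in> {- m..1}"
proof -
  obtain x2 where x2: "x2 \<in> {-1..1}" "\<And>x. x \<in> {-1..1} \<Longrightarrow> v x2 \<le> v x"
    using continuous_attains_inf[OF _ _ C1_0D(1)[OF v]] by auto
  show ?thesis
  proof (rule that[of "- v x2" x2])
    show "0 \<le> - v x2" using x2(2)[of 1] C1_0D(5)[OF v] by simp
    show "- v x2 \<le> 1" using b[OF x2(1)] by simp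
    show "v x \<in> {- (- v x2)..1}" if "x \<in> {-1..1}" for x
      using x2(2)[OF that] b[OF that] by (simp add: abs_le_iff)
  qed (use x2 in auto)
qed

lemma abs_moment_le_2:
  fixes v :: "real \<Rightarrow> real"
  assumes v: "continuous_on {-1..1} v" and b: "\<And>x. x \<in> {-1..1} \<Longrightarrow> \<bar>v x\<bar> \<le> 1"
  shows "\<bar>integral {-1..1} (\<lambda>x. spow r (v x))\<bar> \<le> 2"
proof -
  have "norm (integral {-1..1} (\<lambda>x. spow r (v x))) \<le> integral {-1..1} (\<lambda>x::real. 1::real)"
  proof (rule Henstock_Kurzweil_Integration.integral_norm_bound_integral)
    show "(\<lambda>x. spow r (v x)) integrable_on {-1..1}"
      by (intro integrable_continuous_real continuous_on_spow r_pos v)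
    show "norm (spow r (v x)) \<le> 1" if "x \<in> {-1..1}" for x
      using powr_mono2[of r "\<bar>v x\<bar>" 1] b[OF that] r_pos by (simp add: abs_spow)
  qed auto
  then show ?thesis by simp
qed

text \<open>The loss P R J is linear in R and in the moment J. For r < p the gain c R^2 absorbs R
  and leaves a multiple of J^2. For r = p the uniform gain degenerates, since \<open>gf 1\<close>
  vanishes on [0,1], but there p / r = 1 and \<alpha> = P absorbs the loss directly.\<close>

lemma normalized_large_alpha:
  "\<exists>\<alpha>\<ge>0. \<forall>v v' x1. C1_0 v v' \<longrightarrow> (\<forall>x\<in>{-1..1}. \<bar>v x\<bar> \<le> 1) \<longrightarrow> x1 \<in> {-1..1} \<longrightarrow> v x1 = 1 \<longrightarrow>
     P * integral {-1..1} (\<lambda>x. \<bar>v x\<bar> powr p) \<le> integral {-1..1} (\<lambda>x. \<bar>v' x\<bar> powr p)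
       + \<alpha> * \<bar>integral {-1..1} (\<lambda>x. spow r (v x))\<bar> powr (p / r)"
proof (cases "r = p")
  case True
  show ?thesis
  proof (intro exI[of _ P] conjI allI impI)
    fix v v' x1 assume v: "C1_0 v v'" and b: "\<forall>x\<in>{-1..1}. \<bar>v x\<bar> \<le> 1" and x1: "x1 \<in> {-1..1}" "v x1 = 1"
    obtain m x2 where m: "0 \<le> m" "m \<le> 1" "x2 \<in> {-1..1}" "v x2 = - m" "\<And>x. x \<in> {-1..1} \<Longrightarrow> v x \<in> {- m..1}"
      using C1_0_min[OF v] b by blast
    define J where "J = integral {-1..1} (\<lambda>x. spow r (v x))"
    define X where "X = 2 * p * L powr (p - 1) * (q\<^sup>2 * (R m)\<^sup>2 * J2 (R m))"
    have "0 \<le> J2 (R m)"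
      unfolding J2_def by (intro integral_nonneg integrable_continuous_real continuous_on_J2) auto
    then have X: "0 \<le> X" using p_pos by (simp add: X_def)
    have "P * (R m * J) \<le> P * \<bar>J\<bar>"
    proof (intro mult_left_mono)
      have "R m * J \<le> R m * \<bar>J\<bar>" using R_bounds[OF m(1,2)] by (intro mult_left_mono) auto
      also have "\<dots> \<le> 1 * \<bar>J\<bar>" using R_bounds[OF m(1,2)] by (intro mult_right_mono) auto
      finally show "R m * J \<le> \<bar>J\<bar>" by simp
    qed (use P_pos in simp)
    moreover have "\<bar>J\<bar> powr (p / r) = \<bar>J\<bar>" using True p_pos by simp
    ultimately show "P * integral {-1..1} (\<lambda>x. \<bar>v x\<bar> powr p) \<le> integral {-1..1} (\<lambda>x. \<bar>v' x\<bar> powr p)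
       + P * \<bar>integral {-1..1} (\<lambda>x. spow r (v x))\<bar> powr (p / r)"
      using calibration[OF v m(1,2,5) x1 m(3,4)] X unfolding J_def[symmetric] X_def[symmetric]
      by (simp add: algebra_simps)
  qed (use P_pos in simp)
next
  case False
  define c where "c = 2 * p * L powr (p - 1) * (q\<^sup>2 * J2 1)"
  have "0 < gf 1 (1 / 2)"
  proof -
    have "(1 / 2 :: real) powr p < (1 / 2) powr r"
      using False r_le by (simp add: powr_divide frac_less2)
    then show ?thesis by (simp add: gf_def spow_nonneg)
  qed
  then have "0 < J2 1" by (rule J2_pos)
  then have c: "0 < c" using p_pos L_pos q_ge by (simp add: c_def)
  show ?thesis
  proof (intro exI[of _ "P\<^sup>2 / c"] conjI allI impI)
    fix v v' x1 assume v: "C1_0 v v'" and b: "\<forall>x\<in>{-1..1}. \<bar>v x\<bar> \<le> 1" and x1: "x1 \<in> {-1..1}" "v x1 = 1"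
    obtain m x2 where m: "0 \<le> m" "m \<le> 1" "x2 \<in> {-1..1}" "v x2 = - m" "\<And>x. x \<in> {-1..1} \<Longrightarrow> v x \<in> {- m..1}"
      using C1_0_min[OF v] b by blast
    define J where "J = integral {-1..1} (\<lambda>x. spow r (v x))"
    have J: "\<bar>J\<bar> \<le> 2" unfolding J_def using abs_moment_le_2[OF C1_0D(1)[OF v]] b by blast
    have \<gamma>: "1 \<le> p / r" "p / r \<le> 2" using p_div_r_ge_1 r_ge r_pos by (auto simp: field_simps)
    have "J2 1 \<le> J2 (R m)" by (rule J2_mono) (use R_bounds[OF m(1,2)] in simp)
    then have X: "c * (R m)\<^sup>2 \<le> 2 * p * L powr (p - 1) * (q\<^sup>2 * (R m)\<^sup>2 * J2 (R m))"
      using p_pos mult_left_mono[of "J2 1" "J2 (R m)" "2 * p * L powr (p - 1) * q\<^sup>2 * (R m)\<^sup>2"]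
      by (simp add: c_def algebra_simps)
    \<comment> \<open>The normalization gives |J| \<le> 2, and p / r \<le> 2, so the surplus power
      |J|^(2 - p/r) is at most 4.\<close>
    have JJ: "J\<^sup>2 \<le> 4 * \<bar>J\<bar> powr (p / r)"
    proof (cases "J = 0")
      case False
      have "J\<^sup>2 = \<bar>J\<bar> powr 2" using False by (simp add: powr_numeral[symmetric])
      also have "\<dots> = \<bar>J\<bar> powr (2 - p / r) * \<bar>J\<bar> powr (p / r)" by (simp add: powr_add[symmetric])
      also have "\<dots> \<le> 4 * \<bar>J\<bar> powr (p / r)"
      proof (intro mult_right_mono)
        have "\<bar>J\<bar> powr (2 - p / r) \<le> 2 powr (2 - p / r)" using J \<gamma> by (intro powr_mono2) auto
        also have "\<dots> \<le> 2 powr 2" using \<gamma> by (intro powr_mono) auto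
        finally show "\<bar>J\<bar> powr (2 - p / r) \<le> 4" by simp
      qed simp
      finally show ?thesis .
    qed simp
    \<comment> \<open>Over all R the expression c R^2 - P R J is at least - P^2 J^2 / (4c). Together
      with the bound on J^2 this is the origin of \<alpha> = P^2 / c.\<close>
    have "0 \<le> c * (R m - P * J / (2 * c))\<^sup>2" using c by simp
    also have "\<dots> = c * (R m)\<^sup>2 - P * (R m * J) + P\<^sup>2 / c * (J\<^sup>2 / 4)"
      using c by (simp add: power2_eq_square field_simps)
    also have "\<dots> \<le> c * (R m)\<^sup>2 - P * (R m * J) + P\<^sup>2 / c * \<bar>J\<bar> powr (p / r)"
      using JJ c mult_left_mono[of "J\<^sup>2 / 4" "\<bar>J\<bar> powr (p / r)" "P\<^sup>2 / c"] by simp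
    finally have "P * (R m * J) \<le> c * (R m)\<^sup>2 + P\<^sup>2 / c * \<bar>J\<bar> powr (p / r)" by simp
    moreover have "P * (integral {-1..1} (\<lambda>x. \<bar>v x\<bar> powr p) - R m * J)
        = P * integral {-1..1} (\<lambda>x. \<bar>v x\<bar> powr p) - P * (R m * J)" by (simp add: algebra_simps)
    ultimately show "P * integral {-1..1} (\<lambda>x. \<bar>v x\<bar> powr p) \<le> integral {-1..1} (\<lambda>x. \<bar>v' x\<bar> powr p)
       + P\<^sup>2 / c * \<bar>integral {-1..1} (\<lambda>x. spow r (v x))\<bar> powr (p / r)"
      using calibration[OF v m(1,2,5) x1 m(3,4)] X unfolding J_def[symmetric] by linarith
  qed (use c in simp)
qed

text \<open>All three terms are homogeneous of degree p. Division by the signed value M of largest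
  modulus places that value at +1.\<close>

lemma C1_0_large_alpha:
  "\<exists>\<alpha>\<ge>0. \<forall>w w'. C1_0 w w' \<longrightarrow>
     P * integral {-1..1} (\<lambda>x. \<bar>w x\<bar> powr p) \<le> integral {-1..1} (\<lambda>x. \<bar>w' x\<bar> powr p)
       + \<alpha> * \<bar>integral {-1..1} (\<lambda>x. spow r (w x))\<bar> powr (p / r)"
proof -
  obtain \<alpha> where \<alpha>: "0 \<le> \<alpha>" "\<forall>v v' x1. C1_0 v v' \<longrightarrow> (\<forall>x\<in>{-1..1}. \<bar>v x\<bar> \<le> 1) \<longrightarrow> x1 \<in> {-1..1} \<longrightarrow> v x1 = 1 \<longrightarrow>
     P * integral {-1..1} (\<lambda>x. \<bar>v x\<bar> powr p) \<le> integral {-1..1} (\<lambda>x. \<bar>v' x\<bar> powr p)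
       + \<alpha> * \<bar>integral {-1..1} (\<lambda>x. spow r (v x))\<bar> powr (p / r)"
    using normalized_large_alpha by blast
  show ?thesis
  proof (intro exI[of _ \<alpha>] conjI allI impI \<alpha>(1))
    fix w w' assume w: "C1_0 w w'"
    show "P * integral {-1..1} (\<lambda>x. \<bar>w x\<bar> powr p) \<le> integral {-1..1} (\<lambda>x. \<bar>w' x\<bar> powr p)
       + \<alpha> * \<bar>integral {-1..1} (\<lambda>x. spow r (w x))\<bar> powr (p / r)"
    proof (cases "\<exists>x\<in>{-1..1}. w x \<noteq> 0")
      case False
      then have "integral {-1..1} (\<lambda>x. \<bar>w x\<bar> powr p) = integral {-1..1} (\<lambda>x::real. 0)"
        by (intro integral_cong) auto
      moreover have "0 \<le> integral {-1..1} (\<lambda>x. \<bar>w' x\<bar> powr p)"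
        by (intro integral_nonneg integrable_continuous_real continuous_on_abs_powr C1_0D(2)[OF w] p_pos) auto
      ultimately show ?thesis using \<alpha>(1) by simp
    next
      case True
      obtain x1 M where M: "M \<noteq> 0" "x1 \<in> {-1..1}" "w x1 = M" "\<And>x. x \<in> {-1..1} \<Longrightarrow> \<bar>w x\<bar> \<le> \<bar>M\<bar>"
        using C1_0_normalize[OF w True] by metis
      define v where "v x = (1 / M) * w x" for x
      define v' where "v' x = (1 / M) * w' x" for x
      have v: "C1_0 v v'" using C1_0_scale[OF w, of "1 / M"] by (simp add: v_def[abs_def] v'_def[abs_def])
      have "\<bar>v x\<bar> \<le> 1" if "x \<in> {-1..1}" for x using M(1) M(4)[OF that] by (simp add: v_def abs_mult)
      then have main: "P * integral {-1..1} (\<lambda>x. \<bar>v x\<bar> powr p) \<le> integral {-1..1} (\<lambda>x. \<bar>v' x\<bar> powr p)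
       + \<alpha> * \<bar>integral {-1..1} (\<lambda>x. spow r (v x))\<bar> powr (p / r)"
        using \<alpha>(2)[rule_format, OF v _ M(2)] M by (simp add: v_def)
      have wv: "w x = M * v x" "w' x = M * v' x" for x using M(1) by (simp_all add: v_def v'_def)
      have "\<bar>M\<bar> powr p * (P * integral {-1..1} (\<lambda>x. \<bar>v x\<bar> powr p)) \<le> \<bar>M\<bar> powr p * (integral {-1..1} (\<lambda>x. \<bar>v' x\<bar> powr p)
       + \<alpha> * \<bar>integral {-1..1} (\<lambda>x. spow r (v x))\<bar> powr (p / r))"
        by (rule mult_left_mono[OF main]) simp
      moreover have "integral {-1..1} (\<lambda>x. \<bar>w x\<bar> powr p) = \<bar>M\<bar> powr p * integral {-1..1} (\<lambda>x. \<bar>v x\<bar> powr p)"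
        "integral {-1..1} (\<lambda>x. \<bar>w' x\<bar> powr p) = \<bar>M\<bar> powr p * integral {-1..1} (\<lambda>x. \<bar>v' x\<bar> powr p)"
        unfolding wv abs_mult by (simp_all add: powr_mult)
      moreover have "\<bar>integral {-1..1} (\<lambda>x. spow r (w x))\<bar> powr (p / r)
         = \<bar>M\<bar> powr p * \<bar>integral {-1..1} (\<lambda>x. spow r (v x))\<bar> powr (p / r)"
      proof -
        have "integral {-1..1} (\<lambda>x. spow r (w x)) = spow r M * integral {-1..1} (\<lambda>x. spow r (v x))"
          unfolding wv spow_mult by simp
        then show ?thesis using r_pos by (simp add: abs_mult abs_spow powr_mult powr_powr)
      qed
      ultimately show ?thesis by (simp add: algebra_simps)
    qed
  qed
qed

section \<open>Density: from test functions to the Sobolev space\<close>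

lemma C1_0_test: "test_function \<phi> \<Longrightarrow> C1_0 \<phi> (deriv \<phi>)"
  using test_function_boundary[of \<phi>] unfolding C1_0_def
  by (auto intro: test_function_continuous_on test_function_deriv test_function_has_deriv)

lemma integral_tendsto_uniform:
  fixes \<psi> w :: "real \<Rightarrow> real" and \<phi> :: "nat \<Rightarrow> real \<Rightarrow> real"
  assumes \<psi>: "continuous_on UNIV \<psi>" and w: "continuous_on {-1..1} w"
    and \<phi>: "\<And>n. continuous_on {-1..1} (\<phi> n)" and d: "d \<longlonglongrightarrow> 0"
    and unif: "\<And>n x. x \<in> {-1..1} \<Longrightarrow> \<bar>\<phi> n x - w x\<bar> \<le> d n"
  shows "(\<lambda>n. integral {-1..1} (\<lambda>x. \<psi> (\<phi> n x))) \<longlonglongrightarrow> integral {-1..1} (\<lambda>x. \<psi> (w x))"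
proof -
  obtain E where E: "\<And>n. \<bar>d n\<bar> \<le> E"
    using convergent_imp_Bseq[OF convergentI[OF d]] by (auto simp: Bseq_def)
  obtain W where W: "\<And>x. x \<in> {-1..1} \<Longrightarrow> \<bar>w x\<bar> \<le> W"
    by (rule continuous_on_Icc_bounded[OF w]) (rule that)
  have "continuous_on {- (W + E)..W + E} \<psi>" by (rule continuous_on_subset[OF \<psi>]) auto
  then obtain B where B: "\<And>s. s \<in> {- (W + E)..W + E} \<Longrightarrow> \<bar>\<psi> s\<bar> \<le> B"
    by (rule continuous_on_Icc_bounded) (rule that)
  have c: "continuous_on {-1..1} (\<lambda>x. \<psi> (\<phi> n x))" "continuous_on {-1..1} (\<lambda>x. \<psi> (w x))" for n
    using continuous_on_compose2[OF \<psi> \<phi>] continuous_on_compose2[OF \<psi> w] by simp_all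
  have "(\<lambda>n. LINT x|leb_Omega. \<psi> (\<phi> n x)) \<longlonglongrightarrow> (LINT x|leb_Omega. \<psi> (w x))"
  proof (rule integral_dominated_convergence[where w="\<lambda>x. B"])
    show "(\<lambda>x. \<psi> (w x)) \<in> borel_measurable leb_Omega" "(\<lambda>x. \<psi> (\<phi> n x)) \<in> borel_measurable leb_Omega" for n
      using lebesgue_on_Omega_continuous(1)[OF c(1)] lebesgue_on_Omega_continuous(1)[OF c(2)] by blast+
    show "AE x in leb_Omega. (\<lambda>n. \<psi> (\<phi> n x)) \<longlonglongrightarrow> \<psi> (w x)"
    proof (intro AE_I2)
      fix x assume "x \<in> space leb_Omega"
      then have lim: "(\<lambda>n. \<phi> n x) \<longlonglongrightarrow> w x"
        by (intro LIM_zero_cancel[OF Lim_null_comparison[OF _ d]]) (use unif[of x] in auto)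
      have "isCont \<psi> (w x)" using \<psi> by (simp add: continuous_on_eq_continuous_at)
      then show "(\<lambda>n. \<psi> (\<phi> n x)) \<longlonglongrightarrow> \<psi> (w x)" by (rule isCont_tendsto_compose[OF _ lim])
    qed
    show "AE x in leb_Omega. norm (\<psi> (\<phi> n x)) \<le> B" for n
    proof (intro AE_I2)
      fix x assume "x \<in> space leb_Omega"
      then have "\<bar>\<phi> n x\<bar> \<le> W + E" using unif[of x n] W[of x] E[of n] by auto
      then show "norm (\<psi> (\<phi> n x)) \<le> B" using B[of "\<phi> n x"] by (simp add: abs_le_iff)
    qed
  qed (rule integrable_const_Omega)
  then show ?thesis
    by (simp only: lebesgue_on_Omega_continuous(2)[OF c(1)] lebesgue_on_Omega_continuous(2)[OF c(2)])
qed

lemma mass_representative: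
  assumes u: "u \<in> Lp p" and w: "continuous_on {-1..1} w" and ae: "AE x in leb_Omega. u x = w x"
  shows "mass u = integral {-1..1} (\<lambda>x. \<bar>w x\<bar> powr p)" "moment u = integral {-1..1} (\<lambda>x. spow r (w x))"
proof -
  have 0: "(\<lambda>x. 0) \<in> borel_measurable leb_Omega" by simp
  show "mass u = integral {-1..1} (\<lambda>x. \<bar>w x\<bar> powr p)"
    using integral_cong_AE_representative[OF LpD(1)[OF u] w ae 0 measurable_abs_powr[of p], where e=0]
      lebesgue_on_Omega_continuous(2)[OF continuous_on_abs_powr[OF w p_pos]] by (simp add: mass_def)
  show "moment u = integral {-1..1} (\<lambda>x. spow r (w x))"
    using integral_cong_AE_representative[OF LpD(1)[OF u] w ae 0 measurable_spow'[of r], where e=0]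
      lebesgue_on_Omega_continuous(2)[OF continuous_on_spow[OF r_pos w]] by (simp add: moment_def)
qed

text \<open>Test functions satisfy the inequality and approximate u uniformly, so mass and moment
  converge. Their Dirichlet terms need only an upper bound, (1 + \<delta>)^p times that of u plus a
  vanishing error, with \<delta> tending to 0 at the end.\<close>

theorem large_alpha:
  "\<exists>\<alpha>\<ge>0. \<forall>u\<in>W01p p. P * mass u \<le> dirichlet u + \<alpha> * \<bar>moment u\<bar> powr (p / r)"
proof -
  obtain \<alpha> where \<alpha>: "0 \<le> \<alpha>" "\<And>w w'. C1_0 w w' \<Longrightarrow>
     P * integral {-1..1} (\<lambda>x. \<bar>w x\<bar> powr p) \<le> integral {-1..1} (\<lambda>x. \<bar>w' x\<bar> powr p)
       + \<alpha> * \<bar>integral {-1..1} (\<lambda>x. spow r (w x))\<bar> powr (p / r)"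
    using C1_0_large_alpha by blast
  show ?thesis
  proof (intro exI[of _ \<alpha>] conjI ballI \<alpha>(1))
    fix u assume u: "u \<in> W01p p"
    obtain w g \<phi> d where w: "continuous_on {-1..1} w" "g \<in> Lp p" "has_weak_deriv u g"
      "AE x in leb_Omega. u x = w x" "\<And>x. x \<in> {-1..1} \<Longrightarrow> w x = integral {-1..x} g" "w (-1) = 0" "w 1 = 0"
      "\<And>n. test_function (\<phi> n)" "(\<lambda>n. LINT x|leb_Omega. \<bar>deriv (\<phi> n) x - g x\<bar> powr p) \<longlonglongrightarrow> 0"
      "d \<longlonglongrightarrow> 0" "\<And>n x. x \<in> {-1..1} \<Longrightarrow> \<bar>\<phi> n x - w x\<bar> \<le> d n"
      by (rule W01p_representative[OF u p_ge_1]) (rule that; assumption)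
    have \<phi>c: "continuous_on {-1..1} (\<phi> n)" for n by (rule test_function_continuous_on[OF w(8)])
    have Nlim: "(\<lambda>n. integral {-1..1} (\<lambda>x. \<bar>\<phi> n x\<bar> powr p)) \<longlonglongrightarrow> mass u"
      unfolding mass_representative[OF W01p_Lp[OF u] w(1,4)]
      by (rule integral_tendsto_uniform[OF _ w(1) \<phi>c w(10,11)]) (intro continuous_on_abs_powr continuous_on_id p_pos)
    have Jlim: "(\<lambda>n. integral {-1..1} (\<lambda>x. spow r (\<phi> n x))) \<longlonglongrightarrow> moment u"
      unfolding mass_representative[OF W01p_Lp[OF u] w(1,4)]
      by (rule integral_tendsto_uniform[OF _ w(1) \<phi>c w(10,11)]) (intro continuous_on_spow continuous_on_id r_pos)
    have Jlim': "(\<lambda>n. \<bar>integral {-1..1} (\<lambda>x. spow r (\<phi> n x))\<bar> powr (p / r)) \<longlonglongrightarrow> \<bar>moment u\<bar> powr (p / r)"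
      using p_div_r_ge_1 by (intro tendsto_powr' tendsto_rabs Jlim tendsto_const) auto
    define b where "b n = (LINT x|leb_Omega. \<bar>deriv (\<phi> n) x - g x\<bar> powr p)" for n
    have D: "integral {-1..1} (\<lambda>x. \<bar>deriv (\<phi> n) x\<bar> powr p) \<le> (1 + \<delta>) powr p * dirichlet u + (1 + 1 / \<delta>) powr p * b n"
      if \<delta>: "0 < \<delta>" for \<delta> n
    proof -
      have dc: "continuous_on {-1..1} (deriv (\<phi> n))" by (rule test_function_continuous_on[OF test_function_deriv[OF w(8)]])
      have dL: "(\<lambda>x. deriv (\<phi> n) x - g x) \<in> Lp p"
        using Lp_lin[OF Lp_continuous[OF dc p_pos] w(2), of "- 1"] p_pos by simp
      have "integral {-1..1} (\<lambda>x. \<bar>deriv (\<phi> n) x\<bar> powr p) = (LINT x|leb_Omega. \<bar>deriv (\<phi> n) x\<bar> powr p)"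
        using lebesgue_on_Omega_continuous(2)[OF continuous_on_abs_powr[OF dc p_pos]] by simp
      also have "\<dots> \<le> (LINT x|leb_Omega. (1 + \<delta>) powr p * \<bar>g x\<bar> powr p + (1 + 1 / \<delta>) powr p * \<bar>deriv (\<phi> n) x - g x\<bar> powr p)"
      proof (rule integral_mono)
        show "integrable leb_Omega (\<lambda>x. \<bar>deriv (\<phi> n) x\<bar> powr p)" by (rule LpD(2)[OF Lp_continuous[OF dc p_pos]])
        show "integrable leb_Omega (\<lambda>x. (1 + \<delta>) powr p * \<bar>g x\<bar> powr p + (1 + 1 / \<delta>) powr p * \<bar>deriv (\<phi> n) x - g x\<bar> powr p)"
          using LpD(2)[OF w(2)] LpD(2)[OF dL] by simp
        show "\<bar>deriv (\<phi> n) x\<bar> powr p \<le> (1 + \<delta>) powr p * \<bar>g x\<bar> powr p + (1 + 1 / \<delta>) powr p * \<bar>deriv (\<phi> n) x - g x\<bar> powr p" for x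
          using abs_add_powr_le_weighted[of p \<delta> "g x" "deriv (\<phi> n) x - g x"] p_pos \<delta> by simp
      qed
      also have "\<dots> = (1 + \<delta>) powr p * dirichlet u + (1 + 1 / \<delta>) powr p * b n"
        using LpD(2)[OF w(2)] LpD(2)[OF dL] by (simp add: dirichlet_def integral_weak_deriv_powr[OF w(3)] b_def)
      finally show ?thesis .
    qed
    have step: "P * mass u \<le> (1 + \<delta>) powr p * dirichlet u + \<alpha> * \<bar>moment u\<bar> powr (p / r)" if \<delta>: "0 < \<delta>" for \<delta>
    proof (rule LIMSEQ_le)
      show "(\<lambda>n. P * integral {-1..1} (\<lambda>x. \<bar>\<phi> n x\<bar> powr p)) \<longlonglongrightarrow> P * mass u"
        by (intro tendsto_intros Nlim)
      have "(\<lambda>n. (1 + \<delta>) powr p * dirichlet u + (1 + 1 / \<delta>) powr p * b n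
           + \<alpha> * \<bar>integral {-1..1} (\<lambda>x. spow r (\<phi> n x))\<bar> powr (p / r))
         \<longlonglongrightarrow> (1 + \<delta>) powr p * dirichlet u + (1 + 1 / \<delta>) powr p * 0 + \<alpha> * \<bar>moment u\<bar> powr (p / r)"
        unfolding b_def by (intro tendsto_add tendsto_mult tendsto_const w(9) Jlim')
      then show "(\<lambda>n. (1 + \<delta>) powr p * dirichlet u + (1 + 1 / \<delta>) powr p * b n
           + \<alpha> * \<bar>integral {-1..1} (\<lambda>x. spow r (\<phi> n x))\<bar> powr (p / r))
         \<longlonglongrightarrow> (1 + \<delta>) powr p * dirichlet u + \<alpha> * \<bar>moment u\<bar> powr (p / r)" by simp
      show "\<exists>N. \<forall>n\<ge>N. P * integral {-1..1} (\<lambda>x. \<bar>\<phi> n x\<bar> powr p)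
         \<le> (1 + \<delta>) powr p * dirichlet u + (1 + 1 / \<delta>) powr p * b n + \<alpha> * \<bar>integral {-1..1} (\<lambda>x. spow r (\<phi> n x))\<bar> powr (p / r)"
      proof (intro exI allI impI)
        fix n show "P * integral {-1..1} (\<lambda>x. \<bar>\<phi> n x\<bar> powr p)
         \<le> (1 + \<delta>) powr p * dirichlet u + (1 + 1 / \<delta>) powr p * b n + \<alpha> * \<bar>integral {-1..1} (\<lambda>x. spow r (\<phi> n x))\<bar> powr (p / r)"
          using \<alpha>(2)[OF C1_0_test[OF w(8)[of n]]] D[OF \<delta>, of n] by linarith
      qed
    qed
    show "P * mass u \<le> dirichlet u + \<alpha> * \<bar>moment u\<bar> powr (p / r)"
    proof (rule LIMSEQ_le_const)
      have "(\<lambda>n. (1 + inverse (real (Suc n))) powr p * dirichlet u + \<alpha> * \<bar>moment u\<bar> powr (p / r))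
        \<longlonglongrightarrow> (1 + 0) powr p * dirichlet u + \<alpha> * \<bar>moment u\<bar> powr (p / r)"
        by (intro tendsto_add tendsto_mult tendsto_powr tendsto_const LIMSEQ_inverse_real_of_nat) simp
      then show "(\<lambda>n. (1 + inverse (real (Suc n))) powr p * dirichlet u + \<alpha> * \<bar>moment u\<bar> powr (p / r))
        \<longlonglongrightarrow> dirichlet u + \<alpha> * \<bar>moment u\<bar> powr (p / r)" by simp
      show "\<exists>N. \<forall>n\<ge>N. P * mass u \<le> (1 + inverse (real (Suc n))) powr p * dirichlet u + \<alpha> * \<bar>moment u\<bar> powr (p / r)"
        by (intro exI allI impI step) simp
    qed
  qed
qed

text \<open>With zero moment the calibration has no loss, so its gain must vanish: R m = 0, hence m
  = 1. A minimum equal to zero is excluded because a nonnegative profile of zero moment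
  vanishes.\<close>

lemma zero_moment_symmetric_range:
  assumes v: "C1_0 v v'" and b: "\<And>x. x \<in> {-1..1} \<Longrightarrow> \<bar>v x\<bar> \<le> 1" and x1: "x1 \<in> {-1..1}" "v x1 = 1"
    and J: "integral {-1..1} (\<lambda>x. spow r (v x)) = 0"
    and D: "integral {-1..1} (\<lambda>x. \<bar>v' x\<bar> powr p) \<le> P * integral {-1..1} (\<lambda>x. \<bar>v x\<bar> powr p)"
  shows "\<exists>x2\<in>{-1..1}. v x2 = - 1"
proof -
  obtain m x2 where m: "0 \<le> m" "m \<le> 1" "x2 \<in> {-1..1}" "v x2 = - m" "\<And>x. x \<in> {-1..1} \<Longrightarrow> v x \<in> {- m..1}"
    using C1_0_min[OF v b] by blast
  have "m \<noteq> 0"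
  proof
    assume "m = 0"
    then have "\<forall>x\<in>{-1..1}. spow r (v x) = 0"
      using J m(5) integral_eq_0_iff[OF continuous_on_spow[OF r_pos C1_0D(1)[OF v]]]
      by (auto simp: spow_nonneg_iff)
    then have "spow r (v x1) = 0" using x1(1) by blast
    then show False using x1 by simp
  qed
  then interpret half_range p r m using m by unfold_locales auto
  have "0 < J2 (R m)" by (intro J2_pos gf_pos) (use m_pos in auto)
  have "P * (integral {-1..1} (\<lambda>x. \<bar>v x\<bar> powr p) - R m * 0) = P * integral {-1..1} (\<lambda>x. \<bar>v x\<bar> powr p)" by simp
  then have "2 * p * L powr (p - 1) * (q\<^sup>2 * (R m)\<^sup>2 * J2 (R m)) \<le> 0"
    using calibration[OF v m(1,2,5) x1 m(3,4)] D unfolding J by linarith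
  moreover have "0 < 2 * p * L powr (p - 1) * q\<^sup>2 * J2 (R m)"
    using p_pos L_pos q_ge \<open>0 < J2 (R m)\<close> by simp
  moreover have "2 * p * L powr (p - 1) * (q\<^sup>2 * (R m)\<^sup>2 * J2 (R m)) = (2 * p * L powr (p - 1) * q\<^sup>2 * J2 (R m)) * (R m)\<^sup>2"
    by simp
  ultimately have "(R m)\<^sup>2 \<le> 0" by (metis linorder_not_less mult_pos_pos)
  then have "m = 1" using R_eq_0 m by simp
  then show ?thesis using m by auto
qed

end

section \<open>The generalized sine\<close>

context exponents
begin

text \<open>Up to the shift by L/2, the generalized arcsine of amplitude 1.\<close>

definition F :: "real \<Rightarrow> real" where "F s = integral {-1..s} \<rho>"

lemma F_values: "F (-1) = 0" "F 0 = L / 2" "F 1 = L"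
  by (simp_all add: F_def integral_\<rho>_half L_def)

lemma continuous_on_F: "continuous_on {-1..1} F"
  unfolding F_def[abs_def] by (rule indefinite_integral_continuous_1[OF \<rho>_integrable])

lemma F_has_derivative: "s \<in> {-1<..<1} \<Longrightarrow> (F has_real_derivative \<rho> s) (at s)"
  unfolding F_def[abs_def] by (rule singular_antiderivative[OF continuous_on_\<rho> \<rho>_integrable])

lemma F_strict_mono:
  assumes "s \<in> {-1..1}" "t \<in> {-1..1}" "s < t" shows "F s < F t"
proof (rule DERIV_pos_imp_increasing_open[OF assms(3)])
  show "\<exists>y. (F has_real_derivative y) (at x) \<and> 0 < y" if "s < x" "x < t" for x
    using F_has_derivative[of x] \<rho>_pos[of x] that assms by (intro exI[of _ "\<rho> x"]) (auto simp: abs_less_iff)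
  show "continuous_on {s..t} F" using continuous_on_F by (rule continuous_on_subset) (use assms in auto)
qed

lemma F_inj: "inj_on F {-1..1}"
  by (rule linorder_inj_onI) (use F_strict_mono in \<open>auto simp: less_imp_neq\<close>)

lemma F_le_iff: "s \<in> {-1..1} \<Longrightarrow> t \<in> {-1..1} \<Longrightarrow> F s \<le> F t \<longleftrightarrow> s \<le> t"
  using F_strict_mono[of s t] F_strict_mono[of t s] by (cases s t rule: linorder_cases) auto

lemma F_minus:
  assumes s: "s \<in> {-1..1}" shows "F (- s) = L - F s"
proof -
  have "integral {-1..-s} (\<lambda>t. \<rho> (- t)) = integral {s..1} \<rho>"
    by (rule Henstock_Kurzweil_Integration.integral_reflect_real)
  moreover have "(\<lambda>t. \<rho> (- t)) = \<rho>" by (simp add: \<rho>_def fun_eq_iff)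
  moreover have "integral {-1..s} \<rho> + integral {s..1} \<rho> = L"
    unfolding L_def by (rule Henstock_Kurzweil_Integration.integral_combine) (use s \<rho>_integrable in auto)
  ultimately show ?thesis by (simp add: F_def)
qed

lemma F_image: "F ` {-1..1} = {0..L}"
proof
  show "F ` {-1..1} \<subseteq> {0..L}"
    using F_le_iff[of "-1"] F_le_iff[of _ 1] F_values by auto
  show "{0..L} \<subseteq> F ` {-1..1}"
  proof
    fix y assume "y \<in> {0..L}"
    then obtain s where "-1 \<le> s" "s \<le> 1" "F s = y"
      using IVT'[of F "-1" y 1] F_values continuous_on_F by auto
    then show "y \<in> F ` {-1..1}" by auto
  qed
qed

definition S0 :: "real \<Rightarrow> real" where "S0 = inv_into {-1..1} F"

lemma F_S0: "y \<in> {0..L} \<Longrightarrow> F (S0 y) = y"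
  unfolding S0_def by (rule f_inv_into_f) (simp add: F_image)

lemma S0_range: "y \<in> {0..L} \<Longrightarrow> S0 y \<in> {-1..1}"
  unfolding S0_def by (rule inv_into_into) (simp add: F_image)

lemma S0_F: "s \<in> {-1..1} \<Longrightarrow> S0 (F s) = s"
  unfolding S0_def by (rule inv_into_f_f[OF F_inj])

lemma continuous_on_S0: "continuous_on {0..L} S0"
  using continuous_on_inv[OF continuous_on_F compact_Icc, of S0] S0_F F_image by auto

lemma S0_strict: "y \<in> {0<..<L} \<Longrightarrow> S0 y \<in> {-1<..<1}"
  using S0_range[of y] F_S0[of y] F_values by (cases "S0 y = 1"; cases "S0 y = -1") auto

lemma S0_has_derivative:
  assumes y: "y \<in> {0<..<L}"
  shows "(S0 has_real_derivative (1 - \<bar>S0 y\<bar> powr p) powr (1 / p)) (at y)"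
proof -
  have s: "S0 y \<in> {-1<..<1}" by (rule S0_strict[OF y])
  have "isCont S0 y" using continuous_on_interior[OF continuous_on_S0, of y] y by simp
  then have "(S0 has_real_derivative inverse (\<rho> (S0 y))) (at y)"
    by (intro DERIV_inverse_function[where f=F and a=0 and b=L] F_has_derivative[OF s])
      (use y F_S0 \<rho>_pos[of "S0 y"] s in \<open>auto simp: abs_less_iff\<close>)
  moreover have "inverse (\<rho> (S0 y)) = (1 - \<bar>S0 y\<bar> powr p) powr (1 / p)"
    by (simp add: \<rho>_def powr_minus)
  ultimately show ?thesis by simp
qed

text \<open>The triangle wave of slope \<open>L\<close>, the argument of \<open>sin_p\<close> folded back to the first quarter period.\<close>

definition tri :: "real \<Rightarrow> real" where "tri x = L * (x - 2 * max (x - 1 / 2) 0 + 2 * max (- x - 1 / 2) 0)"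

text \<open>On [-1,1] this is \<open>sin_p p (pi_p p * x)\<close> divided by its amplitude
  (p-1)^(1/p), see \<open>sin_p_eq\<close>.\<close>

definition S :: "real \<Rightarrow> real" where "S x = S0 (L / 2 + tri x)"

definition \<sigma> :: "real \<Rightarrow> real" where "\<sigma> x = (if \<bar>x\<bar> \<le> 1 / 2 then 1 else - 1)"

definition S' :: "real \<Rightarrow> real" where "S' x = L * (\<sigma> x * (1 - \<bar>S x\<bar> powr p) powr (1 / p))"

lemma tri_cases:
  "\<bar>x\<bar> \<le> 1 / 2 \<Longrightarrow> tri x = L * x" "1 / 2 \<le> x \<Longrightarrow> tri x = L * (1 - x)" "x \<le> - 1 / 2 \<Longrightarrow> tri x = L * (- 1 - x)"
  by (auto simp: tri_def max_def abs_le_iff)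

lemma tri_minus: "tri (- x) = - tri x"
  by (simp add: tri_def algebra_simps)

lemma tri_range:
  assumes "x \<in> {-1..1}" shows "L / 2 + tri x \<in> {0..L}"
proof -
  consider "\<bar>x\<bar> \<le> 1 / 2" | "1 / 2 \<le> x" | "x \<le> - 1 / 2" by linarith
  then have "\<exists>k. tri x = L * k \<and> - 1 / 2 \<le> k \<and> k \<le> 1 / 2"
  proof cases
    case 1 then show ?thesis using tri_cases(1)[of x] by (intro exI[of _ x]) (auto simp: abs_le_iff)
  next
    case 2 then show ?thesis using tri_cases(2)[of x] assms by (intro exI[of _ "1 - x"]) auto
  next
    case 3 then show ?thesis using tri_cases(3)[of x] assms by (intro exI[of _ "- 1 - x"]) auto
  qed
  then obtain k where k: "tri x = L * k" "- 1 / 2 \<le> k" "k \<le> 1 / 2" by blast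
  then show ?thesis
  proof -
    have "L * (- 1 / 2) \<le> L * k" "L * k \<le> L * (1 / 2)"
      using k L_pos by (intro mult_left_mono; simp)+
    then show ?thesis unfolding k(1) atLeastAtMost_iff by linarith
  qed
qed

lemma tri_strict:
  assumes "x \<in> {-1<..<1}" "\<bar>x\<bar> \<noteq> 1 / 2" shows "L / 2 + tri x \<in> {0<..<L}"
proof -
  consider "\<bar>x\<bar> < 1 / 2" | "1 / 2 < x" | "x < - 1 / 2" using assms by linarith
  then have "\<exists>k. tri x = L * k \<and> - 1 / 2 < k \<and> k < 1 / 2"
  proof cases
    case 1 then show ?thesis using tri_cases(1)[of x] by (intro exI[of _ x]) (auto simp: abs_less_iff)
  next
    case 2 then show ?thesis using tri_cases(2)[of x] assms by (intro exI[of _ "1 - x"]) auto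
  next
    case 3 then show ?thesis using tri_cases(3)[of x] assms by (intro exI[of _ "- 1 - x"]) auto
  qed
  then obtain k where k: "tri x = L * k" "- 1 / 2 < k" "k < 1 / 2" by blast
  then show ?thesis
  proof -
    have "L * (- 1 / 2) < L * k" "L * k < L * (1 / 2)"
      using k L_pos by (intro mult_strict_left_mono; simp)+
    then show ?thesis unfolding k(1) greaterThanLessThan_iff by linarith
  qed
qed

lemma F_S: "x \<in> {-1..1} \<Longrightarrow> F (S x) = L / 2 + tri x"
  unfolding S_def by (rule F_S0[OF tri_range])

lemma S_range: "x \<in> {-1..1} \<Longrightarrow> S x \<in> {-1..1}"
  unfolding S_def by (rule S0_range[OF tri_range])

lemma S_eqI: "x \<in> {-1..1} \<Longrightarrow> s \<in> {-1..1} \<Longrightarrow> F s = L / 2 + tri x \<Longrightarrow> S x = s"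
  using S0_F[of s] by (simp add: S_def)

lemma S_minus: "x \<in> {-1..1} \<Longrightarrow> S (- x) = - S x"
  using S_range[of x] F_minus[of "S x"] F_S[of x] by (intro S_eqI) (auto simp: tri_minus)

lemma S_0: "S 0 = 0" and S_1: "S 1 = 0" and S_half: "S (1 / 2) = 1"
  by (rule S_eqI; simp add: F_values tri_def)+

lemma S_eq_0_iff:
  assumes "x \<in> {-1<..<1}" shows "S x = 0 \<longleftrightarrow> x = 0"
proof
  assume "S x = 0"
  then have "tri x = 0" using F_S[of x] F_values assms by auto
  then show "x = 0"
    using L_pos tri_cases[of x] assms by (cases "\<bar>x\<bar> \<le> 1 / 2"; cases "1 / 2 \<le> x") auto
qed (simp add: S_0)

lemma continuous_on_S: "continuous_on {-1..1} S"
  unfolding S_def[abs_def]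
  by (rule continuous_on_compose2[OF continuous_on_S0])
    (use tri_range in \<open>auto simp: tri_def[abs_def] intro!: continuous_intros continuous_on_max\<close>)

lemma continuous_on_compl_S: "0 < d \<Longrightarrow> continuous_on {-1..1} (\<lambda>x. (1 - \<bar>S x\<bar> powr p) powr d)"
  using abs_powr_p_le_1[of "S _"] S_range p_pos
  by (intro continuous_on_powr' continuous_on_diff continuous_on_abs_powr continuous_on_S continuous_on_const)
    (auto simp: abs_le_iff)

text \<open>\<sigma> jumps only at 1/2 and -1/2, where |S| = 1 and the other factor is zero.\<close>

lemma continuous_on_\<sigma>_compl_S:
  assumes d: "0 < d" shows "continuous_on {-1..1} (\<lambda>x. \<sigma> x * (1 - \<bar>S x\<bar> powr p) powr d)"
proof -
  let ?f = "\<lambda>x. (1 - \<bar>S x\<bar> powr p) powr d"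
  have "continuous_on ({-1/2..1/2} \<union> ({-1..-1/2} \<union> {1/2..1})) (\<lambda>x. if \<bar>x\<bar> \<le> 1/2 then ?f x else - ?f x)"
  proof (rule continuous_on_cases)
    show "continuous_on {-1/2..1/2} ?f"
      by (rule continuous_on_subset[OF continuous_on_compl_S[OF d]]) auto
    show "continuous_on ({-1..-1/2} \<union> {1/2..1}) (\<lambda>x. - ?f x)"
      by (intro continuous_on_minus continuous_on_subset[OF continuous_on_compl_S[OF d]]) auto
    have "?f x = 0" if "x = 1 / 2 \<or> x = - (1 / 2)" for x
      using that S_minus[of "1/2"] by (elim disjE; hypsubst) (simp_all add: S_half)
    then show "\<forall>x. x \<in> {-1/2..1/2} \<and> \<not> \<bar>x\<bar> \<le> 1/2 \<or> x \<in> {-1..-1/2} \<union> {1/2..1} \<and> \<bar>x\<bar> \<le> 1/2 \<longrightarrow> ?f x = - ?f x"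
      by (auto simp: abs_le_iff)
  qed auto
  moreover have 1: "{-1/2..1/2} \<union> ({-1..-1/2} \<union> {1/2..1}) = {-1..1::real}" by auto
  moreover have 2: "(\<lambda>x. if \<bar>x\<bar> \<le> 1/2 then ?f x else - ?f x) = (\<lambda>x. \<sigma> x * ?f x)"
    by (auto simp: \<sigma>_def fun_eq_iff)
  ultimately show ?thesis by (simp only: 1 2)
qed

lemma continuous_on_S': "continuous_on {-1..1} S'"
  unfolding S'_def[abs_def] using p_pos by (intro continuous_on_mult_left continuous_on_\<sigma>_compl_S) auto

lemma tri_has_derivative:
  assumes "\<bar>x\<bar> \<noteq> 1 / 2" shows "(tri has_real_derivative L * \<sigma> x) (at x)"
proof -
  consider "\<bar>x\<bar> < 1 / 2" | "1 / 2 < x" | "x < - 1 / 2" using assms by linarith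
  then show ?thesis
  proof cases
    case 1
    have "((\<lambda>x. L * x) has_real_derivative L * \<sigma> x) (at x)"
      using 1 by (auto intro!: derivative_eq_intros simp: \<sigma>_def)
    then show ?thesis
      by (rule has_field_derivative_transform_within_open[of _ _ _ "{-1/2<..<1/2}"])
        (use 1 tri_cases(1) in \<open>auto simp: abs_less_iff abs_le_iff\<close>)
  next
    case 2
    have "((\<lambda>x. L * (1 - x)) has_real_derivative L * \<sigma> x) (at x)"
      using 2 by (auto intro!: derivative_eq_intros simp: \<sigma>_def)
    then show ?thesis
      by (rule has_field_derivative_transform_within_open[of _ _ _ "{1/2<..}"]) (use 2 tri_cases(2) in auto)
  next
    case 3
    have "((\<lambda>x. L * (- 1 - x)) has_real_derivative L * \<sigma> x) (at x)"
      using 3 by (auto intro!: derivative_eq_intros simp: \<sigma>_def)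
    then show ?thesis
      by (rule has_field_derivative_transform_within_open[of _ _ _ "{..<-1/2}"]) (use 3 tri_cases(3) in auto)
  qed
qed

lemma S_has_derivative:
  assumes x: "x \<in> {-1<..<1}" "\<bar>x\<bar> \<noteq> 1 / 2" shows "(S has_real_derivative S' x) (at x)"
proof -
  have "((\<lambda>x. L / 2 + tri x) has_real_derivative L * \<sigma> x) (at x)"
    using tri_has_derivative[OF x(2)] by (auto intro!: derivative_eq_intros)
  from DERIV_chain2[OF S0_has_derivative[OF tri_strict[OF x]] this]
  show ?thesis by (simp add: S_def[abs_def] S'_def algebra_simps)
qed

lemma abs_S'_powr: assumes "x \<in> {-1..1}" shows "\<bar>S' x\<bar> powr p = L powr p * (1 - \<bar>S x\<bar> powr p)"
proof -
  have "0 \<le> 1 - \<bar>S x\<bar> powr p" using abs_powr_p_le_1[of "S x"] S_range[OF assms] by (auto simp: abs_le_iff)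
  moreover have "\<bar>\<sigma> x\<bar> = 1" by (simp add: \<sigma>_def)
  ultimately show ?thesis using L_pos p_pos by (simp add: S'_def abs_mult powr_mult powr_powr)
qed

text \<open>Up to a factor, the differentiated function is \<open>u |u'|^(p-2) u'\<close> for \<open>u = S\<close>.\<close>

lemma virial_derivative:
  assumes x: "x \<in> {-1<..<1}" "\<bar>x\<bar> \<noteq> 1 / 2"
  shows "((\<lambda>x. S x * (\<sigma> x * (1 - \<bar>S x\<bar> powr p) powr e)) has_real_derivative L * (1 - p * \<bar>S x\<bar> powr p)) (at x)"
proof -
  have Sx: "\<bar>S x\<bar> < 1"
    unfolding S_def using S0_strict[OF tri_strict[OF x]] by (auto simp: abs_less_iff)
  define Y where "Y = 1 - \<bar>S x\<bar> powr p"
  have Y: "0 < Y" using abs_powr_p_less_1[OF Sx] by (simp add: Y_def)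
  have dS: "(S has_real_derivative S' x) (at x)" by (rule S_has_derivative[OF x])
  have "((\<lambda>x. \<bar>S x\<bar> powr p) has_real_derivative p * spow (p - 1) (S x) * S' x) (at x)"
    by (rule DERIV_chain2[OF abs_powr_has_derivative dS]) (use p_ge in simp)
  then have dY: "((\<lambda>x. 1 - \<bar>S x\<bar> powr p) has_real_derivative - (p * spow (p - 1) (S x) * S' x)) (at x)"
    using DERIV_diff[OF DERIV_const[of 1]] by fastforce
  have dE: "((\<lambda>x. (1 - \<bar>S x\<bar> powr p) powr e) has_real_derivative e * Y powr (e - 1) * - (p * spow (p - 1) (S x) * S' x)) (at x)"
    using DERIV_fun_powr[OF dY, of e] Y by (simp add: Y_def)
  have ex: "e - 1 = - (1 / p)" "e * p = p - 1" using p_pos by (simp_all add: e_def field_simps)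
  have Ye: "Y powr e = Y * Y powr (- (1 / p))" unfolding e_def using Y by (intro powr_conjugate) simp
  have YY: "Y powr (- (1 / p)) * Y powr (1 / p) = 1" using Y by (simp add: powr_add[symmetric])
  have S'Y: "S' x = L * (\<sigma> x * Y powr (1 / p))" by (simp add: S'_def Y_def)
  have ss: "\<sigma> x * \<sigma> x = 1" by (simp add: \<sigma>_def)
  \<comment> \<open>The sign factor is frozen at x while differentiating; it is locally constant
    because |x| differs from 1/2.\<close>
  have "((\<lambda>y. S y * (\<sigma> x * (1 - \<bar>S y\<bar> powr p) powr e)) has_real_derivative
     S' x * (\<sigma> x * Y powr e) + \<sigma> x * (e * Y powr (e - 1) * - (p * spow (p - 1) (S x) * S' x)) * S x) (at x)"
    using DERIV_mult[OF dS DERIV_cmult[OF dE, of "\<sigma> x"]] by (simp add: Y_def)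
  also have "S' x * (\<sigma> x * Y powr e) + \<sigma> x * (e * Y powr (e - 1) * - (p * spow (p - 1) (S x) * S' x)) * S x
     = (\<sigma> x * \<sigma> x) * L * ((Y powr (- (1 / p)) * Y powr (1 / p)) * Y - (e * p) * (Y powr (- (1 / p)) * Y powr (1 / p)) * (spow (p - 1) (S x) * S x))"
    unfolding S'Y Ye ex(1) by (simp add: algebra_simps)
  also have "\<dots> = L * (1 - p * \<bar>S x\<bar> powr p)"
    unfolding ss YY ex(2) spow_times_self by (simp add: Y_def algebra_simps)
  finally have main: "((\<lambda>y. S y * (\<sigma> x * (1 - \<bar>S y\<bar> powr p) powr e)) has_real_derivative L * (1 - p * \<bar>S x\<bar> powr p)) (at x)" .
  show ?thesis
  proof (cases "\<bar>x\<bar> < 1 / 2")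
    case True
    show ?thesis
      by (rule has_field_derivative_transform_within_open[OF main, of "{-1/2<..<1/2}"])
        (use True in \<open>auto simp: \<sigma>_def abs_less_iff abs_le_iff\<close>)
  next
    case False
    have "open {y::real. 1 / 2 < \<bar>y\<bar>}" by (intro open_Collect_less continuous_intros)
    then show ?thesis
      by (rule has_field_derivative_transform_within_open[OF main]) (use False x in \<open>auto simp: \<sigma>_def\<close>)
  qed
qed

text \<open>The affine parameters treat two competitors at once, the full wave (c = 1, d = 0) and
  the half wave (c = d = 1/2). The virial identity fixes the mass as 2/p, and the first integral
  then gives the Dirichlet term.\<close>

lemma S_arc:
  fixes c d :: real
  assumes c: "0 < c" "-1 \<le> d - c" "c + d \<le> 1" and z: "S (d - c) = 0" "S (c + d) = 0"
  defines "y \<equiv> \<lambda>x. S (c * x + d)" and "y' \<equiv> \<lambda>x. c * S' (c * x + d)"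
  shows "y \<in> W01p_nonzero p" "has_weak_deriv y y'" "mass y = 2 / p" "dirichlet y = c powr p * P * mass y"
    "continuous_on {-1..1} y"
proof -
  have img: "c * x + d \<in> {-1..1}" if "x \<in> {-1..1}" for x
  proof -
    have "c * x \<le> c * 1" "c * (- 1) \<le> c * x" using that c by (intro mult_left_mono; simp)+
    then show ?thesis using c unfolding atLeastAtMost_iff by linarith
  qed
  have img': "c * x + d \<in> {-1<..<1}" if "x \<in> {-1<..<1}" for x
  proof -
    have "c * x < c * 1" "c * (- 1) < c * x" using that c by (intro mult_strict_left_mono; simp)+
    then show ?thesis using c unfolding greaterThanLessThan_iff by linarith
  qed
  \<comment> \<open>The points where the affine argument meets a corner of \<open>tri\<close>. The
    fundamental theorem tolerates this finite exceptional set.\<close>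
  define N where "N = {(1/2 - d) / c, (- 1/2 - d) / c}"
  have N: "\<bar>c * x + d\<bar> \<noteq> 1 / 2" if "x \<notin> N" for x
  proof
    assume "\<bar>c * x + d\<bar> = 1 / 2"
    then have "c * x + d = 1 / 2 \<or> c * x + d = - 1 / 2" by linarith
    then have "x = (1/2 - d) / c \<or> x = (- 1/2 - d) / c" using c by (auto simp: field_simps)
    then show False using that by (auto simp: N_def)
  qed
  have aff: "((\<lambda>x. c * x + d) has_real_derivative c) (at x)" for x
    by (auto intro!: derivative_eq_intros)
  have cc: "continuous_on {-1..1} (\<lambda>x. f (c * x + d))" if "continuous_on {-1..1} f" for f :: "real \<Rightarrow> real"
    by (rule continuous_on_compose2[OF that]) (use img in \<open>auto intro!: continuous_intros\<close>)
  show yc: "continuous_on {-1..1} y" unfolding y_def by (rule cc[OF continuous_on_S])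
  have y'c: "continuous_on {-1..1} y'" unfolding y'_def by (intro continuous_on_mult_left cc continuous_on_S')
  have dy: "(y has_real_derivative y' x) (at x)" if "x \<in> {-1<..<1} - N" for x
    unfolding y_def y'_def
    using DERIV_chain2[OF S_has_derivative[OF img' N] aff, of x] that by (simp add: mult.commute)
  have int: "(y' has_integral (y x - y (-1))) {-1..x}" if x: "x \<in> {-1..1}" for x
    by (rule fundamental_theorem_of_calculus_interior_strong[of N])
      (use dy x in \<open>auto simp: N_def has_real_derivative_iff_has_vector_derivative[symmetric]
        intro: continuous_on_subset[OF yc]\<close>)
  have y0: "y (-1) = 0" "y 1 = 0" using z by (simp_all add: y_def add.commute)
  have yint: "y x = integral {-1..x} y'" if "x \<in> {-1..1}" for x
    using integral_unique[OF int[OF that]] y0 by simp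
  have y'0: "integral {-1..1} y' = 0" using yint[of 1] y0 by simp
  have W: "y \<in> W01p p" and wd: "has_weak_deriv y y'"
    using W01p_C1[OF p_ge_1 y'c y'0 yint] by auto
  show "has_weak_deriv y y'" by (rule wd)
  have "((\<lambda>x. c * (L * (1 - p * \<bar>y x\<bar> powr p))) has_integral (0 - 0)) {-1..1}"
  proof -
    define X where "X x = S x * (\<sigma> x * (1 - \<bar>S x\<bar> powr p) powr e)" for x
    have Xc: "continuous_on {-1..1} X"
      unfolding X_def by (intro continuous_on_mult continuous_on_S continuous_on_\<sigma>_compl_S e_pos)
    have "((\<lambda>x. c * (L * (1 - p * \<bar>y x\<bar> powr p))) has_integral (X (c * 1 + d) - X (c * (- 1) + d))) {-1..1}"
    proof (rule fundamental_theorem_of_calculus_interior_strong[of N])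
      show "continuous_on {-1..1} (\<lambda>x. X (c * x + d))" by (rule cc[OF Xc])
      fix x assume x: "x \<in> {-1<..<1} - N"
      show "((\<lambda>x. X (c * x + d)) has_vector_derivative c * (L * (1 - p * \<bar>y x\<bar> powr p))) (at x)"
        unfolding X_def y_def
        using DERIV_chain2[OF virial_derivative[OF img' N] aff, of x] x
        by (simp add: has_real_derivative_iff_has_vector_derivative[symmetric] mult.commute)
    qed (auto simp: N_def)
    moreover have "X (c * 1 + d) = 0" "X (c * (- 1) + d) = 0" using z by (simp_all add: X_def)
    ultimately show ?thesis by simp
  qed
  from integral_unique[OF this] have "c * (L * integral {-1..1} (\<lambda>x. 1 - p * \<bar>y x\<bar> powr p)) = 0" by simp
  then have *: "integral {-1..1} (\<lambda>x. 1 - p * \<bar>y x\<bar> powr p) = 0" using c L_pos by simp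
  have yp: "continuous_on {-1..1} (\<lambda>x. \<bar>y x\<bar> powr p)" by (rule continuous_on_abs_powr[OF yc p_pos])
  have yi: "(\<lambda>x. p * \<bar>y x\<bar> powr p) integrable_on {-1..1}"
    by (intro integrable_continuous_real continuous_on_mult_left yp)
  have m: "mass y = integral {-1..1} (\<lambda>x. \<bar>y x\<bar> powr p)"
    unfolding mass_def by (rule lebesgue_on_Omega_continuous(2)[OF yp])
  have i1: "(\<lambda>x. 1::real) integrable_on {-1..1::real}" by (rule integrable_continuous_real) simp
  have "integral {-1..1} (\<lambda>x. 1 - p * \<bar>y x\<bar> powr p) = 2 - p * mass y"
    using integral_diff[OF i1 yi] by (simp add: m)
  then show mass: "mass y = 2 / p" using * p_pos by (simp add: field_simps)
  have "dirichlet y = (LINT x|leb_Omega. \<bar>y' x\<bar> powr p)"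
    unfolding dirichlet_def by (rule integral_weak_deriv_powr[OF wd])
  also have "\<dots> = integral {-1..1} (\<lambda>x. \<bar>y' x\<bar> powr p)"
    by (rule lebesgue_on_Omega_continuous(2)[OF continuous_on_abs_powr[OF y'c p_pos]])
  also have "\<dots> = integral {-1..1} (\<lambda>x. c powr p * L powr p * (1 - \<bar>y x\<bar> powr p))"
  proof (rule integral_cong)
    fix x :: real assume "x \<in> {-1..1}"
    then show "\<bar>y' x\<bar> powr p = c powr p * L powr p * (1 - \<bar>y x\<bar> powr p)"
      using abs_S'_powr[OF img] c by (simp add: y'_def y_def abs_mult powr_mult)
  qed
  also have "\<dots> = c powr p * L powr p * (2 - mass y)"
    using integral_diff[OF i1 integrable_continuous_real[OF yp]] by (simp add: m)
  also have "2 - mass y = (p - 1) * mass y" unfolding mass using p_pos by (simp add: field_simps)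
  finally show "dirichlet y = c powr p * P * mass y" by (simp add: P_def)
  show "y \<in> W01p_nonzero p"
    using W mass mass_eq_0_iff[OF W01p_Lp[OF W]] p_pos by (simp add: W01p_nonzero_def)
qed

end

section \<open>The theorem\<close>

context exponents
begin

section \<open>Identification with the function \<open>sin_p\<close>\<close>

definition c0 :: real where "c0 = (p - 1) powr (1 / p)"

lemma c0_pos: "0 < c0" using p_ge by (simp add: c0_def)

lemma c0_powr: "c0 powr p = p - 1" using p_ge by (simp add: c0_def powr_powr)

text \<open>Rescaling by c0 = (p-1)^(1/p) turns t^p / (p-1) into (t/c0)^p, and the defining
  integrand of \<open>F_p\<close> into \<rho>.\<close>

lemma F_p_eq:
  assumes z: "z \<in> {0..c0}" shows "F_p p z = c0 * (F (z / c0) - L / 2)"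
proof -
  define f where "f t = 1 / (1 - t powr p / (p - 1)) powr (1 / p)" for t
  have "(f has_integral (c0 * F (z / c0) - c0 * F (0 / c0))) {0..z}"
  proof (rule fundamental_theorem_of_calculus_interior)
    have sub: "t / c0 \<in> {-1..1}" if "t \<in> {0..z}" for t
      using that z c0_pos by (auto simp: field_simps)
    have "continuous_on {0..z} (\<lambda>t. t / c0)"
      using c0_pos by (intro continuous_on_divide continuous_on_id continuous_on_const) auto
    then have "continuous_on {0..z} (\<lambda>t. F (t / c0))"
      by (rule continuous_on_compose2[OF continuous_on_F]) (use sub in blast)
    then show "continuous_on {0..z} (\<lambda>t. c0 * F (t / c0))" by (rule continuous_on_mult_left)
    fix t assume t: "t \<in> {0<..<z}"
    then have tc: "t / c0 \<in> {-1<..<1}" "0 < t / c0" using z c0_pos by (auto simp: field_simps)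
    have "((\<lambda>t. t / c0) has_real_derivative 1 / c0) (at t)"
      using c0_pos by (auto intro!: derivative_eq_intros)
    from DERIV_cmult[OF DERIV_chain2[OF F_has_derivative[OF tc(1)] this], of c0]
    have "((\<lambda>t. c0 * F (t / c0)) has_real_derivative \<rho> (t / c0)) (at t)" using c0_pos by simp
    moreover have "\<rho> (t / c0) = f t"
      using t c0_pos by (simp add: \<rho>_def f_def powr_divide c0_powr powr_minus_divide)
    ultimately show "((\<lambda>t. c0 * F (t / c0)) has_vector_derivative f t) (at t)"
      by (simp add: has_real_derivative_iff_has_vector_derivative)
  qed (use z in simp)
  then have int: "(f has_integral (c0 * (F (z / c0) - L / 2))) {0..z}"
    by (simp add: F_values right_diff_distrib)
  \<comment> \<open>The integrand is nonnegative, so its gauge integral converges absolutely and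
    agrees with the Lebesgue integral in the definition.\<close>
  then have "f absolutely_integrable_on {0..z}"
    by (intro nonnegative_absolutely_integrable_1) (auto simp: f_def)
  then have "integrable (completion lborel) (\<lambda>t. indicator {0..z} t *\<^sub>R f t)"
    by (simp add: set_integrable_def)
  then have "set_integrable lborel {0..z} f"
    unfolding set_integrable_def f_def by (subst (asm) integrable_completion) (auto simp: f_def)
  then have "(LBINT t:{0..z}. f t) = integral {0..z} f"
    by (rule set_borel_integral_eq_integral)
  then show ?thesis using integral_unique[OF int] by (simp add: F_p_def f_def)
qed

lemma pi_p_eq: "pi_p p = c0 * L"
proof -
  have "pi_p p = 2 * F_p p c0" by (simp add: pi_p_def F_p_def c0_def)
  also have "\<dots> = c0 * L" using F_p_eq[of c0] c0_pos by (simp add: F_values)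
  finally show ?thesis .
qed

lemma pi_p_powr: "pi_p p powr p = P"
  using c0_pos L_pos by (simp add: pi_p_eq powr_mult c0_powr P_def)

lemma z_p_eq:
  assumes y: "y \<in> {0..L / 2}" shows "z_p p (c0 * y) = c0 * S0 (L / 2 + y)"
  unfolding z_p_def c0_def[symmetric]
proof (rule inv_into_f_eq)
  have yL: "L / 2 + y \<in> {0..L}" using y by auto
  have F: "F (S0 (L / 2 + y)) = L / 2 + y" by (rule F_S0[OF yL])
  have "0 \<le> S0 (L / 2 + y)" using F_le_iff[of 0 "S0 (L / 2 + y)"] S0_range[OF yL] F F_values y by auto
  then have s: "S0 (L / 2 + y) \<in> {0..1}" using S0_range[OF yL] by auto
  then show m: "c0 * S0 (L / 2 + y) \<in> {0..c0}" using c0_pos by auto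
  show "F_p p (c0 * S0 (L / 2 + y)) = c0 * y"
    using F_p_eq[OF m] c0_pos F by simp
  show "inj_on (F_p p) {0..c0}"
  proof (rule inj_onI)
    fix s t assume st: "s \<in> {0..c0}" "t \<in> {0..c0}" "F_p p s = F_p p t"
    then have "F (s / c0) = F (t / c0)" using F_p_eq[OF st(1)] F_p_eq[OF st(2)] c0_pos by simp
    moreover have "s / c0 \<in> {-1..1}" "t / c0 \<in> {-1..1}" using st c0_pos by (auto simp: field_simps)
    ultimately have "s / c0 = t / c0" using inj_onD[OF F_inj] by blast
    then show "s = t" using c0_pos by simp
  qed
qed

lemma sin_p_period_nonneg:
  assumes x: "x \<in> {0..1}" shows "sin_p_period p (c0 * L * x) = c0 * S x"
proof -
  have t0: "0 \<le> c0 * L * x" using x c0_pos L_pos by simp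
  show ?thesis
  proof (cases "x \<le> 1 / 2")
    case True
    have "L * x \<le> L * (1 / 2)" using True L_pos by (intro mult_left_mono) auto
    then have "z_p p (c0 * (L * x)) = c0 * S0 (L / 2 + L * x)"
      using x L_pos by (intro z_p_eq) auto
    moreover have "c0 * L * x \<le> c0 * L / 2" using True c0_pos L_pos by (simp add: field_simps)
    ultimately show ?thesis
      using t0 x True tri_cases(1)[of x] by (simp add: sin_p_period_def pi_p_eq S_def mult.assoc)
  next
    case False
    have "L * (1 - x) \<le> L * (1 / 2)" using False L_pos by (intro mult_left_mono) auto
    then have "z_p p (c0 * (L * (1 - x))) = c0 * S0 (L / 2 + L * (1 - x))"
      using x L_pos by (intro z_p_eq) auto
    moreover have "\<not> c0 * L * x \<le> c0 * L / 2" using False c0_pos L_pos by (simp add: field_simps)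
    moreover have "c0 * L - c0 * L * x = c0 * (L * (1 - x))" by (simp add: algebra_simps)
    ultimately show ?thesis
      using t0 x False tri_cases(2)[of x] by (simp add: sin_p_period_def pi_p_eq S_def)
  qed
qed

lemma sin_p_period_eq:
  assumes x: "x \<in> {-1..1}" shows "sin_p_period p (c0 * L * x) = c0 * S x"
proof (cases "0 \<le> x")
  case True
  then show ?thesis using sin_p_period_nonneg x by simp
next
  case False
  have neg: "c0 * L * x < 0" using False c0_pos L_pos by (simp add: mult_pos_neg)
  have "sin_p_period p (c0 * L * x) = - sin_p_period p (- (c0 * L * x))"
    using neg by (simp add: sin_p_period_def Let_def)
  also have "- (c0 * L * x) = c0 * L * (- x)" by simp
  also have "sin_p_period p (c0 * L * (- x)) = c0 * S (- x)" by (rule sin_p_period_nonneg) (use x False in auto)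
  also have "S (- x) = - S x" by (rule S_minus[OF x])
  finally show ?thesis by simp
qed

lemma sin_p_eq:
  assumes x: "x \<in> {-1..1}" shows "sin_p p (pi_p p * x) = c0 * S x"
proof -
  have pos: "0 < c0 * L" using c0_pos L_pos by simp
  have fl: "(pi_p p * x + pi_p p) / (2 * pi_p p) = (x + 1) / 2"
  proof -
    have "pi_p p * x + pi_p p = pi_p p * (x + 1)" by (simp add: algebra_simps)
    then show ?thesis using c0_pos L_pos by (simp add: pi_p_eq)
  qed
  show ?thesis
  proof (cases "x = 1")
    case True
    \<comment> \<open>At x = 1 the floor is 1 and the argument is moved to -\<pi>_p; the value is 0
      at both ends of the period.\<close>
    have "sin_p p (pi_p p * x) = sin_p_period p (c0 * L * (- 1))"
      unfolding sin_p_def fl by (simp add: True pi_p_eq mult.commute)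
    then show ?thesis using sin_p_period_eq[of "-1"] S_minus[of 1] S_1 True by simp
  next
    case False
    then have "\<lfloor>(x + 1) / 2\<rfloor> = 0" using x by (simp add: floor_eq_iff)
    then show ?thesis unfolding sin_p_def fl using sin_p_period_eq[OF x] by (simp add: pi_p_eq)
  qed
qed

lemma S_multiple:
  assumes y: "\<And>x. x \<in> {-1..1} \<Longrightarrow> y x = k * S x" and k: "k \<noteq> 0"
  shows "y \<in> W01p_nonzero p" "dirichlet y = P * mass y" "moment y = 0"
proof -
  have arc: "has_weak_deriv S S'" "mass S = 2 / p" "dirichlet S = P * mass S"
    using S_arc[of 1 0] S_1 S_minus[of 1] by simp_all
  have kS'c: "continuous_on {-1..1} (\<lambda>x. k * S' x)" by (intro continuous_on_mult_left continuous_on_S')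
  have int: "(S' has_integral (S x - S (-1))) {-1..x}" if x: "x \<in> {-1..1}" for x
    by (rule fundamental_theorem_of_calculus_interior_strong[of "{-1/2, 1/2}"])
      (use S_has_derivative x in \<open>auto simp: has_real_derivative_iff_has_vector_derivative[symmetric] abs_if
        split: if_splits intro: continuous_on_subset[OF continuous_on_S]\<close>)
  have yint: "y x = integral {-1..x} (\<lambda>x. k * S' x)" if "x \<in> {-1..1}" for x
    using integral_unique[OF int[OF that]] y[OF that] S_minus[of 1] S_1 by simp
  have "integral {-1..1} (\<lambda>x. k * S' x) = 0" using yint[of 1] y[of 1] S_1 by simp
  note C1 = W01p_C1[OF p_ge_1 kS'c this yint]
  have yS: "y x = k * S x" if "x \<in> space leb_Omega" for x using y[of x] that by auto
  have mass: "mass y = \<bar>k\<bar> powr p * mass S"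
  proof -
    have "mass y = (LINT x|leb_Omega. \<bar>k\<bar> powr p * \<bar>S x\<bar> powr p)"
      unfolding mass_def by (intro Bochner_Integration.integral_cong) (auto simp: yS abs_mult powr_mult)
    then show ?thesis by (simp add: mass_def)
  qed
  have "dirichlet y = (LINT x|leb_Omega. \<bar>k * S' x\<bar> powr p)"
    unfolding dirichlet_def by (rule integral_weak_deriv_powr[OF C1(2)])
  also have "\<dots> = \<bar>k\<bar> powr p * (LINT x|leb_Omega. \<bar>S' x\<bar> powr p)" by (simp add: abs_mult powr_mult)
  also have "(LINT x|leb_Omega. \<bar>S' x\<bar> powr p) = dirichlet S"
    unfolding dirichlet_def by (rule integral_weak_deriv_powr[OF arc(1), symmetric])
  finally show "dirichlet y = P * mass y" by (simp add: arc(3) mass)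
  have "mass y \<noteq> 0" using mass arc(2) k p_pos by simp
  then show "y \<in> W01p_nonzero p"
    using C1(1) mass_eq_0_iff[OF W01p_Lp[OF C1(1)]] by (simp add: W01p_nonzero_def)
  have yc: "continuous_on {-1..1} (\<lambda>x. spow r (k * S x))"
    by (intro continuous_on_spow r_pos continuous_on_mult_left continuous_on_S)
  have "moment y = (LINT x|leb_Omega. spow r (k * S x))"
    unfolding moment_def by (intro Bochner_Integration.integral_cong) (auto simp: yS)
  also have "\<dots> = integral {-1..1} (\<lambda>x. spow r (k * S x))" by (rule lebesgue_on_Omega_continuous(2)[OF yc])
  also have "\<dots> = 0"
  proof -
    have "integral {-1..1} (\<lambda>x. spow r (k * S x)) = integral {-1..1} (\<lambda>x. spow r (k * S (- x)))"
      using Henstock_Kurzweil_Integration.integral_reflect_real[where f="\<lambda>x. spow r (k * S x)" and a="-1" and b=1] by simp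
    also have "\<dots> = integral {-1..1} (\<lambda>x. - spow r (k * S x))"
      by (intro integral_cong) (simp add: S_minus spow_minus)
    finally show ?thesis by simp
  qed
  finally show "moment y = 0" .
qed

text \<open>Rigidity in the travel estimate. For m = 1 the change of variable is the identity, so F
  composed with v has Lipschitz constant L. It must climb L/2, fall L and climb L/2 within total
  length 2. No slack remains: the turning points are -1/2 and 1/2, and the composition is a
  reflected triangle wave.\<close>

lemma first_arc_unique:
  assumes v: "C1_0 v v'" and b: "\<And>x. x \<in> {-1..1} \<Longrightarrow> \<bar>v x\<bar> \<le> 1"
    and first: "\<And>x. x \<in> {-1..1} \<Longrightarrow> \<bar>v' x\<bar> powr p = L powr p * (1 - \<bar>v x\<bar> powr p)"
    and x: "x1 \<in> {-1..1}" "v x1 = 1" "x2 \<in> {-1..1}" "v x2 = - 1" and le: "x1 \<le> x2"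
  shows "\<forall>x\<in>{-1..1}. v x = - S x"
proof
  fix x :: real assume xx: "x \<in> {-1..1}"
  interpret half_range p r 1 by unfold_locales auto
  have R1: "R 1 = 0" by (simp add: R_def)
  have vr: "v z \<in> {-1..1}" if "z \<in> {-1..1}" for z using b[OF that] by (auto simp: abs_le_iff)
  have T: "T s = s" for s by (simp add: T_def D_def A_def R1)
  have th: "th = \<rho>" by (simp add: th_def fun_eq_iff R1 Lam_def)
  have FT: "Theta (T s) = F s" for s by (simp add: T Theta_def F_def th)
  have lip: "\<bar>F (v z) - F (v y)\<bar> \<le> L * (z - y)" if "y \<in> {-1..1}" "z \<in> {-1..1}" "y \<le> z" for y z
  proof -
    have "\<bar>Theta (T (v z)) - Theta (T (v y))\<bar> \<le> (L powr p) powr (1 / p) * (z - y)"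
      by (rule Theta_T_lipschitz[OF v]) (use vr first that in \<open>auto simp: R1 gf_def\<close>)
    then show ?thesis using L_pos p_pos by (simp add: FT powr_powr)
  qed
  note v01 = C1_0D(4,5)[OF v]
  have Fv: "F (v x1) = L" "F (v x2) = 0" "F (v (-1)) = L / 2" "F (v 1) = L / 2"
    using x v01 by (simp_all add: F_values)
  have "L / 2 \<le> L * (x1 + 1)" using lip[of "-1" x1] x Fv by (simp add: abs_le_iff)
  then have "L * (1 / 2) \<le> L * (x1 + 1)" by simp
  then have 1: "1 / 2 \<le> x1 + 1" using L_pos by (rule mult_left_le_imp_le)
  have "L * 1 \<le> L * (x2 - x1)" using lip[of x1 x2] x le Fv by (simp add: abs_le_iff)
  then have 2: "1 \<le> x2 - x1" using L_pos by (rule mult_left_le_imp_le)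
  have "L / 2 \<le> L * (1 - x2)" using lip[of x2 1] x Fv by (simp add: abs_le_iff)
  then have "L * (1 / 2) \<le> L * (1 - x2)" by simp
  then have 3: "1 / 2 \<le> 1 - x2" using L_pos by (rule mult_left_le_imp_le)
  have x12: "x1 = - 1 / 2" "x2 = 1 / 2" using 1 2 3 by linarith+
  have "F (v x) = L / 2 - tri x"
  proof -
    consider "x \<le> - 1 / 2" | "\<bar>x\<bar> \<le> 1 / 2" | "1 / 2 \<le> x" by linarith
    then show ?thesis
    proof cases
      case 1
      then have "\<bar>F (v x) - L / 2\<bar> \<le> L * (x + 1)" "\<bar>L - F (v x)\<bar> \<le> L * (- 1 / 2 - x)"
        using lip[of "-1" x] lip[of x x1] xx x Fv x12 by auto
      from this[THEN abs_le_D1] show ?thesis using tri_cases(3)[OF 1] by (simp add: algebra_simps)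
    next
      case 2
      then have "\<bar>F (v x) - L\<bar> \<le> L * (x + 1 / 2)" "\<bar>0 - F (v x)\<bar> \<le> L * (1 / 2 - x)"
        using lip[of x1 x] lip[of x x2] xx x Fv x12 by (auto simp: abs_le_iff)
      from this[THEN abs_le_D2] show ?thesis using tri_cases(1)[OF 2] by (simp add: algebra_simps)
    next
      case 3
      then have "\<bar>F (v x) - 0\<bar> \<le> L * (x - 1 / 2)" "\<bar>L / 2 - F (v x)\<bar> \<le> L * (1 - x)"
        using lip[of x2 x] lip[of x 1] xx x Fv x12 by auto
      from this[THEN abs_le_D1] show ?thesis using tri_cases(2)[OF 3] by (simp add: algebra_simps)
    qed
  qed
  then have "F (v x) = F (- S x)"
    using F_minus[OF S_range[OF xx]] F_S[OF xx] by simp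
  then show "v x = - S x"
    using F_inj vr[OF xx] S_range[OF xx] by (auto simp: inj_on_def)
qed

lemma arc_unique:
  assumes v: "C1_0 v v'" and b: "\<And>x. x \<in> {-1..1} \<Longrightarrow> \<bar>v x\<bar> \<le> 1"
    and first: "\<And>x. x \<in> {-1..1} \<Longrightarrow> \<bar>v' x\<bar> powr p = L powr p * (1 - \<bar>v x\<bar> powr p)"
    and x: "x1 \<in> {-1..1}" "v x1 = 1" "x2 \<in> {-1..1}" "v x2 = - 1"
  shows "\<exists>k. k \<noteq> 0 \<and> (\<forall>x\<in>{-1..1}. v x = k * S x)"
proof (cases "x1 \<le> x2")
  case True
  show ?thesis using first_arc_unique[OF v b first x True] by (intro exI[of _ "- 1"]) auto
next
  case False
  have "\<forall>x\<in>{-1..1}. - 1 * v x = - S x"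
    by (rule first_arc_unique[OF C1_0_scale[OF v], of "- 1" x2 x1]) (use b first x False in auto)
  then show ?thesis by (intro exI[of _ 1]) auto
qed

text \<open>Calibration forces the normalized profile to attain both 1 and -1. The derivative
  vanishes at both values, which removes the odd term of the first integral and leaves the equation
  of the generalized sine.\<close>

lemma zero_moment_minimizer:
  assumes min: "is_minimizer p r \<alpha> y" and lam: "lambda_eig p r \<alpha> = P" and mom: "moment y = 0"
  shows "\<exists>k. k \<noteq> 0 \<and> (AE x in leb_Omega. y x = k * S x)"
proof -
  have y: "y \<in> W01p_nonzero p" "y \<in> W01p p" using min by (auto simp: is_minimizer_def W01p_nonzero_def)
  have "Q p r \<alpha> y = P" using min lam by (simp add: is_minimizer_def)
  then have Dy: "dirichlet y = P * mass y" using mass_pos[OF y(1)] mom by (simp add: Q_eq field_simps)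
  obtain w w' a b where w: "continuous_on {-1..1} w" "continuous_on {-1..1} w'"
    "\<And>x. x \<in> {-1<..<1} \<Longrightarrow> (w has_real_derivative w' x) (at x)"
    "w (-1) = 0" "w 1 = 0" "AE x in leb_Omega. y x = w x" "has_weak_deriv y w'"
    "\<And>x. x \<in> {-1..1} \<Longrightarrow> (p - 1) * \<bar>w' x\<bar> powr p = a + b * spow r (w x) - lambda_eig p r \<alpha> * \<bar>w x\<bar> powr p"
    by (rule minimizer_first_integral[OF min]) (rule that; assumption)
  have C1: "C1_0 w w'" using w by (simp add: C1_0_def)
  note rep = mass_representative[OF W01p_Lp[OF y(2)] w(1,6)]
  have Dw: "dirichlet y = integral {-1..1} (\<lambda>x. \<bar>w' x\<bar> powr p)"
    using integral_weak_deriv_powr[OF w(7)] lebesgue_on_Omega_continuous(2)[OF continuous_on_abs_powr[OF w(2) p_pos]]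
    by (simp add: dirichlet_def)
  have "\<exists>x\<in>{-1..1}. w x \<noteq> 0"
  proof (rule ccontr)
    assume z: "\<not> (\<exists>x\<in>{-1..1}. w x \<noteq> 0)"
    have "integral {-1..1} (\<lambda>x. \<bar>w x\<bar> powr p) = integral {-1..1} (\<lambda>x::real. 0)"
      by (intro integral_cong) (use z in auto)
    then show False using mass_pos[OF y(1)] rep(1) by simp
  qed
  from C1_0_normalize[OF C1 this] obtain x1 M where
    M: "M \<noteq> 0" "x1 \<in> {-1..1}" "w x1 = M" "\<And>x. x \<in> {-1..1} \<Longrightarrow> \<bar>w x\<bar> \<le> \<bar>M\<bar>" by metis
  define v where "v x = (1 / M) * w x" for x
  define v' where "v' x = (1 / M) * w' x" for x
  have v: "C1_0 v v'" using C1_0_scale[OF C1, of "1 / M"] by (simp add: v_def[abs_def] v'_def[abs_def])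
  have vb: "\<bar>v x\<bar> \<le> 1" if "x \<in> {-1..1}" for x using M(1) M(4)[OF that] by (simp add: v_def abs_mult)
  have vx1: "v x1 = 1" using M by (simp add: v_def)
  have vJ: "integral {-1..1} (\<lambda>x. spow r (v x)) = 0"
    unfolding v_def spow_mult using rep(2) mom by simp
  have vD: "integral {-1..1} (\<lambda>x. \<bar>v' x\<bar> powr p) \<le> P * integral {-1..1} (\<lambda>x. \<bar>v x\<bar> powr p)"
    unfolding v_def v'_def abs_mult using Dy Dw rep(1) by (simp add: powr_divide)
  obtain x2 where x2: "x2 \<in> {-1..1}" "v x2 = - 1"
    using zero_moment_symmetric_range[OF v vb M(2) vx1 vJ vD] by blast
  have inn: "x1 \<in> {-1<..<1}" "x2 \<in> {-1<..<1}"
    using M(2) x2 vx1 C1_0D(4,5)[OF v] by (cases "x1 = 1"; cases "x1 = -1"; cases "x2 = 1"; cases "x2 = -1"; auto)+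
  have v'x1: "v' x1 = 0"
    by (rule DERIV_0_at_interior_max[OF v inn(1)]) (use vb vx1 in \<open>force simp: abs_le_iff\<close>)
  have "(\<lambda>x. - 1 * v' x) x2 = 0"
    by (rule DERIV_0_at_interior_max[OF C1_0_scale[OF v] inn(2)]) (use vb x2 in \<open>force simp: abs_le_iff\<close>)
  then have v'x2: "v' x2 = 0" by simp
  define m where "m = \<bar>M\<bar> powr p"
  have m: "0 < m" using M(1) by (simp add: m_def)
  have first: "(p - 1) * (m * \<bar>v' x\<bar> powr p) = a + b * spow r M * spow r (v x) - P * (m * \<bar>v x\<bar> powr p)"
    if x: "x \<in> {-1..1}" for x
  proof -
    have wv: "w x = M * v x" "w' x = M * v' x" using M(1) by (simp_all add: v_def v'_def)
    show ?thesis
      using w(8)[OF x] unfolding wv lam spow_mult abs_mult by (simp add: powr_mult m_def)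
  qed
  \<comment> \<open>Sum and difference of the relations at the values 1 and -1 separate the even
    coefficient from the odd one.\<close>
  have "0 = a + b * spow r M - P * m" "0 = a - b * spow r M - P * m"
    using first[OF M(2)] first[OF x2(1)] v'x1 v'x2 vx1 x2(2) by (simp_all add: spow_minus)
  then have ab: "a = P * m" "b * spow r M = 0" by linarith+
  have first': "\<bar>v' x\<bar> powr p = L powr p * (1 - \<bar>v x\<bar> powr p)" if x: "x \<in> {-1..1}" for x
  proof -
    have "(p - 1) * m * \<bar>v' x\<bar> powr p = (p - 1) * m * (L powr p * (1 - \<bar>v x\<bar> powr p))"
      using first[OF x] unfolding ab P_def by (simp add: algebra_simps)
    then show ?thesis using m p_ge by simp
  qed
  obtain k where k: "k \<noteq> 0" "\<And>x. x \<in> {-1..1} \<Longrightarrow> v x = k * S x"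
    using arc_unique[OF v vb first' M(2) vx1 x2] by blast
  have "AE x in leb_Omega. w x = (M * k) * S x"
  proof (rule AE_I2)
    fix x assume "x \<in> space leb_Omega"
    then have "v x = k * S x" by (intro k) auto
    then show "w x = (M * k) * S x" using M(1) by (simp add: v_def field_simps)
  qed
  with w(6) have "AE x in leb_Omega. y x = (M * k) * S x" by eventually_elim simp
  then show ?thesis using M(1) k(1) by (intro exI[of _ "M * k"]) auto
qed

section \<open>The saturation threshold\<close>

definition saturated :: "real set" where
  "saturated = {\<alpha>. \<forall>u\<in>W01p_nonzero p. P \<le> Q p r \<alpha> u}"

lemma saturated_iff: "\<alpha> \<in> saturated \<longleftrightarrow> (\<forall>u\<in>W01p_nonzero p. P \<le> Q p r \<alpha> u)"
  by (simp add: saturated_def)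

lemma P_le_Q_iff:
  "u \<in> W01p_nonzero p \<Longrightarrow> P \<le> Q p r \<alpha> u \<longleftrightarrow> P * mass u \<le> dirichlet u + \<alpha> * \<bar>moment u\<bar> powr (p / r)"
  using mass_pos[of u] by (simp add: Q_eq pos_le_divide_eq)

lemma saturated_mono:
  assumes "\<alpha> \<in> saturated" "\<alpha> \<le> \<beta>" shows "\<beta> \<in> saturated"
  unfolding saturated_def
proof (intro CollectI ballI)
  fix u assume u: "u \<in> W01p_nonzero p"
  have "\<alpha> * \<bar>moment u\<bar> powr (p / r) \<le> \<beta> * \<bar>moment u\<bar> powr (p / r)"
    using assms(2) by (intro mult_right_mono) auto
  then show "P \<le> Q p r \<beta> u" using assms(1) u by (auto simp: saturated_def P_le_Q_iff)
qed

lemma saturated_nonempty: "saturated \<noteq> {}"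
proof -
  obtain \<alpha> where "\<forall>u\<in>W01p p. P * mass u \<le> dirichlet u + \<alpha> * \<bar>moment u\<bar> powr (p / r)"
    using large_alpha by blast
  then have "\<alpha> \<in> saturated"
    by (auto simp: saturated_def P_le_Q_iff W01p_nonzero_def)
  then show ?thesis by blast
qed

text \<open>The half wave on the whole interval has Dirichlet quotient P / 2^p. Saturation requires
  its moment term to supply the missing (1 - 2^(-p)) P, which bounds \<alpha> away from
  zero.\<close>

lemma saturated_lower_bound: "\<exists>a>0. \<forall>\<alpha>\<in>saturated. a \<le> \<alpha>"
proof -
  define y where "y x = S (1 / 2 * x + 1 / 2)" for x
  have y: "y \<in> W01p_nonzero p" "dirichlet y = (1 / 2) powr p * P * mass y"
    using S_arc[of "1/2" "1/2"] S_0 S_1 by (simp_all add: y_def[abs_def])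
  define j where "j = \<bar>moment y\<bar> powr (p / r)"
  have j: "0 \<le> j" by (simp add: j_def)
  have "(1 / 2 :: real) powr p < 1" using p_pos powr_less_mono2[of p "1/2" 1] by simp
  then have gap: "0 < (1 - (1 / 2) powr p) * P * mass y" (is "0 < ?g")
    using P_pos mass_pos[OF y(1)] by simp
  show ?thesis
  \<comment> \<open>The denominator j + 1 is positive without knowing that j is.\<close>
  proof (intro exI[of _ "?g / (j + 1)"] conjI ballI)
    show "0 < ?g / (j + 1)" using gap j by simp
    fix \<alpha> assume "\<alpha> \<in> saturated"
    then have "P * mass y \<le> dirichlet y + \<alpha> * j"
      using y(1) by (auto simp: saturated_def P_le_Q_iff j_def)
    then have g: "?g \<le> \<alpha> * j" unfolding y(2) by (simp add: algebra_simps)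
    then have "0 < \<alpha> * j" using gap by linarith
    then have "0 < \<alpha>" using j by (simp add: zero_less_mult_iff)
    then have "\<alpha> * j \<le> \<alpha> * (j + 1)" by (intro mult_left_mono) auto
    then have "?g \<le> \<alpha> * (j + 1)" using g by linarith
    then show "?g / (j + 1) \<le> \<alpha>" using j by (simp add: pos_divide_le_eq)
  qed
qed

text \<open>For fixed u the energy is affine in \<alpha>, so the defining inequality passes to the
  limit and the infimum is attained.\<close>

lemma saturated_Inf: "Inf saturated \<in> saturated"
  unfolding saturated_iff
proof
  fix u assume u: "u \<in> W01p_nonzero p"
  define j where "j = \<bar>moment u\<bar> powr (p / r)"
  have j: "0 \<le> j" by (simp add: j_def)
  have *: "P * mass u \<le> dirichlet u + \<alpha> * j" if gt: "Inf saturated < \<alpha>" for \<alpha>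
  proof -
    obtain s where "s \<in> saturated" "s < \<alpha>" using cInf_lessD[OF saturated_nonempty gt] by blast
    then have "\<alpha> \<in> saturated" using saturated_mono[of s \<alpha>] by simp
    then show ?thesis using u by (auto simp: saturated_def P_le_Q_iff j_def)
  qed
  have "P * mass u \<le> dirichlet u + Inf saturated * j"
  proof (rule ccontr)
    assume n: "\<not> ?thesis"
    define g where "g = P * mass u - (dirichlet u + Inf saturated * j)"
    have g: "0 < g" using n by (simp add: g_def)
    define h where "h = g / (2 * (j + 1))"
    have h: "0 < h" using g j by (simp add: h_def)
    have "h * j \<le> h * (j + 1)" using h by (intro mult_left_mono) auto
    also have "h * (j + 1) = g / 2" using j by (simp add: h_def field_simps)
    finally have "h * j < g" using g by linarith
    moreover have "P * mass u \<le> dirichlet u + (Inf saturated + h) * j" by (rule *) (use h in simp)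
    ultimately show False by (simp add: g_def algebra_simps)
  qed
  then show "P \<le> Q p r (Inf saturated) u" using P_le_Q_iff[OF u] by (simp add: j_def)
qed

text \<open>The moment vanishes because S is odd, so the value of the quotient does not depend on
  \<alpha>.\<close>

lemma Q_sin: 
  assumes y: "\<And>x. x \<in> {-1..1} \<Longrightarrow> y x = k * S x" and k: "k \<noteq> 0"
  shows "Q p r \<alpha> y = P"
  using S_multiple[OF y k] mass_pos[of y] r_pos p_pos by (simp add: Q_eq)

lemma lambda_eig_saturated:
  assumes "\<alpha> \<in> saturated" shows "lambda_eig p r \<alpha> = P"
proof (rule antisym)
  have "S \<in> W01p_nonzero p" "Q p r \<alpha> S = P" using S_multiple[of S 1] Q_sin[of S 1] by simp_all
  then show "lambda_eig p r \<alpha> \<le> P" using lambda_eig_le[of S \<alpha>] by simp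
  show "P \<le> lambda_eig p r \<alpha>"
    unfolding lambda_eig_def using \<open>S \<in> W01p_nonzero p\<close> assms
    by (intro cINF_greatest) (auto simp: saturated_def)
qed

lemma lambda_eig_not_saturated:
  assumes "\<alpha> \<notin> saturated" shows "lambda_eig p r \<alpha> < P"
proof -
  obtain u where "u \<in> W01p_nonzero p" "Q p r \<alpha> u < P" using assms by (auto simp: saturated_def not_le)
  then show ?thesis using lambda_eig_le[of u \<alpha>] by simp
qed

text \<open>With a nonzero moment the energy increases strictly in \<alpha>; equality at \<alpha> is
  then incompatible with the lower bound at the smaller saturated \<beta>.\<close>

lemma saturated_moment_0:
  assumes min: "is_minimizer p r \<alpha> y" and \<beta>: "\<beta> \<in> saturated" "\<beta> < \<alpha>"
  shows "moment y = 0"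
proof (rule ccontr)
  assume n: "moment y \<noteq> 0"
  have y: "y \<in> W01p_nonzero p" using min by (simp add: is_minimizer_def)
  have "Q p r \<alpha> y = P"
    using min lambda_eig_saturated[OF saturated_mono[OF \<beta>(1)], of \<alpha>] \<beta>(2) by (simp add: is_minimizer_def)
  then have "dirichlet y + \<alpha> * \<bar>moment y\<bar> powr (p / r) = P * mass y"
    using mass_pos[OF y] by (simp add: Q_eq field_simps)
  moreover have "P * mass y \<le> dirichlet y + \<beta> * \<bar>moment y\<bar> powr (p / r)"
    using \<beta>(1) y by (auto simp: saturated_def P_le_Q_iff)
  moreover have "\<beta> * \<bar>moment y\<bar> powr (p / r) < \<alpha> * \<bar>moment y\<bar> powr (p / r)"
    using n \<beta>(2) by (intro mult_strict_right_mono) auto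
  ultimately show False by simp
qed

end

theorem theorem1p1:
  fixes p r :: real
  assumes "p \<ge> 2" and "p / 2 \<le> r" and "r \<le> p"
  shows "\<exists>\<alpha>\<^sub>C::real. \<alpha>\<^sub>C > 0 \<and>
    (\<forall>\<alpha>. \<alpha> < \<alpha>\<^sub>C \<longrightarrow>
       lambda_eig p r \<alpha> < pi_p p powr p \<and>
       (\<forall>y. is_minimizer p r \<alpha> y \<longrightarrow> has_constant_sign y)) \<and>
    (\<forall>\<alpha>. \<alpha> \<ge> \<alpha>\<^sub>C \<longrightarrow> lambda_eig p r \<alpha> = pi_p p powr p) \<and>
    (\<forall>\<alpha>. \<alpha> > \<alpha>\<^sub>C \<longrightarrow>
       (let y = (\<lambda>x. sin_p p (pi_p p * x)) in
          is_minimizer p r \<alpha> y \<and>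
          (\<forall>v. is_minimizer p r \<alpha> v \<longrightarrow>
             (\<exists>c. c \<noteq> 0 \<and> (AE x in leb_Omega. v x = c * y x))) \<and>
          (\<forall>x \<in> {-1..1}. y (- x) = - y x) \<and>
          (LINT x|leb_Omega. \<bar>y x\<bar> powr (r - 1) * y x) = 0 \<and>
          (\<forall>x \<in> Omega. y x = 0 \<longleftrightarrow> x = 0)))"
proof -
  interpret exponents p r using assms by unfold_locales
  obtain a where a: "0 < a" "\<And>\<alpha>. \<alpha> \<in> saturated \<Longrightarrow> a \<le> \<alpha>" using saturated_lower_bound by blast
  have bdd: "bdd_below saturated" by (rule bdd_belowI[of _ a]) (rule a(2))
  have le: "\<alpha> \<in> saturated" if "Inf saturated \<le> \<alpha>" for \<alpha>
    by (rule saturated_mono[OF saturated_Inf that])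
  have less: "\<alpha> \<notin> saturated" if "\<alpha> < Inf saturated" for \<alpha>
    using cInf_lower[OF _ bdd, of \<alpha>] that by auto
  define y where "y x = sin_p p (pi_p p * x)" for x
  have y: "y x = c0 * S x" if "x \<in> {-1..1}" for x unfolding y_def by (rule sin_p_eq[OF that])
  have c0: "c0 \<noteq> 0" using c0_pos by simp
  note yS = S_multiple[OF y c0]
  show ?thesis
    unfolding Let_def pi_p_powr y_def[symmetric]
  \<comment> \<open>Below the infimum of the saturated parameters the bound by P fails, and a
    minimizer without constant sign would restore it, a contradiction.\<close>
  proof (rule exI[of _ "Inf saturated"], intro conjI allI impI ballI)
    show "0 < Inf saturated" using cInf_greatest[OF saturated_nonempty a(2)] a(1) by linarith
  next
    fix \<alpha> assume "\<alpha> < Inf saturated"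
    then show lt: "lambda_eig p r \<alpha> < P" by (intro lambda_eig_not_saturated less)
    fix v assume "is_minimizer p r \<alpha> v"
    then show "has_constant_sign v"
      using minimizer_without_constant_sign[of \<alpha> v] lt by (auto simp: P_def)
  next
    fix \<alpha> assume "Inf saturated \<le> \<alpha>"
    then show "lambda_eig p r \<alpha> = P" by (intro lambda_eig_saturated le)
  next
    fix \<alpha> assume gt: "Inf saturated < \<alpha>"
    then have lam: "lambda_eig p r \<alpha> = P" by (intro lambda_eig_saturated le) simp
    then show "is_minimizer p r \<alpha> y" using yS(1) Q_sin[OF y c0] by (simp add: is_minimizer_def)
    fix v assume v: "is_minimizer p r \<alpha> v"
    obtain k where k: "k \<noteq> 0" "AE x in leb_Omega. v x = k * S x"
      using zero_moment_minimizer[OF v lam saturated_moment_0[OF v saturated_Inf gt]] by blast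
    have "AE x in leb_Omega. y x = c0 * S x" using y by (intro AE_I2) auto
    with k(2) have "AE x in leb_Omega. v x = (k / c0) * y x" by eventually_elim (use c0 in simp)
    then show "\<exists>c. c \<noteq> 0 \<and> (AE x in leb_Omega. v x = c * y x)"
      using k(1) c0 by (intro exI[of _ "k / c0"]) auto
  next
    fix x :: real assume "x \<in> {-1..1}"
    then show "y (- x) = - y x" using y[of x] y[of "- x"] S_minus[of x] by simp
  next
    show "(LINT x|leb_Omega. \<bar>y x\<bar> powr (r - 1) * y x) = 0"
      using yS(3) by (simp add: moment_def spow_def)
  next
    fix x assume "x \<in> Omega"
    then show "y x = 0 \<longleftrightarrow> x = 0" using y[of x] S_eq_0_iff[of x] c0 by auto
  qed
qed

end
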